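(* Let $d \in \mathbb{N}$ and $p, p_1, p_2, q \in [1,\infty]$ be such that $\frac1p = \frac1{p_1} + \frac1{p_2}$. For $q > 1$ let $s > d\left(1 - \frac1q\right)$ and for $q = 1$ let $s \geq 0$. Then there is a $C > 0$ such that for any $f \in M_{p_1,q}^s(\mathbb{R}^d)$ and any $g \in M_{p_2,q}^s(\mathbb{R}^d)$ one has $fg \in M_{p,q}^s(\mathbb{R}^d)$ and $$\|fg\|_{M_{p,q}^s(\mathbb{R}^d)} \leq C\, \|f\|_{M_{p_1,q}^s(\mathbb{R}^d)}\, \|g\|_{M_{p_2,q}^s(\mathbb{R}^d)}.$$
   Context: Modulation spaces: fix a window $\gamma \in \mathcal{S}(\mathbb{R}^d)\setminus\{0\}$. For $f \in \mathcal{S}'(\mathbb{R}^d)$ the short-time Fourier transform is $(V_\gamma f)(x,\xi) = (2\pi)^{-d/2}\, \overline{\langle f, M_\xi S_x \gamma\rangle}$, $x,\xi\in\mathbb{R}^d$, where $S_x \gamma(y) = \gamma(y-x)$, $(M_\xi \gamma)(y) = e^{\mathrm{i}\xi\cdot y} \gamma(y)$, and $\langle f, \gamma\rangle = \int \overline{f(y)}\, \gamma(y)\,dy$, extended to $f\in\mathcal{S}'$ (so for nice $f$, $(V_\gamma f)(x,\xi) = (2\pi)^{-d/2}\int f(y)\overline{\gamma(y-x)}e^{-\mathrm{i}\xi\cdot y}\,dy$). With $\langle\xi\rangle = \sqrt{1+|\xi|^2}$, set $\|f\|_{M_{p,q}^s(\mathbb{R}^d)} = \big\| \xi \mapsto \langle\xi\rangle^s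 \|V_\gamma f(\cdot,\xi)\|_{L^p(\mathbb{R}^d)} \big\|_{L^q(\mathbb{R}^d)}$ and $M_{p,q}^s(\mathbb{R}^d) = \{ f \in \mathcal{S}'(\mathbb{R}^d) : \|f\|_{M_{p,q}^s} < \infty\}$, $M_{p,q} := M_{p,q}^0$. Different windows give equivalent norms. The product $fg$ is the pointwise product of functions: under the stated conditions on $q$ and $s$ one has $M_{r,q}^s(\mathbb{R}^d) \hookrightarrow M_{\infty,1}(\mathbb{R}^d) \hookrightarrow C_{\mathrm{b}}(\mathbb{R}^d)$ for every $r \in [1,\infty]$, where $C_{\mathrm{b}}(\mathbb{R}^d)$ is the space of bounded continuous complex-valued functions, so $f$ and $g$ are identified with bounded continuous functions. *)

theory Defs
  imports "HOL-Analysis.Analysis" "HOL-Probability.Essential_Supremum"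
begin

section \<open>Schwartz functions and tempered distributions\<close>

text \<open>A multi-index derivative is encoded by a list of coordinate directions;
  \<open>frechet_derivative f (at x) b\<close> is the partial derivative of \<open>f\<close> at \<open>x\<close> along \<open>b\<close>
  whenever \<open>f\<close> is differentiable at \<open>x\<close>, which \<open>schwartz\<close> demands at every order.\<close>

primrec iter_pderiv :: "'a list \<Rightarrow> ('a::euclidean_space \<Rightarrow> complex) \<Rightarrow> 'a \<Rightarrow> complex" where
  "iter_pderiv [] f = f"
| "iter_pderiv (b # bs) f = (\<lambda>x. frechet_derivative (iter_pderiv bs f) (at x) b)"

definition schwartz :: "('a::euclidean_space \<Rightarrow> complex) set" where
  "schwartz = {\<phi>. \<forall>bs\<in>lists Basis.
     (\<forall>x. iter_pderiv bs \<phi> differentiable (at x)) \<and>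
     (\<forall>k::nat. bounded (range (\<lambda>x. norm x ^ k *\<^sub>R iter_pderiv bs \<phi> x)))}"

definition schwartz_seminorm :: "nat \<Rightarrow> 'a list \<Rightarrow> ('a::euclidean_space \<Rightarrow> complex) \<Rightarrow> real" where
  "schwartz_seminorm k bs \<phi> = (SUP x. norm x ^ k * norm (iter_pderiv bs \<phi> x))"

text \<open>Tempered distributions are the complex-linear functionals on Schwartz functions that are
  continuous, i.e. dominated by finitely many of the seminorms. They are functions on the whole
  type; \<open>extensional\<close> fixes their value off \<open>schwartz\<close>, so that equality of functions is equality
  of distributions.\<close>

definition tempered_distributions :: "(('a::euclidean_space \<Rightarrow> complex) \<Rightarrow> complex) set" where
  "tempered_distributions = {u \<in> extensional schwartz.
     (\<forall>\<phi>\<in>schwartz. \<forall>\<psi>\<in>schwartz. u (\<lambda>x. \<phi> x + \<psi> x) = u \<phi> + u \<psi>) \<and>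
     (\<forall>c. \<forall>\<phi>\<in>schwartz. u (\<lambda>x. c * \<phi> x) = c * u \<phi>) \<and>
     (\<exists>C N. \<forall>\<phi>\<in>schwartz. norm (u \<phi>) \<le>
        C * (\<Sum>k\<le>N. \<Sum>bs\<in>{bs \<in> lists Basis. length bs \<le> N}. schwartz_seminorm k bs \<phi>))}"

definition regular_distribution ::
    "('a::euclidean_space \<Rightarrow> complex) \<Rightarrow> ('a \<Rightarrow> complex) \<Rightarrow> complex" where
  "regular_distribution F = (\<lambda>\<phi>\<in>schwartz. \<integral>x. F x * \<phi> x \<partial>lborel)"

text \<open>The sesquilinear pairing, antilinear in the distribution: for a function \<open>f\<close> it is the
  integral of \<open>cnj f * \<phi>\<close>. The distribution itself acts bilinearly, whence the two conjugations.\<close>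

definition pairing ::
    "(('a::euclidean_space \<Rightarrow> complex) \<Rightarrow> complex) \<Rightarrow> ('a \<Rightarrow> complex) \<Rightarrow> complex" where
  "pairing u \<phi> = cnj (u (\<lambda>x. cnj (\<phi> x)))"

section \<open>Short-time Fourier transform\<close>

definition translation :: "'a::euclidean_space \<Rightarrow> ('a \<Rightarrow> complex) \<Rightarrow> 'a \<Rightarrow> complex" where
  "translation x \<gamma> = (\<lambda>y. \<gamma> (y - x))"

definition modulation :: "'a::euclidean_space \<Rightarrow> ('a \<Rightarrow> complex) \<Rightarrow> 'a \<Rightarrow> complex" where
  "modulation \<xi> \<gamma> = (\<lambda>y. exp (\<i> * complex_of_real (\<xi> \<bullet> y)) * \<gamma> y)"

definition stft ::
    "('a::euclidean_space \<Rightarrow> complex) \<Rightarrow> (('a \<Rightarrow> complex) \<Rightarrow> complex) \<Rightarrow> 'a \<Rightarrow> 'a \<Rightarrow> complex" where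
  "stft \<gamma> u x \<xi> = complex_of_real ((2 * pi) powr (- real DIM('a) / 2)) *
     cnj (pairing u (modulation \<xi> (translation x \<gamma>)))"

lemma pairing_regular_distribution:
  assumes "(\<lambda>y. cnj (\<phi> y)) \<in> schwartz"
  shows "pairing (regular_distribution f) \<phi> = (\<integral>y. cnj (f y) * \<phi> y \<partial>lborel)"
proof -
  have "pairing (regular_distribution f) \<phi> = cnj (\<integral>y. f y * cnj (\<phi> y) \<partial>lborel)"
    using assms by (simp add: pairing_def regular_distribution_def)
  also have "\<dots> = (\<integral>y. cnj (f y * cnj (\<phi> y)) \<partial>lborel)"
    by (rule Bochner_Integration.integral_cnj [symmetric])
  finally show ?thesis
    by simp
qed

lemma stft_regular_distribution:
  fixes \<gamma> :: "'a::euclidean_space \<Rightarrow> complex"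
  assumes "(\<lambda>y. cnj (modulation \<xi> (translation x \<gamma>) y)) \<in> schwartz"
  shows "stft \<gamma> (regular_distribution f) x \<xi> =
    complex_of_real ((2 * pi) powr (- real DIM('a) / 2)) *
      (\<integral>y. f y * cnj (\<gamma> (y - x)) * exp (- \<i> * complex_of_real (\<xi> \<bullet> y)) \<partial>lborel)"
  using assms
  by (simp add: stft_def pairing_def regular_distribution_def modulation_def translation_def
      exp_cnj mult_ac)

section \<open>Lebesgue norms with values in the extended nonnegative reals\<close>

text \<open>Only used with exponents \<open>r > 0\<close>.\<close>

definition ennreal_powr :: "ennreal \<Rightarrow> real \<Rightarrow> ennreal" where
  "ennreal_powr t r = (if t = \<infinity> then \<infinity> else ennreal (enn2real t powr r))"

text \<open>The argument is the (possibly infinite) modulus of the function.\<close>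

definition Lp_norm :: "ennreal \<Rightarrow> ('a::euclidean_space \<Rightarrow> ennreal) \<Rightarrow> ennreal" where
  "Lp_norm p F =
     (if p = \<infinity> then esssup lborel F
      else ennreal_powr (\<integral>\<^sup>+x. ennreal_powr (F x) (enn2real p) \<partial>lborel) (1 / enn2real p))"

section \<open>Modulation spaces\<close>

definition japanese_bracket :: "'a::euclidean_space \<Rightarrow> real" where
  "japanese_bracket \<xi> = sqrt (1 + (norm \<xi>)\<^sup>2)"

definition modulation_norm :: "('a::euclidean_space \<Rightarrow> complex) \<Rightarrow> ennreal \<Rightarrow> ennreal \<Rightarrow> real \<Rightarrow>
    (('a \<Rightarrow> complex) \<Rightarrow> complex) \<Rightarrow> ennreal" where
  "modulation_norm \<gamma> p q s u =
     Lp_norm q (\<lambda>\<xi>. ennreal (japanese_bracket \<xi> powr s) *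
       Lp_norm p (\<lambda>x. ennreal (norm (stft \<gamma> u x \<xi>))))"

definition modulation_space :: "('a::euclidean_space \<Rightarrow> complex) \<Rightarrow> ennreal \<Rightarrow> ennreal \<Rightarrow> real \<Rightarrow>
    (('a \<Rightarrow> complex) \<Rightarrow> complex) set" where
  "modulation_space \<gamma> p q s = {u \<in> tempered_distributions. modulation_norm \<gamma> p q s u < \<infinity>}"

text \<open>Identification of a distribution with the bounded continuous function inducing it, and the
  resulting pointwise product. This is meaningful only for distributions induced by such a function
  (which is then unique).\<close>

definition cb_function ::
    "(('a::euclidean_space \<Rightarrow> complex) \<Rightarrow> complex) \<Rightarrow> 'a \<Rightarrow> complex" where
  "cb_function u = (THE F. F \<in> bcontfun \<and> u = regular_distribution F)"

definition distr_product :: "(('a::euclidean_space \<Rightarrow> complex) \<Rightarrow> complex) \<Rightarrow>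
    (('a \<Rightarrow> complex) \<Rightarrow> complex) \<Rightarrow> ('a \<Rightarrow> complex) \<Rightarrow> complex" where
  "distr_product u v = regular_distribution (\<lambda>x. cb_function u x * cb_function v x)"

end

theory Submission
  imports Defs
begin

text \<open>
  Let \<open>V f\<close> be the short-time Fourier transform of \<open>f\<close>. If \<open>V f (z, \<eta>)\<close> is
  integrable against \<open>\<gamma> (y - z)\<close>, Fourier inversion shows that \<open>f\<close> is the bounded continuous function
  \<open>f y = K \<integral>\<integral> V f (z, \<eta>) e\<^sup>i\<^sup>\<eta>\<^sup>y \<gamma> (y - z) dz d\<eta>\<close>; the only delicate point is to move the distribution under
  the integral, which is done by Riemann sums converging in finitely many seminorms at once.
  Hoelder's inequality with the weight \<open>\<langle>\<eta>\<rangle>\<^sup>-\<^sup>s\<close> (here \<open>s > d (1 - 1/q)\<close> enters) makes the representation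
  available. Substituting it for both factors,
  \<open>V (f g) (x, \<xi>)\<close> becomes the integral of \<open>V f (z, \<eta>) V g (w, \<zeta>)\<close> against the Fourier transform at
  \<open>\<eta> + \<zeta> - \<xi>\<close> of \<open>\<gamma> (y - z) \<gamma> (y - w) cnj (\<gamma> (y - x))\<close>, which decays rapidly in \<open>x - z\<close>,
  \<open>x - w\<close> and \<open>\<xi> - \<eta> - \<zeta>\<close>. Minkowski's integral inequality and Hoelder's inequality in \<open>x\<close>
  reduce the claim to a weighted convolution inequality in the frequency variable, which follows from
  Young's inequality and \<open>\<langle>\<eta> + \<zeta>\<rangle>\<^sup>s \<le> 2\<^sup>s (\<langle>\<eta>\<rangle>\<^sup>s + \<langle>\<zeta>\<rangle>\<^sup>s)\<close>.
\<close>

subsection \<open>Powers and Lebesgue norms with values in the extended reals\<close>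

text \<open>In a convolution of weighted \<open>L^q\<close> functions one factor carries the weight
  and the other has to be integrable; the embedding into \<open>L^1\<close> that permits the
  reconstruction supplies this as well, so one constant \<open>D\<close> serves both purposes.
  Analysis and synthesis use the same \<gamma>, hence the norms that come out are those of the
  statement. The product is defined through \<open>cb_function\<close>, a definite description:
  besides existence of a bounded continuous representative its uniqueness is needed, and both rest
  on Fourier inversion. The main obstacle is that Schwartz functions form a bare set and a tempered
  distribution is only linear and dominated by seminorms, so there is no space in which to integrate
  a family of test functions. Each seminorm is therefore realised as the norm of an element of a
  Banach space of bounded continuous functions; the finitely many that control a given distribution
  suffice. Norms take values in \<open>ennreal\<close>, so Tonelli and Minkowski apply before
  anything is known to be finite; the measurability they ask for comes from joint continuity of the
  short-time Fourier transform.\<close>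

lemma ennreal_powr_top [simp]: "ennreal_powr top r = top"
  by (simp add: ennreal_powr_def infinity_ennreal_def)

lemma ennreal_powr_ennreal [simp]: "0 \<le> x \<Longrightarrow> ennreal_powr (ennreal x) r = ennreal (x powr r)"
  by (simp add: ennreal_powr_def infinity_ennreal_def)

lemma ennreal_powr_0 [simp]: "ennreal_powr 0 r = 0"
  by (simp add: ennreal_powr_def infinity_ennreal_def)

lemma ennreal_powr_1 [simp]: "ennreal_powr 1 r = 1"
  by (simp add: ennreal_powr_def infinity_ennreal_def)

lemma ennreal_powr_by_1 [simp]: "ennreal_powr t 1 = t"
  by (cases t) (auto simp: ennreal_powr_def infinity_ennreal_def)

lemma ennreal_powr_mono: "t \<le> t' \<Longrightarrow> 0 \<le> r \<Longrightarrow> ennreal_powr t r \<le> ennreal_powr t' r"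
  by (cases t; cases t') (auto simp: ennreal_le_iff top_unique intro!: ennreal_leI powr_mono2)

lemma ennreal_powr_mult: 
  assumes "0 < r" shows "ennreal_powr (a * b) r = ennreal_powr a r * ennreal_powr b r"
proof (cases a)
  case (real x)
  show ?thesis
  proof (cases b)
    case (real y)
    with \<open>a = ennreal x\<close> \<open>0 \<le> x\<close> show ?thesis
      by (simp add: ennreal_mult[symmetric] powr_mult)
  next
    case top
    with real assms show ?thesis
      by (cases "x = 0") (auto simp: ennreal_mult_top)
  qed
next
  case top
  then show ?thesis using assms
    by (cases b; cases "b = 0") (auto simp: ennreal_top_mult)
qed

lemma ennreal_powr_powr: "ennreal_powr (ennreal_powr t r) s = ennreal_powr t (r * s)"
  by (cases t) (auto simp: powr_powr)

lemma ennreal_powr_add: 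
  assumes "0 < r" "0 < s" shows "ennreal_powr t r * ennreal_powr t s = ennreal_powr t (r + s)"
  by (cases t) (auto simp: powr_add ennreal_mult[symmetric])

lemma ennreal_powr_eq_0_iff [simp]: "ennreal_powr t r = 0 \<longleftrightarrow> t = 0"
  by (cases t) auto

lemma ennreal_powr_eq_top_iff [simp]: "ennreal_powr t r = top \<longleftrightarrow> t = top"
  by (cases t) auto

lemma measurable_ennreal_powr [measurable]:
  assumes [measurable]: "f \<in> borel_measurable M"
  shows "(\<lambda>x. ennreal_powr (f x) r) \<in> borel_measurable M"
  unfolding ennreal_powr_def by measurable

text \<open>Weighted arithmetic-geometric mean inequality, with weights summing to 1 instead of
  conjugate exponents, so that it integrates directly to Hoelder's inequality.\<close>

lemma ennreal_Young:
  assumes "0 < \<alpha>" "0 < \<beta>" "\<alpha> + \<beta> = 1"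
  shows "ennreal_powr a \<alpha> * ennreal_powr b \<beta> \<le> ennreal \<alpha> * a + ennreal \<beta> * b"
proof (cases "a = top \<or> b = top")
  case True
  then show ?thesis using assms by (auto simp: ennreal_mult_top)
next
  case False
  then obtain x y where "a = ennreal x" "b = ennreal y" "0 \<le> x" "0 \<le> y"
    by (metis ennreal_cases)
  then show ?thesis 
    using Youngs_inequality_0[of \<alpha> \<beta> x y] assms
    by (cases "x = 0 \<or> y = 0")
      (auto simp: ennreal_mult[symmetric] ennreal_plus[symmetric] simp del: ennreal_plus) 
qed

text \<open>Both functions are normalised to integral 1; Young's inequality then integrates to
  \<open>\<alpha> + \<beta> = 1\<close>. The normalisation divides by the two integrals, so the
  values 0 and \<open>top\<close> are split off first.\<close>

lemma nn_integral_Holder: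
  assumes [measurable]: "f \<in> borel_measurable M" "g \<in> borel_measurable M"
    and ab: "0 < \<alpha>" "0 < \<beta>" "\<alpha> + \<beta> = 1"
  shows "(\<integral>\<^sup>+x. ennreal_powr (f x) \<alpha> * ennreal_powr (g x) \<beta> \<partial>M)
    \<le> ennreal_powr (\<integral>\<^sup>+x. f x \<partial>M) \<alpha> * ennreal_powr (\<integral>\<^sup>+x. g x \<partial>M) \<beta>"
proof -
  define X Y where "X = (\<integral>\<^sup>+x. f x \<partial>M)" and "Y = (\<integral>\<^sup>+x. g x \<partial>M)"
  consider "X = 0 \<or> Y = 0" | "X \<noteq> 0" "Y \<noteq> 0" "X = top \<or> Y = top" 
    | "X \<noteq> 0" "Y \<noteq> 0" "X \<noteq> top" "Y \<noteq> top" by blast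
  then show ?thesis
  proof cases
    case 1
    then have "(AE x in M. f x = 0) \<or> (AE x in M. g x = 0)"
      by (simp add: X_def Y_def nn_integral_0_iff_AE)
    then have "AE x in M. ennreal_powr (f x) \<alpha> * ennreal_powr (g x) \<beta> = 0" by auto
    then show ?thesis by (simp add: nn_integral_0_iff_AE[THEN iffD2])
  next
    case 2
    then have "ennreal_powr X \<alpha> * ennreal_powr Y \<beta> = top"
      by (auto simp: ennreal_mult_eq_top_iff)
    then show ?thesis by (simp add: X_def Y_def)
  next
    case 3
    have iX: "inverse X * X = 1" "inverse Y * Y = 1"
      using 3 ennreal_divide_self[of X] ennreal_divide_self[of Y]
      by (simp_all add: divide_ennreal_def mult.commute less_top)
    have "(\<integral>\<^sup>+x. ennreal_powr (f x) \<alpha> * ennreal_powr (g x) \<beta> \<partial>M) 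
      = (\<integral>\<^sup>+x. (ennreal_powr X \<alpha> * ennreal_powr Y \<beta>) *
           (ennreal_powr (inverse X * f x) \<alpha> * ennreal_powr (inverse Y * g x) \<beta>) \<partial>M)"
    proof (rule nn_integral_cong)
      fix x
      have "ennreal_powr (f x) \<alpha> = ennreal_powr X \<alpha> * ennreal_powr (inverse X * f x) \<alpha>"
        "ennreal_powr (g x) \<beta> = ennreal_powr Y \<beta> * ennreal_powr (inverse Y * g x) \<beta>"
        using iX ab by (simp_all add: ennreal_powr_mult[symmetric] mult.assoc[symmetric] 
            mult.commute[of X] mult.commute[of Y])
      then show "ennreal_powr (f x) \<alpha> * ennreal_powr (g x) \<beta> = 
          (ennreal_powr X \<alpha> * ennreal_powr Y \<beta>) *
           (ennreal_powr (inverse X * f x) \<alpha> * ennreal_powr (inverse Y * g x) \<beta>)"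
        by (simp only: mult_ac)
    qed
    also have "\<dots> \<le> (\<integral>\<^sup>+x. (ennreal_powr X \<alpha> * ennreal_powr Y \<beta>) *
           (ennreal \<alpha> * (inverse X * f x) + ennreal \<beta> * (inverse Y * g x)) \<partial>M)"
      by (intro nn_integral_mono mult_left_mono ennreal_Young ab) auto
    also have "\<dots> = (ennreal_powr X \<alpha> * ennreal_powr Y \<beta>) * 
        (ennreal \<alpha> * (inverse X * X) + ennreal \<beta> * (inverse Y * Y))"
      by (simp add: nn_integral_cmult nn_integral_add X_def Y_def)
    also have "\<dots> = ennreal_powr X \<alpha> * ennreal_powr Y \<beta>"
      using ab iX by (simp add: ennreal_plus[symmetric] del: ennreal_plus)
    finally show ?thesis by (simp add: X_def Y_def)
  qed
qed

section \<open>Lebesgue norms: Hoelder, Minkowski and translation invariance\<close>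

lemma Lp_norm_top: "Lp_norm top F = esssup lborel F"
  by (simp add: Lp_norm_def infinity_ennreal_def)

lemma Lp_norm_ennreal: "0 \<le> r \<Longrightarrow>
    Lp_norm (ennreal r) F = ennreal_powr (\<integral>\<^sup>+x. ennreal_powr (F x) r \<partial>lborel) (1 / r)"
  by (simp add: Lp_norm_def infinity_ennreal_def)

lemma Lp_norm_1: "Lp_norm 1 F = (\<integral>\<^sup>+x. F x \<partial>lborel)"
  using Lp_norm_ennreal[of 1 F] by simp

lemma ennreal_ge_1_cases:
  fixes p :: ennreal
  assumes "1 \<le> p"
  obtains (top) "p = top" | (real) r where "p = ennreal r" "1 \<le> r"
  using assms by (cases p) (auto simp: ennreal_1[symmetric] simp del: ennreal_1)

lemma ennreal_ge_1_finite: "1 \<le> p \<Longrightarrow> p \<noteq> top \<Longrightarrow> \<exists>r. p = ennreal r \<and> 1 \<le> r"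
  by (metis ennreal_ge_1_cases)

lemma powr_Lp_norm: "0 < r \<Longrightarrow>
    ennreal_powr (Lp_norm (ennreal r) F) r = (\<integral>\<^sup>+x. ennreal_powr (F x) r \<partial>lborel)"
  by (simp add: Lp_norm_ennreal ennreal_powr_powr)

text \<open>Only the smaller function has to be measurable: \<open>esssup\<close> of a
  non-measurable function is \<open>top\<close>, which is harmless on the right-hand side.\<close>

lemma Lp_norm_AE_mono:
  assumes "1 \<le> p" and [measurable]: "F \<in> borel_measurable borel" 
    and le: "AE x in lborel. F x \<le> G x"
  shows "Lp_norm p F \<le> Lp_norm p G"
  using \<open>1 \<le> p\<close>
proof (cases rule: ennreal_ge_1_cases)
  case top
  then show ?thesis using le by (auto simp: Lp_norm_top intro!: esssup_AE_mono)
next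
  case (real r)
  have "(\<integral>\<^sup>+x. ennreal_powr (F x) r \<partial>lborel) \<le> (\<integral>\<^sup>+x. ennreal_powr (G x) r \<partial>lborel)"
    using le real by (intro nn_integral_mono_AE) (auto elim!: eventually_mono intro: ennreal_powr_mono)
  then show ?thesis using real by (auto simp: Lp_norm_ennreal intro!: ennreal_powr_mono)
qed

lemma Lp_norm_mono:
  assumes "1 \<le> p" "F \<in> borel_measurable borel" "\<And>x. F x \<le> G x"
  shows "Lp_norm p F \<le> Lp_norm p G"
  using assms by (intro Lp_norm_AE_mono) auto

lemma Lp_norm_leI:
  assumes "1 \<le> r" "(\<integral>\<^sup>+x. ennreal_powr (F x) r \<partial>lborel) \<le> ennreal_powr S r"
  shows "Lp_norm (ennreal r) F \<le> S"
proof -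
  have "Lp_norm (ennreal r) F \<le> ennreal_powr (ennreal_powr S r) (1 / r)"
    using assms by (auto simp: Lp_norm_ennreal intro!: ennreal_powr_mono)
  then show ?thesis using assms by (simp add: ennreal_powr_powr)
qed

lemma Lp_norm_cmult_le:
  assumes "1 \<le> p" and [measurable]: "F \<in> borel_measurable borel"
  shows "Lp_norm p (\<lambda>x. c * F x) \<le> c * Lp_norm p F"
  using \<open>1 \<le> p\<close>
proof (cases rule: ennreal_ge_1_cases)
  case top
  have "AE x in lborel. c * F x \<le> c * esssup lborel F"
    using esssup_AE[of F lborel] by eventually_elim (auto intro: mult_left_mono)
  then show ?thesis using top by (auto simp: Lp_norm_top intro!: esssup_I)
next
  case (real r)
  then show ?thesis
    by (auto intro!: Lp_norm_leI simp: ennreal_powr_mult powr_Lp_norm nn_integral_cmult)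
qed

lemma Lp_norm_eq_0_AE:
  assumes "1 \<le> p" and [measurable]: "F \<in> borel_measurable borel" and 0: "Lp_norm p F = 0"
  shows "AE x in lborel. F x = 0"
  using \<open>1 \<le> p\<close>
proof (cases rule: ennreal_ge_1_cases)
  case top
  then show ?thesis using 0 esssup_AE[of F lborel] by (simp add: Lp_norm_top)
next
  case (real r)
  then show ?thesis using 0 by (simp add: Lp_norm_ennreal nn_integral_0_iff_AE)
qed

lemma ennreal_inverse_real: "0 < r \<Longrightarrow> 1 / ennreal r = ennreal (1 / r)"
  by (metis divide_ennreal ennreal_1 zero_le_one)

lemma ennreal_inverse_inverse: "inverse (inverse x) = (x :: ennreal)"
proof (cases x)
  case (real r)
  then show ?thesis by (cases "r = 0") (simp_all add: inverse_ennreal)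
qed simp

text \<open>After raising to the power \<open>r0\<close> the integrand is a product of the powers
  \<open>r0 / r1\<close> and \<open>r0 / r2\<close> of \<open>F^r1\<close> and \<open>G^r2\<close>,
  and the exponent relation says that these weights sum to 1. If \<open>p1\<close> or
  \<open>p2\<close> is infinite, the relation forces \<open>p\<close> to equal the other exponent,
  and the essential supremum is pulled out.\<close>

lemma Lp_norm_Holder:
  assumes p: "1 \<le> p" "1 \<le> p1" "1 \<le> p2" and eq: "1 / p = 1 / p1 + 1 / p2"
    and [measurable]: "F \<in> borel_measurable borel" "G \<in> borel_measurable borel"
  shows "Lp_norm p (\<lambda>x. F x * G x) \<le> Lp_norm p1 F * Lp_norm p2 G"
proof -
  have *: "Lp_norm p (\<lambda>x. F x * G x) \<le> esssup lborel F * Lp_norm p G" 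
    if [measurable]: "F \<in> borel_measurable borel" "G \<in> borel_measurable borel" for F G :: "'a \<Rightarrow> ennreal"
  proof -
    have "Lp_norm p (\<lambda>x. F x * G x) \<le> Lp_norm p (\<lambda>x. esssup lborel F * G x)"
      using esssup_AE[of F lborel] 
      by (intro Lp_norm_AE_mono p) (auto intro: mult_right_mono elim!: eventually_mono)
    also have "\<dots> \<le> esssup lborel F * Lp_norm p G"
      by (rule Lp_norm_cmult_le) (use p in auto)
    finally show ?thesis .
  qed
  have inj: "a = b" if "1 / a = 1 / b" for a b :: ennreal
  proof -
    have "inverse a = inverse b" using that by (simp add: divide_ennreal_def)
    then show ?thesis
      by (metis ennreal_inverse_inverse)
  qed
  show ?thesis
  proof (cases "p1 = top")
    case True
    have "p = p2" by (rule inj) (use eq True in simp)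
    then show ?thesis using *[of F G] True by (simp add: Lp_norm_top)
  next
    case p1: False
    show ?thesis
    proof (cases "p2 = top")
      case True
      have "p = p1" by (rule inj) (use eq True in simp)
      then show ?thesis using *[of G F] True by (simp add: Lp_norm_top mult.commute)
    next
      case False
      obtain r1 r2 where r: "p1 = ennreal r1" "p2 = ennreal r2" "1 \<le> r1" "1 \<le> r2"
        using ennreal_ge_1_finite[OF p(2) p1] ennreal_ge_1_finite[OF p(3) False] by blast
      have ip: "1 / p = ennreal (1 / r1 + 1 / r2)"
        using eq r by (simp add: ennreal_inverse_real ennreal_plus[symmetric] del: ennreal_plus)
      moreover have "1 / r1 + 1 / r2 > 0" using r by (intro add_pos_pos) simp_all
      ultimately have "p \<noteq> top" by auto
      then obtain r0 where r0: "p = ennreal r0" "1 \<le> r0"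
        using ennreal_ge_1_finite[OF p(1)] by blast
      have "ennreal (1 / r0) = ennreal (1 / r1 + 1 / r2)"
        using r r0 ip by (simp add: ennreal_inverse_real)
      then have "1 / r0 = 1 / r1 + 1 / r2"
        using r r0 by (subst (asm) ennreal_inj) auto
      then have "r0 * (1 / r1 + 1 / r2) = r0 * (1 / r0)" by simp
      also have "\<dots> = 1" using r0 by simp
      finally have "r0 * (1 / r1 + 1 / r2) = 1" .
      then have sum1: "r0 / r1 + r0 / r2 = 1" by (simp add: distrib_left)
      show ?thesis unfolding r0(1)
      proof (rule Lp_norm_leI[OF r0(2)])
        have "(\<integral>\<^sup>+x. ennreal_powr (F x * G x) r0 \<partial>lborel) =
          (\<integral>\<^sup>+x. ennreal_powr (ennreal_powr (F x) r1) (r0 / r1) * 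
             ennreal_powr (ennreal_powr (G x) r2) (r0 / r2) \<partial>lborel)"
          using r r0 by (intro nn_integral_cong) (simp add: ennreal_powr_powr ennreal_powr_mult)
        also have "\<dots> \<le> ennreal_powr (\<integral>\<^sup>+x. ennreal_powr (F x) r1 \<partial>lborel) (r0 / r1) * 
            ennreal_powr (\<integral>\<^sup>+x. ennreal_powr (G x) r2 \<partial>lborel) (r0 / r2)"
          using r r0 sum1 by (intro nn_integral_Holder) auto
        also have "\<dots> = ennreal_powr (Lp_norm p1 F * Lp_norm p2 G) r0"
          using r r0 by (simp add: powr_Lp_norm[symmetric] ennreal_powr_mult ennreal_powr_powr)
        finally show "(\<integral>\<^sup>+x. ennreal_powr (F x * G x) r0 \<partial>lborel) \<le> \<dots>" .
      qed
    qed
  qed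
qed

text \<open>For the essential supremum, \<open>y < esssup\<close> holds exactly when the section
  \<open>{x. y < F t x}\<close> has nonzero measure, and the measure of a section depends measurably
  on the parameter.\<close>

lemma measurable_Lp_norm:
  fixes F :: "'b \<Rightarrow> 'a::euclidean_space \<Rightarrow> ennreal"
  assumes "1 \<le> p" and [measurable]: "case_prod F \<in> borel_measurable (N \<Otimes>\<^sub>M borel)"
  shows "(\<lambda>t. Lp_norm p (F t)) \<in> borel_measurable N"
proof -
  have m[measurable]: "case_prod F \<in> borel_measurable (N \<Otimes>\<^sub>M lborel)"
    using assms(2) by (simp cong: measurable_cong_sets)
  interpret sigma_finite_measure "lborel :: 'a measure" by (rule sigma_finite_lborel)
  show ?thesis using \<open>1 \<le> p\<close>
  proof (cases rule: ennreal_ge_1_cases)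
    case top
    have "(\<lambda>t. esssup lborel (F t)) \<in> borel_measurable N"
    proof (rule borel_measurableI_greater)
      fix y :: ennreal
      have "{t \<in> space N. y < esssup lborel (F t)} = 
          {t \<in> space N. emeasure lborel {x\<in>space lborel. y < F t x} \<noteq> 0}"
      proof (intro Collect_cong conj_cong refl)
        fix t assume t: "t \<in> space N"
        have [measurable]: "F t \<in> borel_measurable lborel"
          using measurable_Pair2[OF m t] by simp
        have "(esssup lborel (F t) \<le> y) \<longleftrightarrow> (AE x in lborel. F t x \<le> y)"
          using esssup_AE[of "F t" lborel]
          by (auto intro: esssup_I elim!: eventually_elim2)
        also have "\<dots> \<longleftrightarrow> emeasure lborel {x\<in>space lborel. y < F t x} = 0"
          by (subst AE_iff_measurable[OF _ refl]) (auto simp: not_le)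
        finally show "(y < esssup lborel (F t)) = (emeasure lborel {x\<in>space lborel. y < F t x} \<noteq> 0)"
          by (auto simp: not_le[symmetric])
      qed
      also have "\<dots> \<in> sets N" by measurable
      finally show "{t \<in> space N. y < esssup lborel (F t)} \<in> sets N" .
    qed
    then show ?thesis using top by (simp add: Lp_norm_top)
  next
    case (real r)
    then show ?thesis by (simp add: Lp_norm_ennreal)
  qed
qed

text \<open>No duality is used. With \<open>a t\<close> the norm of \<open>F\<close> at
  \<open>t\<close> and \<open>b = a^(1 - r)\<close>, the integrand is
  \<open>(F^r * b)^(1/r) * a^(1 - 1/r)\<close>. Hoelder in \<open>t\<close> gives the factor
  \<open>S^(r - 1)\<close>, and Tonelli turns what is left into the integral of
  \<open>a^r * b\<close>, which is at most \<open>S\<close>. Finiteness of the left-hand side is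
  never presupposed.\<close>

lemma Minkowski_integral:
  fixes F :: "'a::euclidean_space \<Rightarrow> 'b \<Rightarrow> ennreal"
  assumes p: "1 \<le> p" and N: "sigma_finite_measure N"
    and m: "case_prod F \<in> borel_measurable (borel \<Otimes>\<^sub>M N)"
  shows "Lp_norm p (\<lambda>x. \<integral>\<^sup>+t. F x t \<partial>N) \<le> (\<integral>\<^sup>+t. Lp_norm p (\<lambda>x. F x t) \<partial>N)"
proof -
  interpret sigma_finite_measure N by fact
  interpret L: sigma_finite_measure "lborel :: 'a measure" by (rule sigma_finite_lborel)
  interpret pair_sigma_finite "lborel :: 'a measure" N ..
  have m'[measurable]: "case_prod F \<in> borel_measurable (lborel \<Otimes>\<^sub>M N)"
    "case_prod F \<in> borel_measurable (borel \<Otimes>\<^sub>M N)"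
    using m by (simp_all cong: measurable_cong_sets)
  have ms[measurable]: "(\<lambda>(t, x). F x t) \<in> borel_measurable (N \<Otimes>\<^sub>M borel)"
    "(\<lambda>(t, x). F x t) \<in> borel_measurable (N \<Otimes>\<^sub>M lborel)" by measurable
  define a where "a = (\<lambda>t. Lp_norm p (\<lambda>x. F x t))"
  have [measurable]: "a \<in> borel_measurable N"
    unfolding a_def by (rule measurable_Lp_norm) (use p in auto)
  have mfs: "(\<lambda>x. F (fst x) (snd x)) \<in> borel_measurable (lborel \<Otimes>\<^sub>M N)"
    using m' by (simp add: split_beta')
  have mt: "(\<lambda>x. F x t) \<in> borel_measurable borel" if "t \<in> space N" for t
    using measurable_Pair2[OF ms(1) that] by simp
  show ?thesis using p
  proof (cases rule: ennreal_ge_1_cases)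
    case top
    have "AE t in N. AE x in lborel. F x t \<le> a t"
      unfolding a_def top Lp_norm_top by (intro AE_I2 esssup_AE)
    then have "AE x in lborel. AE t in N. F x t \<le> a t"
      using AE_commute[OF borel_measurable_le[OF mfs measurable_compose[OF measurable_snd \<open>a \<in> borel_measurable N\<close>]]]
      by simp
    then have "AE x in lborel. (\<integral>\<^sup>+t. F x t \<partial>N) \<le> (\<integral>\<^sup>+t. a t \<partial>N)"
      by eventually_elim (rule nn_integral_mono_AE)
    then have "esssup lborel (\<lambda>x. \<integral>\<^sup>+t. F x t \<partial>N) \<le> (\<integral>\<^sup>+t. a t \<partial>N)"
      by (intro esssup_I) auto
    then show ?thesis unfolding a_def top Lp_norm_top .
  next
    case (real r)
    define S where "S = (\<integral>\<^sup>+t. a t \<partial>N)"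
    have "Lp_norm p (\<lambda>x. \<integral>\<^sup>+t. F x t \<partial>N) \<le> S"
    proof (cases "r = 1 \<or> S = top")
      case True
      then show ?thesis
      proof
        assume "r = 1"
        then have "p = 1" using real by simp
        have "(\<integral>\<^sup>+x. \<integral>\<^sup>+t. F x t \<partial>N \<partial>lborel) = (\<integral>\<^sup>+t. \<integral>\<^sup>+x. F x t \<partial>lborel \<partial>N)"
          by (rule Fubini'[symmetric]) auto
        then show ?thesis by (simp add: S_def a_def \<open>p = 1\<close> Lp_norm_1)
      qed auto
    next
      case False
      then have r: "1 < r" and S: "S \<noteq> top" using real by auto
      define b where "b = (\<lambda>t. inverse (ennreal_powr (a t) (r - 1)))"
      have [measurable]: "b \<in> borel_measurable N" unfolding b_def by measurable
      have afin: "AE t in N. a t \<noteq> top"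
        using nn_integral_PInf_AE[of a N] S by (simp add: S_def)
      \<comment> \<open>The powers of \<open>a t\<close> cancel if \<open>a t\<close> is finite and
        nonzero. If \<open>a t = 0\<close>, the right-hand side is 0 while \<open>F x t\<close>
        vanishes for almost every \<open>x\<close> only; hence the nested almost-everywhere form,
        whose quantifiers \<open>AE1\<close> exchanges.\<close>
      have AE0: "AE t in N. AE x in lborel. F x t \<le> ennreal_powr (ennreal_powr (F x t) r * b t) (1/r) 
                * ennreal_powr (a t) (1 - 1/r)"
      proof (rule AE_mp[OF afin], rule AE_I2, rule impI)
        fix t assume t: "t \<in> space N" "a t \<noteq> top"
        show "AE x in lborel. F x t \<le> ennreal_powr (ennreal_powr (F x t) r * b t) (1/r) 
                * ennreal_powr (a t) (1 - 1/r)"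
        proof (cases "a t = 0")
          case True
          then have "AE x in lborel. F x t = 0"
            using mt[OF t(1)] p unfolding a_def by (intro Lp_norm_eq_0_AE) auto
          then show ?thesis by eventually_elim auto
        next
          case False
          then obtain c where c: "a t = ennreal c" "0 < c" using t
            by (metis ennreal_cases ennreal_0 less_eq_real_def)
          have "1/r * r = 1" "(1/r) * (1 - r) = 1/r - 1" using r by (auto simp: field_simps)
          have "ennreal_powr (b t) (1/r) * ennreal_powr (a t) (1 - 1/r) = 
              ennreal (inverse (c powr (r-1)) powr (1/r) * c powr (1 - 1/r))"
            using c r by (simp add: b_def inverse_ennreal ennreal_mult)
          also have "inverse (c powr (r-1)) powr (1/r) * c powr (1 - 1/r) = c powr ((1-r)*(1/r) + (1 - 1/r))"
            unfolding powr_add powr_powr[symmetric] using c 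
            by (simp add: powr_minus[symmetric])
          also have "(1-r)*(1/r) + (1 - 1/r) = 0" using r by (simp add: field_simps)
          finally have "ennreal_powr (b t) (1/r) * ennreal_powr (a t) (1 - 1/r) = 1"
            using c by simp
          then have "ennreal_powr (ennreal_powr (F x t) r * b t) (1/r) 
                * ennreal_powr (a t) (1 - 1/r) = F x t" for x
            using r by (simp add: ennreal_powr_mult ennreal_powr_powr mult.assoc)
          then show ?thesis by simp
        qed
      qed
      have AE1: "AE x in lborel. AE t in N. F x t \<le> ennreal_powr (ennreal_powr (F x t) r * b t) (1/r) 
                * ennreal_powr (a t) (1 - 1/r)"
      proof -
        have mrhs: "(\<lambda>x. ennreal_powr (ennreal_powr (F (fst x) (snd x)) r * b (snd x)) (1/r) 
                * ennreal_powr (a (snd x)) (1 - 1/r)) \<in> borel_measurable (lborel \<Otimes>\<^sub>M N)"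
          using mfs by (intro borel_measurable_times_ennreal measurable_ennreal_powr) measurable
        show ?thesis using AE0 AE_commute[OF borel_measurable_le[OF mfs mrhs]] by simp
      qed
      have "(\<integral>\<^sup>+x. ennreal_powr (\<integral>\<^sup>+t. F x t \<partial>N) r \<partial>lborel) \<le> 
        (\<integral>\<^sup>+x. (\<integral>\<^sup>+t. ennreal_powr (F x t) r * b t \<partial>N) * ennreal_powr S (r - 1) \<partial>lborel)"
      proof (rule nn_integral_mono_AE, use AE1 in eventually_elim)
        fix x assume ae: "AE t in N. F x t \<le> ennreal_powr (ennreal_powr (F x t) r * b t) (1/r) 
                * ennreal_powr (a t) (1 - 1/r)"
        have "(\<integral>\<^sup>+t. F x t \<partial>N) \<le> (\<integral>\<^sup>+t. ennreal_powr (ennreal_powr (F x t) r * b t) (1/r) 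
                * ennreal_powr (a t) (1 - 1/r) \<partial>N)"
          using ae by (rule nn_integral_mono_AE)
        also have "\<dots> \<le> ennreal_powr (\<integral>\<^sup>+t. ennreal_powr (F x t) r * b t \<partial>N) (1/r) * 
            ennreal_powr S (1 - 1/r)"
          unfolding S_def using r by (intro nn_integral_Holder) auto
        finally have "ennreal_powr (\<integral>\<^sup>+t. F x t \<partial>N) r \<le> ennreal_powr \<dots> r"
          using r by (intro ennreal_powr_mono) auto
        also have "\<dots> = (\<integral>\<^sup>+t. ennreal_powr (F x t) r * b t \<partial>N) * ennreal_powr S (r - 1)"
          using r by (simp add: ennreal_powr_mult ennreal_powr_powr algebra_simps)
        finally show "ennreal_powr (\<integral>\<^sup>+t. F x t \<partial>N) r \<le> \<dots>" .
      qed
      also have "\<dots> = (\<integral>\<^sup>+x. (\<integral>\<^sup>+t. ennreal_powr (F x t) r * b t \<partial>N) \<partial>lborel) * ennreal_powr S (r - 1)"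
        by (rule nn_integral_multc) measurable
      also have "(\<integral>\<^sup>+x. (\<integral>\<^sup>+t. ennreal_powr (F x t) r * b t \<partial>N) \<partial>lborel) = 
         (\<integral>\<^sup>+t. (\<integral>\<^sup>+x. ennreal_powr (F x t) r * b t \<partial>lborel) \<partial>N)"
        by (rule Fubini'[symmetric]) measurable
      also have "\<dots> = (\<integral>\<^sup>+t. ennreal_powr (a t) r * b t \<partial>N)"
      proof (rule nn_integral_cong)
        fix t assume "t \<in> space N"
        then have [measurable]: "(\<lambda>x. F x t) \<in> borel_measurable borel" by (rule mt)
        have "(\<integral>\<^sup>+x. ennreal_powr (F x t) r * b t \<partial>lborel) = 
            (\<integral>\<^sup>+x. ennreal_powr (F x t) r \<partial>lborel) * b t" 
          by (rule nn_integral_multc) measurable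
        then show "(\<integral>\<^sup>+x. ennreal_powr (F x t) r * b t \<partial>lborel) = ennreal_powr (a t) r * b t"
          unfolding a_def real(1) using r by (simp add: powr_Lp_norm)
      qed
      also have "\<dots> \<le> (\<integral>\<^sup>+t. a t \<partial>N)"
      proof (rule nn_integral_mono_AE, use afin in eventually_elim)
        fix t assume t: "a t \<noteq> top"
        show "ennreal_powr (a t) r * b t \<le> a t"
        proof (cases "a t = 0")
          case False
          then obtain c where c: "a t = ennreal c" "0 < c" using t
            by (metis ennreal_cases ennreal_0 less_eq_real_def)
          have "c powr r * inverse (c powr (r - 1)) = c" using c 
            by (simp add: powr_diff)
          then show ?thesis using c by (simp add: b_def inverse_ennreal ennreal_mult[symmetric])
        qed auto
      qed
      finally have "(\<integral>\<^sup>+x. ennreal_powr (\<integral>\<^sup>+t. F x t \<partial>N) r \<partial>lborel) \<le> ennreal_powr S 1 * ennreal_powr S (r - 1)"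
        unfolding S_def[symmetric] by (simp add: mult_right_mono)
      also have "\<dots> = ennreal_powr S r" using r by (subst ennreal_powr_add) auto
      finally show ?thesis unfolding real(1) using real by (intro Lp_norm_leI)
    qed
    then show ?thesis by (simp add: S_def a_def)
  qed
qed

text \<open>The integral Minkowski inequality for counting measure on the two-point type
  \<open>bool\<close>.\<close>

lemma Lp_norm_add_le:
  assumes p: "1 \<le> p" and [measurable]: "F \<in> borel_measurable borel" "G \<in> borel_measurable borel"
  shows "Lp_norm p (\<lambda>x. F x + G x) \<le> Lp_norm p F + Lp_norm p G"
proof -
  have "Lp_norm p (\<lambda>x. \<integral>\<^sup>+t. (if t then F x else G x) \<partial>count_space UNIV) \<le> 
     (\<integral>\<^sup>+t. Lp_norm p (\<lambda>x. if t then F x else G x) \<partial>count_space (UNIV::bool set))"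
    by (intro Minkowski_integral p sigma_finite_measure_count_space_countable) auto
  then show ?thesis by (simp add: nn_integral_count_space_finite UNIV_bool add.commute)
qed

lemma nn_integral_lborel_translate:
  fixes F :: "'a::euclidean_space \<Rightarrow> ennreal"
  assumes [measurable]: "F \<in> borel_measurable borel"
  shows "(\<integral>\<^sup>+x. F (w + x) \<partial>lborel) = (\<integral>\<^sup>+x. F x \<partial>lborel)"
proof -
  have "(\<integral>\<^sup>+x. F x \<partial>lborel) = (\<integral>\<^sup>+x. F x \<partial>distr lborel borel ((+) w))"
    by (simp add: lborel_distr_plus)
  also have "\<dots> = (\<integral>\<^sup>+x. F (w + x) \<partial>lborel)" by (simp add: nn_integral_distr)
  finally show ?thesis by simp
qed

lemma Lp_norm_translate_le:
  fixes F :: "'a::euclidean_space \<Rightarrow> ennreal"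
  assumes p: "1 \<le> p" and [measurable]: "F \<in> borel_measurable borel"
  shows "Lp_norm p (\<lambda>x. F (w + x)) \<le> Lp_norm p F"
  using p
proof (cases rule: ennreal_ge_1_cases)
  case top
  have "AE x in distr lborel borel ((+) w). F x \<le> esssup lborel F"
    unfolding lborel_distr_plus by (rule esssup_AE)
  then have "AE x in lborel. F (w + x) \<le> esssup lborel F"
    by (simp add: AE_distr_iff)
  then show ?thesis using top by (auto simp: Lp_norm_top intro!: esssup_I)
next
  case (real r)
  then show ?thesis 
    using nn_integral_lborel_translate[of "\<lambda>x. ennreal_powr (F x) r" w]
    by (simp add: Lp_norm_ennreal)
qed

subsection \<open>The weight \<open>japanese_bracket\<close>\<close>

abbreviation jb :: "'a::euclidean_space \<Rightarrow> real" where "jb \<equiv> japanese_bracket"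

lemma jb_ge_1 [simp]: "1 \<le> jb x"
  by (simp add: japanese_bracket_def)

lemma jb_pos [simp]: "0 < jb x"
  using jb_ge_1[of x] by linarith

lemma jb_nonneg [simp]: "0 \<le> jb x" and jb_neq_0 [simp]: "jb x \<noteq> 0"
  using jb_pos[of x] by linarith+

lemma jb_minus [simp]: "jb (- x) = jb x"
  by (simp add: japanese_bracket_def)

lemma norm_le_jb: "norm x \<le> jb x"
  by (simp add: japanese_bracket_def real_le_rsqrt)

lemma jb_le: "jb x \<le> 1 + norm x"
  unfolding japanese_bracket_def by (rule real_le_lsqrt) (auto simp: power2_eq_square algebra_simps)

lemma jb_power_le: "jb x ^ N \<le> 2 ^ N * (1 + norm x ^ N)"
proof -
  have "jb x ^ N \<le> (2 * max 1 (norm x)) ^ N" 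
    using jb_le[of x] by (intro power_mono) auto
  also have "\<dots> \<le> 2 ^ N * (1 + norm x ^ N)"
    by (auto simp: power_mult_distrib max_def)
  finally show ?thesis .
qed

lemma continuous_on_jb [continuous_intros]:
  "continuous_on S f \<Longrightarrow> continuous_on S (\<lambda>x. jb (f x))"
  unfolding japanese_bracket_def by (intro continuous_intros) auto

lemma measurable_jb [measurable]: "jb \<in> borel_measurable borel"
  by (intro borel_measurable_continuous_onI continuous_intros)

text \<open>The bracket of \<open>x\<close> is the Euclidean norm of the pair \<open>(1, x)\<close>,
  so this is the triangle inequality for \<open>(0, y)\<close> and \<open>(1, x)\<close>.\<close>

lemma jb_triangle: "jb (x + y) \<le> jb x + jb y"
proof -
  have "jb (x + y) = norm (1::real, x + y)" by (simp add: japanese_bracket_def norm_Pair)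
  also have "\<dots> \<le> norm (0::real, y) + norm (1::real, x)"
    using norm_triangle_ineq[of "(0::real, y)" "(1::real, x)"] by (simp add: add.commute)
  also have "norm (0::real, y) \<le> jb y" by (simp add: norm_Pair norm_le_jb)
  also have "norm (1::real, x) = jb x" by (simp add: japanese_bracket_def norm_Pair)
  finally show ?thesis by simp
qed

lemma jb_Peetre: "jb (x + y) \<le> 2 * jb x * jb y"
proof -
  have "jb x * 1 \<le> jb x * jb y" "1 * jb y \<le> jb x * jb y"
    by (intro mult_mono; simp)+
  then show ?thesis using jb_triangle[of x y] by linarith
qed

lemma jb_power_Peetre: "jb (x + y) ^ N \<le> 2 ^ N * jb x ^ N * jb y ^ N"
  using power_mono[OF jb_Peetre, of x y N] by (simp add: power_mult_distrib)

text \<open>The form in which a change of centre is paid for: decay at \<open>x + y\<close> becomes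
  decay at \<open>x\<close> at a polynomial cost in \<open>y\<close>. This is the source of all the
  factors \<open>2 ^ N\<close> below.\<close>

lemma inverse_jb_Peetre: "1 / jb (x + y) ^ N \<le> 2 ^ N * jb y ^ N / jb x ^ N"
proof -
  have "jb x ^ N \<le> 2 ^ N * jb (x + y) ^ N * jb y ^ N"
    using jb_power_Peetre[of "x + y" "- y" N] by simp
  then show ?thesis by (simp add: field_simps)
qed

text \<open>By \<open>(1 + \<bar>t\<bar>)^2 \<le> 2 * (1 + t^2)\<close> the integrand lies below a
  multiple of \<open>(1 + \<bar>t\<bar>) powr (- r)\<close>, which has an elementary antiderivative
  on each half-line; this is where \<open>2 powr (r/2)\<close> comes from.\<close>

lemma nn_integral_one_plus_square_powr:
  assumes "1 < r"
  shows "(\<integral>\<^sup>+t. ennreal ((1 + t\<^sup>2) powr (- r / 2)) \<partial>lborel) < \<infinity>"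
proof -
  define g where "g = (\<lambda>t::real. ennreal (2 powr (r/2) * (1 + t) powr (- r) ) * indicator {0..} t)"
  have g: "(\<integral>\<^sup>+t. g t \<partial>lborel) = ennreal (0 - (2 powr (r/2) / (1 - r) * (1 + 0) powr (1 - r)))"
    unfolding g_def
  proof (rule nn_integral_FTC_atLeast)
    fix x :: real assume "0 \<le> x"
    then show "DERIV (\<lambda>x. 2 powr (r/2) / (1 - r) * (1 + x) powr (1 - r)) x :> 2 powr (r/2) * (1 + x) powr (- r)"
      using assms by (auto intro!: derivative_eq_intros)
  next
    have "((\<lambda>x::real. (1 + x) powr (1 - r)) \<longlongrightarrow> 0) at_top"
      using assms by (intro tendsto_neg_powr filterlim_tendsto_add_at_top[OF tendsto_const]) (auto simp: filterlim_ident)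
    from tendsto_mult_left[OF this, of "2 powr (r/2) / (1 - r)"]
    show "((\<lambda>x. 2 powr (r/2) / (1 - r) * (1 + x) powr (1 - r)) \<longlongrightarrow> 0) at_top" by simp
  qed auto
  have le: "ennreal ((1 + t\<^sup>2) powr (- r / 2)) \<le> g t + g (- t)" for t
  proof -
    have 1: "(1 + \<bar>t\<bar>)\<^sup>2 \<le> 2 * (1 + t\<^sup>2)" using sum_squares_bound[of 1 "\<bar>t\<bar>"]
      by (simp add: power2_eq_square algebra_simps)
    have "(1 + \<bar>t\<bar>) powr r = ((1 + \<bar>t\<bar>)\<^sup>2) powr (r/2)"
      by (simp add: powr_powr flip: powr_numeral)
    also have "\<dots> \<le> (2 * (1 + t\<^sup>2)) powr (r/2)"
      using assms 1 by (intro powr_mono2) auto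
    also have "\<dots> = 2 powr (r/2) * (1 + t\<^sup>2) powr (r/2)" by (rule powr_mult)
    finally have "(1 + \<bar>t\<bar>) powr r \<le> 2 powr (r/2) * (1 + t\<^sup>2) powr (r/2)" .
    moreover have "0 < (1 + t\<^sup>2) powr (r/2)" "0 < (1 + \<bar>t\<bar>) powr r"
      by (auto simp: add_pos_nonneg less_le[of 0 "1 + t\<^sup>2"] add_nonneg_eq_0_iff)
    ultimately have "(1 + t\<^sup>2) powr (- r / 2) \<le> 2 powr (r/2) * (1 + \<bar>t\<bar>) powr (- r)"
      by (simp add: powr_minus field_simps)
    then have "ennreal ((1 + t\<^sup>2) powr (- r / 2)) \<le> ennreal (2 powr (r/2) * (1 + \<bar>t\<bar>) powr (- r))"
      by (rule ennreal_leI)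
    also have "\<dots> \<le> g t + g (- t)"
      by (cases "t \<ge> 0") (auto simp: g_def indicator_def)
    finally show ?thesis .
  qed
  have [measurable]: "g \<in> borel_measurable borel" unfolding g_def by measurable
  have "(\<integral>\<^sup>+t. ennreal ((1 + t\<^sup>2) powr (- r / 2)) \<partial>lborel) \<le> (\<integral>\<^sup>+t. g t + g (- t) \<partial>lborel)"
    by (intro nn_integral_mono le)
  also have "\<dots> = (\<integral>\<^sup>+t. g t \<partial>lborel) + (\<integral>\<^sup>+t. g (- t) \<partial>lborel)"
    by (rule nn_integral_add) auto
  also have "(\<integral>\<^sup>+t. g (- t) \<partial>lborel) = (\<integral>\<^sup>+t. g t \<partial>lborel)"
    using nn_integral_real_affine[of g "-1" 0] by simp
  also have "\<dots> + \<dots> < \<infinity>" unfolding g by (simp add: ennreal_plus[symmetric] del: ennreal_plus)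
  finally show ?thesis .
qed

text \<open>Polar coordinates are avoided: the integrand is a product of \<open>d\<close> equal
  powers, and in each of them the norm of \<open>x\<close> is replaced by one coordinate. The
  resulting one-dimensional exponent \<open>r / d\<close> exceeds 1 exactly when
  \<open>r > d\<close>, so nothing is lost; this sharp threshold is the one in the hypothesis on
  \<open>s\<close>.\<close>

lemma nn_integral_jb_powr:
  assumes "real DIM('a) < r"
  shows "(\<integral>\<^sup>+x. ennreal (jb (x :: 'a::euclidean_space) powr (- r)) \<partial>lborel) < \<infinity>"
proof -
  define d where "d = real DIM('a)"
  have d: "0 < d" by (simp add: d_def)
  define f where "f = (\<lambda>t::real. ennreal ((1 + t\<^sup>2) powr (- (r / d) / 2)))"
  have le: "ennreal (jb x powr (- r)) \<le> (\<Prod>b\<in>Basis. f (x \<bullet> b))" for x :: 'a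
  proof -
    have p: "0 < 1 + (norm x)\<^sup>2" by (simp add: add_pos_nonneg)
    have "jb x powr (- r) = (1 + (norm x)\<^sup>2) powr (- r / 2)"
      using p by (simp add: japanese_bracket_def powr_half_sqrt[symmetric] powr_powr)
    also have "\<dots> = (\<Prod>b\<in>(Basis :: 'a set). (1 + (norm x)\<^sup>2) powr (- (r / d) / 2))"
      using p d by (simp add: powr_realpow[symmetric] powr_powr d_def)
    also have "\<dots> \<le> (\<Prod>b\<in>Basis. (1 + (x \<bullet> b)\<^sup>2) powr (- (r / d) / 2))"
    proof (intro prod_mono conjI)
      fix b :: 'a assume b: "b \<in> Basis"
      have "(x \<bullet> b)\<^sup>2 \<le> (norm x)\<^sup>2" using Basis_le_norm[OF b, of x] by (metis abs_norm_cancel abs_le_square_iff)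
      then show "(1 + (norm x)\<^sup>2) powr (- (r / d) / 2) \<le> (1 + (x \<bullet> b)\<^sup>2) powr (- (r / d) / 2)"
        using assms d by (intro powr_mono2') (auto simp: add_pos_nonneg)
    qed auto
    finally have "ennreal (jb x powr (- r)) \<le> ennreal \<dots>" by (rule ennreal_leI)
    then show ?thesis by (simp add: f_def prod_ennreal)
  qed
  have "(\<integral>\<^sup>+x. ennreal (jb (x :: 'a) powr (- r)) \<partial>lborel) \<le> (\<integral>\<^sup>+x. (\<Prod>b\<in>Basis. f ((x::'a) \<bullet> b)) \<partial>lborel)"
    by (intro nn_integral_mono le)
  also have "\<dots> = (\<Prod>b\<in>(Basis::'a set). \<integral>\<^sup>+t. f t \<partial>lborel)"
    by (rule nn_integral_lborel_prod) (auto simp: f_def)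
  also have "\<dots> < \<infinity>"
    using nn_integral_one_plus_square_powr[of "r / d"] assms d
    by (simp add: f_def d_def power_less_top_ennreal)
  finally show ?thesis .
qed

lemma nn_integral_jb_power:
  assumes "DIM('a) < N"
  shows "(\<integral>\<^sup>+x. ennreal (1 / jb (x :: 'a::euclidean_space) ^ N) \<partial>lborel) < \<infinity>"
  using nn_integral_jb_powr[where 'a='a and r="real N"] assms
  by (simp add: powr_minus powr_realpow divide_inverse)

lemma integrable_jb_power:
  assumes "DIM('a) < N"
  shows "integrable lborel (\<lambda>x. 1 / jb (x :: 'a::euclidean_space) ^ N)"
  using nn_integral_jb_power[OF assms]
  by (intro integrableI_bounded) (auto simp: abs_of_pos)

subsection \<open>Families of smooth functions with weighted bounds\<close>

definition pderiv_dir :: "'a \<Rightarrow> ('a::euclidean_space \<Rightarrow> complex) \<Rightarrow> 'a \<Rightarrow> complex" where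
  "pderiv_dir b f = (\<lambda>x. frechet_derivative f (at x) b)"

lemma pderiv_dir_eq: "(f has_derivative D) (at x) \<Longrightarrow> pderiv_dir b f x = D b"
  unfolding pderiv_dir_def using frechet_derivative_at by metis

lemma has_derivative_frechet: 
  "f differentiable (at x) \<Longrightarrow> (f has_derivative frechet_derivative f (at x)) (at x)"
  by (simp add: frechet_derivative_works)

text \<open>The recursion of \<open>iter_pderiv\<close> adds derivatives on the outside; here one is
  moved onto the function itself, which shows that derivatives of Schwartz functions are
  Schwartz.\<close>

lemma iter_pderiv_snoc: "iter_pderiv (bs @ [b]) f = iter_pderiv bs (pderiv_dir b f)"
  by (induction bs) (auto simp: pderiv_dir_def)

lemma iter_pderiv_Cons: "iter_pderiv (b # bs) f = pderiv_dir b (iter_pderiv bs f)"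
  by (simp add: pderiv_dir_def)

text \<open>A family \<open>f p\<close> of smooth functions, with parameter \<open>p\<close>, all of whose partial derivatives up to
  order \<open>n\<close> are jointly continuous in \<open>(p, y)\<close> and dominated by one weight \<open>w p y\<close>. Recursion on \<open>n\<close>
  makes the Leibniz rule a plain induction; it stands in for joint Schwartz regularity.\<close>

definition fam0 :: "('p::topological_space \<Rightarrow> 'a::euclidean_space \<Rightarrow> real) \<Rightarrow> ('p \<Rightarrow> 'a \<Rightarrow> complex) \<Rightarrow> bool" where
  "fam0 w f \<longleftrightarrow> continuous_on UNIV (\<lambda>(p, y). f p y) \<and> (\<exists>C\<ge>0. \<forall>p y. norm (f p y) \<le> C * w p y)"

primrec fam :: "nat \<Rightarrow> ('p::topological_space \<Rightarrow> 'a::euclidean_space \<Rightarrow> real) \<Rightarrow> ('p \<Rightarrow> 'a \<Rightarrow> complex) \<Rightarrow> bool" where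
  "fam 0 w f = fam0 w f"
| "fam (Suc n) w f = (fam0 w f \<and> (\<forall>p y. f p differentiable (at y)) \<and>
      (\<forall>b\<in>Basis. fam n w (\<lambda>p. pderiv_dir b (f p))))"

lemma fam_fam0: "fam n w f \<Longrightarrow> fam0 w f"
  by (cases n) auto

lemma fam_SucD: "fam (Suc n) w f \<Longrightarrow> fam n w f"
  by (induction n arbitrary: f) auto

lemma fam0_mono:
  assumes "fam0 w f" "0 \<le> K" "\<And>p y. w p y \<le> K * v p y" shows "fam0 v f"
proof -
  obtain C where C: "0 \<le> C" "\<And>p y. norm (f p y) \<le> C * w p y" 
    using assms(1) by (auto simp: fam0_def)
  have "norm (f p y) \<le> (C * K) * v p y" for p y
    using C(2)[of p y] mult_left_mono[OF assms(3)[of p y] C(1)] by (simp add: mult.assoc)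
  then show ?thesis using assms C by (auto simp: fam0_def intro!: exI[of _ "C * K"])
qed

lemma fam_mono:
  assumes "fam n w f" "0 \<le> K" "\<And>p y. w p y \<le> K * v p y" shows "fam n v f"
  using assms(1) by (induction n arbitrary: f) (auto intro: fam0_mono[OF _ assms(2,3)])

lemma fam0_add: 
  assumes "fam0 w f" "fam0 w g" shows "fam0 w (\<lambda>p y. f p y + g p y)"
proof -
  obtain C D where C: "0 \<le> C" "\<And>p y. norm (f p y) \<le> C * w p y" 
    and D: "0 \<le> D" "\<And>p y. norm (g p y) \<le> D * w p y" 
    using assms by (auto simp: fam0_def)
  have "norm (f p y + g p y) \<le> (C + D) * w p y" for p y
    using norm_triangle_ineq[of "f p y" "g p y"] C(2)[of p y] D(2)[of p y] by (simp add: distrib_right)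
  moreover have "continuous_on UNIV (\<lambda>(p, y). f p y + g p y)"
    using assms by (auto simp: fam0_def split_beta' intro!: continuous_intros)
  ultimately show ?thesis using C D by (auto simp: fam0_def intro!: exI[of _ "C + D"])
qed

lemma fam0_mult: 
  assumes "fam0 w f" "fam0 v g" shows "fam0 (\<lambda>p y. w p y * v p y) (\<lambda>p y. f p y * g p y)"
proof -
  obtain C D where C: "0 \<le> C" "\<And>p y. norm (f p y) \<le> C * w p y" 
    and D: "0 \<le> D" "\<And>p y. norm (g p y) \<le> D * v p y" 
    using assms by (auto simp: fam0_def)
  have "norm (f p y * g p y) \<le> (C * D) * (w p y * v p y)" for p y
    using mult_mono'[OF C(2)[of p y] D(2)[of p y]] by (simp add: norm_mult mult_ac)
  moreover have "continuous_on UNIV (\<lambda>(p, y). f p y * g p y)"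
    using assms by (auto simp: fam0_def split_beta' intro!: continuous_intros)
  ultimately show ?thesis using C D by (auto simp: fam0_def intro!: exI[of _ "C * D"])
qed

lemma pderiv_dir_add:
  assumes "f differentiable (at x)" "g differentiable (at x)"
  shows "pderiv_dir b (\<lambda>y. f y + g y) x = pderiv_dir b f x + pderiv_dir b g x"
  using pderiv_dir_eq[OF has_derivative_add[OF assms[THEN has_derivative_frechet]]]
  by (simp add: pderiv_dir_def)

lemma pderiv_dir_mult:
  assumes "f differentiable (at x)" "g differentiable (at x)"
  shows "pderiv_dir b (\<lambda>y. f y * g y) x = pderiv_dir b f x * g x + f x * pderiv_dir b g x"
  using pderiv_dir_eq[OF has_derivative_mult[OF assms[THEN has_derivative_frechet]]]
  by (simp add: pderiv_dir_def)

lemma fam_add: 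
  assumes "fam n w f" "fam n w g" shows "fam n w (\<lambda>p y. f p y + g p y)"
  using assms
proof (induction n arbitrary: f g)
  case (Suc n)
  have "fam n w (\<lambda>p. pderiv_dir b (\<lambda>y. f p y + g p y))" if "b \<in> Basis" for b
  proof -
    have "(\<lambda>p. pderiv_dir b (\<lambda>y. f p y + g p y)) = (\<lambda>p y. pderiv_dir b (f p) y + pderiv_dir b (g p) y)"
      using Suc.prems by (auto simp: pderiv_dir_add fun_eq_iff)
    then show ?thesis using Suc.prems that by (auto intro: Suc.IH)
  qed
  then show ?case using Suc.prems by (auto intro: fam0_add)
qed (simp add: fam0_add)

lemma fam_mult: 
  assumes "fam n w f" "fam n v g" shows "fam n (\<lambda>p y. w p y * v p y) (\<lambda>p y. f p y * g p y)"
  using assms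
proof (induction n arbitrary: f g)
  case (Suc n)
  have "fam n (\<lambda>p y. w p y * v p y) (\<lambda>p. pderiv_dir b (\<lambda>y. f p y * g p y))" if "b \<in> Basis" for b
  proof -
    have "(\<lambda>p. pderiv_dir b (\<lambda>y. f p y * g p y)) = 
        (\<lambda>p y. pderiv_dir b (f p) y * g p y + f p y * pderiv_dir b (g p) y)"
      using Suc.prems by (auto simp: pderiv_dir_mult fun_eq_iff)
    then show ?thesis 
      using Suc.prems that fam_SucD[OF Suc.prems(1)] fam_SucD[OF Suc.prems(2)] 
      by (auto intro!: fam_add Suc.IH)
  qed
  then show ?case using Suc.prems by (auto intro: fam0_mult)
qed (simp add: fam0_mult)

text \<open>The shift depends on the parameter alone, so it commutes with derivatives in
  \<open>y\<close> and merely recentres the weight.\<close>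

lemma fam_translate:
  assumes "fam n w f" and \<pi>: "continuous_on UNIV \<pi>"
  shows "fam n (\<lambda>p y. w p (y - \<pi> p)) (\<lambda>p y. f p (y - \<pi> p))"
  using assms(1)
proof (induction n arbitrary: f)
  have *: "fam0 (\<lambda>p y. w p (y - \<pi> p)) (\<lambda>p y. f p (y - \<pi> p))" if f0: "fam0 w f" for f
  proof -
    have "continuous_on UNIV ((\<lambda>(p, y). f p y) \<circ> (\<lambda>(p, y). (p, y - \<pi> p)))"
      using f0 by (intro continuous_on_compose)
        (auto simp: fam0_def split_beta' intro!: continuous_intros 
           continuous_on_compose2[OF \<pi>] elim!: continuous_on_subset)
    moreover obtain C where "0 \<le> C" "\<And>p y. norm (f p y) \<le> C * w p y" 
      using f0 by (auto simp: fam0_def)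
    ultimately show ?thesis by (auto simp: fam0_def o_def split_beta')
  qed
  { case 0 then show ?case using * by simp }
  case (Suc n)
  have d: "((\<lambda>y. f p (y - \<pi> p)) has_derivative frechet_derivative (f p) (at (y - \<pi> p))) (at y)" for p y
  proof -
    have "(f p has_derivative frechet_derivative (f p) (at (y - \<pi> p))) (at (y - \<pi> p))"
      using Suc.prems by (auto intro: has_derivative_frechet)
    moreover have "((\<lambda>y. y - \<pi> p) has_derivative (\<lambda>h. h)) (at y)"
      by (auto intro!: derivative_eq_intros)
    ultimately show ?thesis using has_derivative_compose[of "\<lambda>y. y - \<pi> p" "\<lambda>h. h" y UNIV "f p"] by simp
  qed
  have e: "(\<lambda>p. pderiv_dir b (\<lambda>y. f p (y - \<pi> p))) = (\<lambda>p y. pderiv_dir b (f p) (y - \<pi> p))" for b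
    using pderiv_dir_eq[OF d] by (auto simp: fun_eq_iff pderiv_dir_def)
  show ?case using Suc.prems d by (auto simp: e differentiable_def intro!: * Suc.IH)
qed

lemma fam_cnj:
  assumes "fam n w f" shows "fam n w (\<lambda>p y. cnj (f p y))"
  using assms
proof (induction n arbitrary: f)
  have *: "fam0 w (\<lambda>p y. cnj (f p y))" if f0: "fam0 w f" for f
    using f0 by (auto simp: fam0_def split_beta' intro!: continuous_intros)
  { case 0 then show ?case using * by simp }
  case (Suc n)
  have d: "((\<lambda>y. cnj (f p y)) has_derivative (\<lambda>h. cnj (frechet_derivative (f p) (at y) h))) (at y)" for p y
    using Suc.prems by (intro bounded_linear.has_derivative[OF bounded_linear_cnj] has_derivative_frechet) auto
  have e: "(\<lambda>p. pderiv_dir b (\<lambda>y. cnj (f p y))) = (\<lambda>p y. cnj (pderiv_dir b (f p) y))" for b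
    using pderiv_dir_eq[OF d] by (auto simp: fun_eq_iff pderiv_dir_def)
  show ?case using Suc.prems d by (auto simp: e differentiable_def intro!: * Suc.IH)
qed

text \<open>Factors that depend on the parameter alone have vanishing derivatives in
  \<open>y\<close>. Coefficients such as \<open>window_coeff\<close> enter a family in this
  way.\<close>

lemma fam_const:
  assumes "continuous_on UNIV c" "0 \<le> C" and b: "\<And>p y. norm (c p) \<le> C * w p y" 
    and w: "\<And>p y. 0 \<le> w p y"
  shows "fam n w (\<lambda>p y. c p)"
proof -
  have 0: "fam n w (\<lambda>p y. 0)" for n
  proof (induction n)
    have *: "fam0 w (\<lambda>p y. 0)" using w by (auto simp: fam0_def intro!: continuous_intros)
    case 0 then show ?case using * by simp
    case (Suc n) then show ?case using * by (simp add: pderiv_dir_def)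
  qed
  have *: "fam0 w (\<lambda>p y. c p)"
    using assms by (auto simp: fam0_def split_beta' intro!: continuous_on_compose2[OF assms(1)] continuous_intros)
  show ?thesis using * 0 by (cases n) (auto simp: pderiv_dir_def)
qed

lemma has_derivative_exp_inner:
  fixes \<theta> :: "'a::euclidean_space"
  shows "((\<lambda>y. exp (\<i> * complex_of_real (\<theta> \<bullet> y))) has_derivative 
    (\<lambda>h. (\<i> * complex_of_real (\<theta> \<bullet> h)) * exp (\<i> * complex_of_real (\<theta> \<bullet> y)))) (at y)"
proof -
  have "((\<lambda>y. \<i> * complex_of_real (\<theta> \<bullet> y)) has_derivative (\<lambda>h. \<i> * complex_of_real (\<theta> \<bullet> h))) (at y)"
    by (auto intro!: derivative_eq_intros)
  from has_derivative_compose[OF this DERIV_exp[unfolded has_field_derivative_def]]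
  show ?thesis by (simp add: mult.commute)
qed

text \<open>Each derivative produces a factor bounded by \<open>jb (\<rho> p)\<close>, and since
  this is at least 1, the power for order \<open>n\<close> also covers all lower orders.\<close>

lemma fam_exp:
  assumes \<rho>: "continuous_on UNIV \<rho>"
  shows "fam n (\<lambda>p y. jb (\<rho> p) ^ n) (\<lambda>p y. exp (\<i> * complex_of_real (\<rho> p \<bullet> y)))"
proof (induction n)
  have *: "fam0 (\<lambda>p y. jb (\<rho> p) ^ n) (\<lambda>p y. exp (\<i> * complex_of_real (\<rho> p \<bullet> y)))" for n
    by (auto simp: fam0_def split_beta' intro!: continuous_intros exI[of _ 1]
        continuous_on_compose2[OF \<rho>])
  case 0 then show ?case using *[of 0] by simp
  case (Suc n)
  let ?e = "\<lambda>p y. exp (\<i> * complex_of_real (\<rho> p \<bullet> y))"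
  have d: "(?e p has_derivative (\<lambda>h. (\<i> * complex_of_real (\<rho> p \<bullet> h)) * ?e p y)) (at y)" for p y
    by (rule has_derivative_exp_inner)
  have e: "(\<lambda>p. pderiv_dir b (?e p)) = (\<lambda>p y. (\<i> * complex_of_real (\<rho> p \<bullet> b)) * ?e p y)" for b
    using pderiv_dir_eq[OF d] by (auto simp: fun_eq_iff)
  have "fam n (\<lambda>p y. jb (\<rho> p) * jb (\<rho> p) ^ n) (\<lambda>p y. (\<i> * complex_of_real (\<rho> p \<bullet> b)) * ?e p y)" 
    if "b \<in> Basis" for b
  proof (intro fam_mult Suc.IH fam_const)
    show "norm (\<i> * complex_of_real (\<rho> p \<bullet> b)) \<le> 1 * jb (\<rho> p)" for p
      using Basis_le_norm[OF that, of "\<rho> p"] norm_le_jb[of "\<rho> p"] by (simp add: norm_mult)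
  qed (auto intro!: continuous_intros \<rho>)
  then show ?case using d *[of "Suc n"] by (auto simp: e differentiable_def)
qed

lemma pderiv_dir_schwartz: "\<gamma> \<in> schwartz \<Longrightarrow> b \<in> Basis \<Longrightarrow> pderiv_dir b \<gamma> \<in> schwartz"
proof -
  assume g: "\<gamma> \<in> schwartz" and b: "b \<in> Basis"
  have "bs @ [b] \<in> lists Basis" if "bs \<in> lists Basis" for bs using that b by auto
  then show ?thesis using g unfolding schwartz_def
    by (auto simp: iter_pderiv_snoc[symmetric])
qed

text \<open>Seminorms are formed with powers of \<open>norm y\<close>, weights with powers of
  \<open>jb y\<close>; \<open>jb_power_le\<close> converts one into the other and needs only the
  orders 0 and \<open>N\<close>. Derivatives stay in the Schwartz class, which drives the
  induction.\<close>

lemma fam_schwartz: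
  fixes \<gamma> :: "'b::euclidean_space \<Rightarrow> complex"
  assumes "\<gamma> \<in> schwartz"
  shows "fam n (\<lambda>p y. 1 / jb y ^ N) (\<lambda>p. \<gamma>)"
  using assms
proof (induction n arbitrary: \<gamma>)
  have d: "\<gamma> differentiable (at y)" if "\<gamma> \<in> schwartz" for \<gamma> :: "'b \<Rightarrow> complex" and y
    using that unfolding schwartz_def by (auto dest!: bspec[of _ _ "[]"])
  have *: "fam0 (\<lambda>p y. 1 / jb y ^ N) (\<lambda>p. \<gamma>)" if g: "\<gamma> \<in> schwartz" for \<gamma> :: "'b \<Rightarrow> complex"
  proof -
    have "continuous_on UNIV \<gamma>" 
      using d[OF g] differentiable_imp_continuous_within continuous_at_imp_continuous_on by blast
    moreover have "bounded (range (\<lambda>x. norm x ^ k *\<^sub>R \<gamma> x))" for k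
      using g unfolding schwartz_def by (auto dest!: bspec[of _ _ "[]"])
    then have "\<exists>B. \<forall>x. norm (norm x ^ k *\<^sub>R \<gamma> x) \<le> B" for k
      by (auto simp: bounded_iff)
    then obtain B where B: "\<And>k x. norm x ^ k * norm (\<gamma> x) \<le> B k"
      by (auto simp: norm_power) metis
    have "norm (\<gamma> y) \<le> (2 ^ N * (B 0 + B N)) * (1 / jb y ^ N)" for y
    proof -
      have "jb y ^ N * norm (\<gamma> y) \<le> 2 ^ N * (1 + norm y ^ N) * norm (\<gamma> y)"
        by (rule mult_right_mono[OF jb_power_le]) simp
      also have "\<dots> = 2 ^ N * (norm (\<gamma> y) + norm y ^ N * norm (\<gamma> y))" by (simp add: algebra_simps)
      also have "\<dots> \<le> 2 ^ N * (B 0 + B N)"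
        using B[of y 0] B[of y N] by (intro mult_left_mono add_mono) auto
      finally show ?thesis by (simp add: field_simps)
    qed
    moreover have "0 \<le> B k" for k using B[of 0 k] by (rule order_trans[rotated]) simp
    ultimately show ?thesis
      by (auto simp: fam0_def split_beta' intro!: exI[of _ "2 ^ N * (B 0 + B N)"] 
          continuous_on_compose2[of UNIV \<gamma>] continuous_intros)
  qed
  { case 0 then show ?case using * by simp }
  case (Suc n)
  show ?case using Suc.prems * d Suc.IH[OF pderiv_dir_schwartz[OF Suc.prems]] by simp
qed

lemma fam_iter_pderiv:
  assumes "fam (length bs + n) w f" "bs \<in> lists Basis"
  shows "fam n w (\<lambda>p. iter_pderiv bs (f p))"
  using assms
proof (induction bs arbitrary: n)
  case (Cons b bs)
  then have "fam (Suc n) w (\<lambda>p. iter_pderiv bs (f p))" by (intro Cons.IH) auto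
  then show ?case using Cons.prems by (simp add: iter_pderiv_Cons del: iter_pderiv.simps)
qed simp

text \<open>The way back from weighted bounds to the Schwartz class, so that closure of families
  under products, shifts and modulations yields membership. For a fixed \<open>p\<close> the number
  \<open>h p\<close> is a constant, and it may change with \<open>n\<close> and \<open>N\<close>
  because each seminorm is tested separately. A single function is treated as a family with a dummy
  real parameter.\<close>

lemma schwartzI_fam:
  fixes f :: "'p::topological_space \<Rightarrow> 'b::euclidean_space \<Rightarrow> complex"
  assumes f: "\<And>n N. \<exists>h. fam n (\<lambda>p y. h p / jb y ^ N) f"
  shows "f p \<in> schwartz"
  unfolding schwartz_def
proof (intro CollectI ballI conjI allI)
  fix bs :: "'b list" assume bs: "bs \<in> lists Basis"
  fix k :: nat
  obtain h where "fam (length bs + 1) (\<lambda>p y. h p / jb y ^ k) f" using f by blast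
  then have h: "fam (Suc 0) (\<lambda>p y. h p / jb y ^ k) (\<lambda>p. iter_pderiv bs (f p))"
    using fam_iter_pderiv[of bs 1] bs by simp
  then show "iter_pderiv bs (f p) differentiable at x" for x by simp
  obtain C where C: "norm (iter_pderiv bs (f p) y) \<le> C * (h p / jb y ^ k)" for y
    using fam_fam0[OF h] by (auto simp: fam0_def)
  have "norm (norm x ^ k *\<^sub>R iter_pderiv bs (f p) x) \<le> C * h p" for x
  proof -
    have "norm x ^ k * norm (iter_pderiv bs (f p) x) \<le> jb x ^ k * norm (iter_pderiv bs (f p) x)"
      by (intro mult_right_mono power_mono norm_le_jb) auto
    also have "\<dots> \<le> C * h p" using C[of x] by (simp add: field_simps)
    finally show ?thesis by (simp add: norm_power)
  qed
  then show "bounded (range (\<lambda>x. norm x ^ k *\<^sub>R iter_pderiv bs (f p) x))"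
    by (auto simp: bounded_iff)
qed

subsection \<open>Interchanging tempered distributions and integrals\<close>

text \<open>Joins completeness and the norm into the class required by the integrability of
  continuous functions with values in \<open>bcontfun\<close>.\<close>

instance bcontfun :: (metric_space, banach) banach ..

lemma schwartz_add:
  fixes \<phi> :: "'a::euclidean_space \<Rightarrow> complex"
  assumes "\<phi> \<in> schwartz" "\<psi> \<in> schwartz" shows "(\<lambda>y. \<phi> y + \<psi> y) \<in> schwartz"
proof (rule schwartzI_fam[of "\<lambda>p::real. \<lambda>y. \<phi> y + \<psi> y"])
  show "\<exists>h. fam n (\<lambda>p y. h p / jb y ^ N) (\<lambda>p::real. \<lambda>y. \<phi> y + \<psi> y)" for n N
    using fam_add[OF fam_schwartz[OF assms(1)] fam_schwartz[OF assms(2)]] 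
    by (intro exI[of _ "\<lambda>_. 1"]) auto
qed

lemma schwartz_cmult:
  fixes \<phi> :: "'a::euclidean_space \<Rightarrow> complex"
  assumes "\<phi> \<in> schwartz" shows "(\<lambda>y. c * \<phi> y) \<in> schwartz"
proof (rule schwartzI_fam[of "\<lambda>p::real. \<lambda>y. c * \<phi> y"])
  show "\<exists>h. fam n (\<lambda>p y. h p / jb y ^ N) (\<lambda>p::real. \<lambda>y. c * \<phi> y)" for n N
    using fam_mult[OF fam_const[of "\<lambda>_::real. c" "norm c" "\<lambda>p y. 1" n] fam_schwartz[OF assms]] 
    by (intro exI[of _ "\<lambda>_. 1"]) (auto intro!: continuous_intros)
qed

lemma schwartz_iter_differentiable: 
  "\<phi> \<in> schwartz \<Longrightarrow> bs \<in> lists Basis \<Longrightarrow> iter_pderiv bs \<phi> differentiable (at x)"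
  by (auto simp: schwartz_def)

lemma schwartz_iter_continuous: 
  "\<phi> \<in> schwartz \<Longrightarrow> bs \<in> lists Basis \<Longrightarrow> continuous_on S (iter_pderiv bs \<phi>)"
  by (meson continuous_at_imp_continuous_on differentiable_imp_continuous_within schwartz_iter_differentiable)

lemma schwartz_continuous: "\<phi> \<in> schwartz \<Longrightarrow> continuous_on S \<phi>"
  using schwartz_iter_continuous[of \<phi> "[]"] by simp

lemma iter_pderiv_add:
  assumes "\<phi> \<in> schwartz" "\<psi> \<in> schwartz" "bs \<in> lists Basis" 
  shows "iter_pderiv bs (\<lambda>y. \<phi> y + \<psi> y) = (\<lambda>y. iter_pderiv bs \<phi> y + iter_pderiv bs \<psi> y)"
  using assms(3)
proof (induction bs)
  case (Cons b bs)
  then have bs: "bs \<in> lists Basis" and 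
    IH: "iter_pderiv bs (\<lambda>y. \<phi> y + \<psi> y) = (\<lambda>y. iter_pderiv bs \<phi> y + iter_pderiv bs \<psi> y)" by auto
  show ?case unfolding iter_pderiv_Cons IH
    by (intro ext pderiv_dir_add schwartz_iter_differentiable assms bs)
qed simp

lemma iter_pderiv_cmult:
  assumes "\<phi> \<in> schwartz" "bs \<in> lists Basis" 
  shows "iter_pderiv bs (\<lambda>y. c * \<phi> y) = (\<lambda>y. c * iter_pderiv bs \<phi> y)"
  using assms(2)
proof (induction bs)
  case (Cons b bs)
  then have bs: "bs \<in> lists Basis" and 
    IH: "iter_pderiv bs (\<lambda>y. c * \<phi> y) = (\<lambda>y. c * iter_pderiv bs \<phi> y)" by auto
  have "pderiv_dir b (\<lambda>y. c * iter_pderiv bs \<phi> y) x = c * pderiv_dir b (iter_pderiv bs \<phi>) x" for x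
    using assms bs by (subst pderiv_dir_mult) (auto intro: schwartz_iter_differentiable simp: pderiv_dir_def)
  then show ?case unfolding iter_pderiv_Cons IH by auto
qed simp

text \<open>Turns a seminorm into a norm: for Schwartz \<phi> the function under
  \<open>Bcontfun\<close> is bounded and continuous, and its supremum norm is the seminorm with the
  same indices. Families of test functions can thereby be integrated in a Banach space.\<close>

definition weighted_deriv :: "nat \<Rightarrow> 'a list \<Rightarrow> ('a::euclidean_space \<Rightarrow> complex) \<Rightarrow> 'a \<Rightarrow>\<^sub>C complex" where
  "weighted_deriv k bs \<phi> = Bcontfun (\<lambda>y. norm y ^ k *\<^sub>R iter_pderiv bs \<phi> y)"

lemma apply_weighted_deriv: 
  assumes "\<phi> \<in> schwartz" "bs \<in> lists Basis"
  shows "apply_bcontfun (weighted_deriv k bs \<phi>) y = norm y ^ k *\<^sub>R iter_pderiv bs \<phi> y"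
proof -
  have "(\<lambda>y. norm y ^ k *\<^sub>R iter_pderiv bs \<phi> y) \<in> bcontfun"
    using assms schwartz_iter_continuous[OF assms] 
    by (auto simp: bcontfun_def schwartz_def intro!: continuous_intros)
  then show ?thesis by (simp add: weighted_deriv_def Bcontfun_inverse)
qed

lemma norm_weighted_deriv: 
  assumes "\<phi> \<in> schwartz" "bs \<in> lists Basis"
  shows "norm (weighted_deriv k bs \<phi>) = schwartz_seminorm k bs \<phi>"
  unfolding norm_bcontfun_def dist_bcontfun.rep_eq schwartz_seminorm_def
  using assms by (simp add: apply_weighted_deriv norm_power)

lemma weighted_deriv_add:
  assumes "\<phi> \<in> schwartz" "\<psi> \<in> schwartz" "bs \<in> lists Basis" 
  shows "weighted_deriv k bs (\<lambda>y. \<phi> y + \<psi> y) = weighted_deriv k bs \<phi> + weighted_deriv k bs \<psi>"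
  using assms by (intro bcontfun_eqI) 
    (simp add: apply_weighted_deriv schwartz_add iter_pderiv_add scaleR_add_right)

lemma weighted_deriv_scaleR:
  assumes "\<phi> \<in> schwartz" "bs \<in> lists Basis" 
  shows "weighted_deriv k bs (\<lambda>y. complex_of_real r * \<phi> y) = r *\<^sub>R weighted_deriv k bs \<phi>"
  using assms by (intro bcontfun_eqI) 
    (simp add: apply_weighted_deriv schwartz_cmult iter_pderiv_cmult scaleR_conv_of_real)

lemma iter_pderiv_zero [simp]: "iter_pderiv bs (\<lambda>_. 0) = (\<lambda>_. 0)"
  by (induction bs) auto

lemma schwartz_zero: "(\<lambda>_. 0) \<in> schwartz"
  by (auto simp: schwartz_def)

text \<open>The coefficients are real because these sums will be Riemann sums, with volumes of cells
  as coefficients.\<close>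

lemma schwartz_sum:
  fixes c :: "'i \<Rightarrow> real"
  assumes "finite D" "\<And>i. i \<in> D \<Longrightarrow> \<phi> i \<in> schwartz"
  shows "(\<lambda>y. \<Sum>i\<in>D. complex_of_real (c i) * \<phi> i y) \<in> schwartz"
  using assms
proof (induction D rule: finite_induct)
  case (insert x F)
  then have "(\<lambda>y. complex_of_real (c x) * \<phi> x y + (\<Sum>i\<in>F. complex_of_real (c i) * \<phi> i y)) \<in> schwartz"
    by (intro schwartz_add schwartz_cmult) auto
  then show ?case using insert by simp
qed (simp add: schwartz_zero)

lemma weighted_deriv_sum:
  fixes c :: "'i \<Rightarrow> real"
  assumes "finite D" "\<And>i. i \<in> D \<Longrightarrow> \<phi> i \<in> schwartz" "bs \<in> lists Basis"
  shows "weighted_deriv k bs (\<lambda>y. \<Sum>i\<in>D. complex_of_real (c i) * \<phi> i y) = 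
    (\<Sum>i\<in>D. c i *\<^sub>R weighted_deriv k bs (\<phi> i))"
  using assms
proof (induction D rule: finite_induct)
  case empty
  show ?case using assms 
    by (intro bcontfun_eqI) (simp add: apply_weighted_deriv schwartz_zero)
next
  case (insert x F)
  then show ?case
    by (simp add: weighted_deriv_add weighted_deriv_scaleR schwartz_sum schwartz_cmult)
qed

lemma tempered_add: 
  "u \<in> tempered_distributions \<Longrightarrow> \<phi> \<in> schwartz \<Longrightarrow> \<psi> \<in> schwartz \<Longrightarrow> u (\<lambda>x. \<phi> x + \<psi> x) = u \<phi> + u \<psi>"
  by (auto simp: tempered_distributions_def)

lemma tempered_cmult: 
  "u \<in> tempered_distributions \<Longrightarrow> \<phi> \<in> schwartz \<Longrightarrow> u (\<lambda>x. c * \<phi> x) = c * u \<phi>"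
  by (auto simp: tempered_distributions_def)

lemma tempered_sum:
  fixes c :: "'i \<Rightarrow> real"
  assumes u: "u \<in> tempered_distributions" and "finite D" "\<And>i. i \<in> D \<Longrightarrow> \<phi> i \<in> schwartz"
  shows "u (\<lambda>y. \<Sum>i\<in>D. complex_of_real (c i) * \<phi> i y) = (\<Sum>i\<in>D. c i *\<^sub>R u (\<phi> i))"
  using assms(2,3)
proof (induction D rule: finite_induct)
  case empty
  show ?case using tempered_cmult[OF u schwartz_zero, of 0] by simp
next
  case (insert x F)
  then show ?case
    by (simp add: tempered_add[OF u] tempered_cmult[OF u] schwartz_sum schwartz_cmult scaleR_conv_of_real)
qed

lemma tempered_bound:
  fixes u :: "('a::euclidean_space \<Rightarrow> complex) \<Rightarrow> complex"
  assumes u: "u \<in> tempered_distributions"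
  obtains C I where "0 \<le> C" "finite I" "I \<subseteq> UNIV \<times> lists Basis" 
    "\<And>\<phi>. \<phi> \<in> schwartz \<Longrightarrow> norm (u \<phi>) \<le> C * (\<Sum>(k, bs)\<in>I. norm (weighted_deriv k bs \<phi>))"
    "\<And>\<phi> \<psi>. \<phi> \<in> schwartz \<Longrightarrow> \<psi> \<in> schwartz \<Longrightarrow> 
       dist (u \<phi>) (u \<psi>) \<le> C * (\<Sum>(k, bs)\<in>I. dist (weighted_deriv k bs \<phi>) (weighted_deriv k bs \<psi>))"
proof -
  obtain C N where C: "\<And>\<phi>. \<phi> \<in> schwartz \<Longrightarrow> norm (u \<phi>) \<le>
      C * (\<Sum>k\<le>N. \<Sum>bs\<in>{bs \<in> lists Basis. length bs \<le> N}. schwartz_seminorm k bs \<phi>)"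
    using u unfolding tempered_distributions_def by blast
  define I where "I = {..N} \<times> {bs \<in> lists (Basis :: 'a set). length bs \<le> N}"
  have fin: "finite {bs \<in> lists (Basis :: 'a set). length bs \<le> N}"
    using finite_lists_length_le[of "Basis :: 'a set" N] by (simp add: lists_eq_set)
  have I: "finite I" "I \<subseteq> UNIV \<times> lists Basis" using fin by (auto simp: I_def)
  have 1: "norm (u \<phi>) \<le> \<bar>C\<bar> * (\<Sum>(k, bs)\<in>I. norm (weighted_deriv k bs \<phi>))" if "\<phi> \<in> schwartz" for \<phi>
  proof -
    have "norm (u \<phi>) \<le> C * (\<Sum>(k, bs)\<in>I. norm (weighted_deriv k bs \<phi>))"
      using C[OF that] that fin by (simp add: I_def sum.cartesian_product[symmetric] norm_weighted_deriv)
    also have "\<dots> \<le> \<bar>C\<bar> * (\<Sum>(k, bs)\<in>I. norm (weighted_deriv k bs \<phi>))"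
      by (intro mult_right_mono sum_nonneg) auto
    finally show ?thesis .
  qed
  have 2: "dist (u \<phi>) (u \<psi>) \<le> \<bar>C\<bar> * (\<Sum>(k, bs)\<in>I. dist (weighted_deriv k bs \<phi>) (weighted_deriv k bs \<psi>))"
    if "\<phi> \<in> schwartz" "\<psi> \<in> schwartz" for \<phi> \<psi>
  proof -
    let ?d = "\<lambda>y. \<phi> y + complex_of_real (-1) * \<psi> y"
    have s: "(\<lambda>y. complex_of_real (-1) * \<psi> y) \<in> schwartz" by (rule schwartz_cmult) fact
    have "u ?d = u \<phi> - u \<psi>"
      using tempered_add[OF u that(1) s] tempered_cmult[OF u that(2), of "-1"] by simp
    moreover have "weighted_deriv k bs ?d = weighted_deriv k bs \<phi> - weighted_deriv k bs \<psi>" if "(k, bs) \<in> I" for k bs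
    proof -
      have "bs \<in> lists Basis" using that I by blast
      then show ?thesis 
        using weighted_deriv_add[OF \<open>\<phi> \<in> _\<close> s, of bs k] weighted_deriv_scaleR[OF \<open>\<psi> \<in> _\<close>, of bs k "-1"] by simp
    qed
    moreover have "?d \<in> schwartz" using that s by (rule_tac schwartz_add)
    ultimately show ?thesis
      using 1[of ?d] by (simp add: dist_norm case_prod_unfold cong: sum.cong)
  qed
  show ?thesis by (rule that[OF _ I 1 2]) auto
qed

text \<open>Joint continuity gives only locally uniform convergence in \<open>y\<close>. One power
  of decay beyond the required \<open>k\<close> makes both functions uniformly small outside a ball,
  and on the remaining compact set uniform continuity applies.\<close>

lemma continuous_on_weighted_deriv:
  fixes f :: "'p::euclidean_space \<Rightarrow> 'a::euclidean_space \<Rightarrow> complex"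
  assumes f: "\<And>n N. \<exists>h. continuous_on UNIV h \<and> fam n (\<lambda>p y. h p / jb y ^ N) f"
    and bs: "bs \<in> lists Basis"
  shows "continuous_on UNIV (\<lambda>p. weighted_deriv k bs (f p))"
  unfolding continuous_on_iff
proof (intro ballI allI impI)
  fix p0 :: 'p and e :: real assume e: "0 < e"
  have S: "f p \<in> schwartz" for p
    by (rule schwartzI_fam) (use f in blast)
  let ?g = "\<lambda>p y. iter_pderiv bs (f p) y"
  obtain h where h: "continuous_on UNIV h" "fam (length bs + 0) (\<lambda>p y. h p / jb y ^ (k + 1)) f" 
    using f by (metis add.right_neutral)
  have "fam0 (\<lambda>p y. h p / jb y ^ (k + 1)) (\<lambda>p. iter_pderiv bs (f p))"
    using fam_iter_pderiv[OF h(2) bs] by simp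
  then obtain C where gc: "continuous_on UNIV (\<lambda>(p, y). ?g p y)" and 
      C: "0 \<le> C" "\<And>p y. norm (?g p y) \<le> C * (h p / jb y ^ (k + 1))"
    unfolding fam0_def by blast
  have "compact (h ` cball p0 1)" using h(1) by (intro compact_continuous_image) (auto elim: continuous_on_subset)
  then obtain H where H: "\<And>p. p \<in> cball p0 1 \<Longrightarrow> h p \<le> H" "0 \<le> H"
  proof -
    assume *: "\<And>H. (\<And>p. p \<in> cball p0 1 \<Longrightarrow> h p \<le> H) \<Longrightarrow> 0 \<le> H \<Longrightarrow> thesis"
    obtain B where B: "\<And>p. p \<in> cball p0 1 \<Longrightarrow> norm (h p) \<le> B"
      using compact_imp_bounded[OF \<open>compact (h ` _)\<close>] by (meson bounded_iff imageI)
    show thesis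
    proof (rule *[of "\<bar>B\<bar>"])
      show "h p \<le> \<bar>B\<bar>" if "p \<in> cball p0 1" for p using B[OF that] by auto
    qed simp
  qed
  have wd: "norm (norm y ^ k *\<^sub>R ?g p y) \<le> C * H / jb y" if "p \<in> cball p0 1" for p y
  proof -
    have "norm (norm y ^ k *\<^sub>R ?g p y) \<le> jb y ^ k * (C * (h p / jb y ^ (k + 1)))"
    proof -
      have "norm y ^ k * norm (?g p y) \<le> jb y ^ k * (C * (h p / jb y ^ (k + 1)))"
        by (intro mult_mono power_mono norm_le_jb C(2)) auto
      then show ?thesis by (simp add: norm_power)
    qed
    also have "\<dots> = C * h p / jb y" by simp
    also have "\<dots> \<le> C * H / jb y" using H(1)[OF that] C by (intro divide_right_mono mult_left_mono) auto
    finally show ?thesis .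
  qed
  \<comment> \<open>Beyond radius \<open>R\<close> each of the two functions is at most
    \<open>e / 4\<close>; the summand 1 keeps \<open>R\<close> positive when \<open>C * H\<close> is
    zero.\<close>
  define R where "R = 4 * C * H / e + 1"
  have R: "1 \<le> R" "C * H / R \<le> e / 4" 
  proof -
    show R1: "1 \<le> R" using e C H by (simp add: R_def)
    have "R * e = 4 * (C * H) + e" using e by (simp add: R_def distrib_right)
    then show "C * H / R \<le> e / 4" using e R1 by (simp add: pos_divide_le_eq mult.commute)
  qed
  let ?K = "cball p0 1 \<times> cball (0::'a) R"
  have "continuous_on ?K (\<lambda>(p, y). norm y ^ k *\<^sub>R ?g p y)"
    using continuous_on_subset[OF gc, of ?K] by (auto simp: split_beta' intro!: continuous_intros)
  then have uc: "uniformly_continuous_on ?K (\<lambda>(p, y). norm y ^ k *\<^sub>R ?g p y)"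
    by (intro compact_uniformly_continuous compact_Times) auto
  obtain d where d: "0 < d" "\<And>z' z. z' \<in> ?K \<Longrightarrow> z \<in> ?K \<Longrightarrow> dist z z' < d \<Longrightarrow> 
      dist ((\<lambda>(p, y). norm y ^ k *\<^sub>R ?g p y) z) ((\<lambda>(p, y). norm y ^ k *\<^sub>R ?g p y) z') < e / 2"
    by (rule uniformly_continuous_onE[OF uc half_gt_zero[OF e]]) blast
  show "\<exists>d>0. \<forall>p\<in>UNIV. dist p p0 < d \<longrightarrow> dist (weighted_deriv k bs (f p)) (weighted_deriv k bs (f p0)) < e"
  proof (intro exI[of _ "min d 1"] conjI ballI impI)
    fix p assume p: "dist p p0 < min d 1"
    have pK: "p \<in> cball p0 1" "p0 \<in> cball p0 1" using p by (auto simp: dist_commute)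
    have "dist (weighted_deriv k bs (f p)) (weighted_deriv k bs (f p0)) \<le> e / 2"
    proof (rule dist_bound)
      fix y :: 'a
      show "dist (apply_bcontfun (weighted_deriv k bs (f p)) y) (apply_bcontfun (weighted_deriv k bs (f p0)) y) \<le> e / 2"
      proof (cases "norm y \<le> R")
        case True
        have "dist (p, y) (p0, y) < d" using p by (simp add: dist_Pair_Pair)
        then show ?thesis using d(2)[of "(p0, y)" "(p, y)"] True pK by (simp add: apply_weighted_deriv S bs)
      next
        case False
        have "norm (norm y ^ k *\<^sub>R ?g q y) \<le> e / 4" if "q \<in> cball p0 1" for q
        proof -
          have "C * H / jb y \<le> C * H / R" 
            using False norm_le_jb[of y] R C H by (intro divide_left_mono) auto
          then show ?thesis using wd[OF that, of y] R by linarith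
        qed
        from this[OF pK(1)] this[OF pK(2)] show ?thesis
          using norm_triangle_ineq4[of "norm y ^ k *\<^sub>R ?g p y" "norm y ^ k *\<^sub>R ?g p0 y"]
          by (simp add: apply_weighted_deriv S bs dist_norm)
      qed
    qed
    then show "dist (weighted_deriv k bs (f p)) (weighted_deriv k bs (f p0)) < e" using e by linarith
  qed (use d in auto)
qed

lemma continuous_on_tempered_family:
  fixes f :: "'p::euclidean_space \<Rightarrow> 'a::euclidean_space \<Rightarrow> complex"
  assumes u: "u \<in> tempered_distributions" 
    and f: "\<And>n N. \<exists>h. continuous_on UNIV h \<and> fam n (\<lambda>p y. h p / jb y ^ N) f"
  shows "continuous_on UNIV (\<lambda>p. u (f p))"
  unfolding continuous_on_def
proof
  fix p0
  have S: "f p \<in> schwartz" for p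
    by (rule schwartzI_fam) (use f in blast)
  obtain C I where C: "0 \<le> C" "finite I" "I \<subseteq> UNIV \<times> lists Basis" and 
    "\<And>\<phi>. \<phi> \<in> schwartz \<Longrightarrow> norm (u \<phi>) \<le> C * (\<Sum>(k, bs)\<in>I. norm (weighted_deriv k bs \<phi>))" and
    b: "\<And>\<phi> \<psi>. \<phi> \<in> schwartz \<Longrightarrow> \<psi> \<in> schwartz \<Longrightarrow> 
       dist (u \<phi>) (u \<psi>) \<le> C * (\<Sum>(k, bs)\<in>I. dist (weighted_deriv k bs \<phi>) (weighted_deriv k bs \<psi>))"
    by (rule tempered_bound[OF u]) blast
  have *: "((\<lambda>p. C * (\<Sum>(k, bs)\<in>I. dist (weighted_deriv k bs (f p)) (weighted_deriv k bs (f p0)))) 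
      \<longlongrightarrow> C * (\<Sum>(k, bs)\<in>I. dist (weighted_deriv k bs (f p0)) (weighted_deriv k bs (f p0)))) (at p0)"
    unfolding split_beta
  proof (intro tendsto_intros tendsto_sum)
    fix i assume "i \<in> I"
    then have "snd i \<in> lists Basis" using C by auto
    from continuous_on_weighted_deriv[OF f this, of "fst i"]
    show "((\<lambda>p. weighted_deriv (fst i) (snd i) (f p)) \<longlongrightarrow> weighted_deriv (fst i) (snd i) (f p0)) (at p0)"
      by (simp add: continuous_on_def)
  qed
  have "((\<lambda>p. dist (u (f p)) (u (f p0))) \<longlongrightarrow> 0) (at p0)"
  proof (rule tendsto_sandwich[OF _ _ tendsto_const])
    show "\<forall>\<^sub>F p in at p0. dist (u (f p)) (u (f p0)) \<le> 
      C * (\<Sum>(k, bs)\<in>I. dist (weighted_deriv k bs (f p)) (weighted_deriv k bs (f p0)))"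
      using b[OF S S] by (intro always_eventually) auto
    show "((\<lambda>p. C * (\<Sum>(k, bs)\<in>I. dist (weighted_deriv k bs (f p)) (weighted_deriv k bs (f p0)))) \<longlongrightarrow> 0) (at p0)"
      using * by (simp add: split_beta)
  qed simp
  then show "((\<lambda>p. u (f p)) \<longlongrightarrow> u (f p0)) (at p0 within UNIV)"
    by (subst tendsto_dist_iff) simp
qed

section \<open>Differentiation under the integral sign\<close>

lemma has_vector_derivative_line:
  assumes "f differentiable (at (y + \<tau> *\<^sub>R b))"
  shows "((\<lambda>\<tau>. f (y + \<tau> *\<^sub>R b)) has_vector_derivative pderiv_dir b f (y + \<tau> *\<^sub>R b)) (at \<tau>)"
proof -
  let ?D = "frechet_derivative f (at (y + \<tau> *\<^sub>R b))"
  have D: "(f has_derivative ?D) (at (y + \<tau> *\<^sub>R b))" using assms by (rule has_derivative_frechet)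
  have "((\<lambda>\<tau>. y + \<tau> *\<^sub>R b) has_derivative (\<lambda>h. h *\<^sub>R b)) (at \<tau>)"
    by (auto intro!: derivative_eq_intros)
  from has_derivative_compose[OF this D]
  have "((\<lambda>\<tau>. f (y + \<tau> *\<^sub>R b)) has_derivative (\<lambda>h. ?D (h *\<^sub>R b))) (at \<tau>)" .
  then show ?thesis using has_derivative_linear[OF D]
    by (simp add: has_vector_derivative_def pderiv_dir_def linear_scale)
qed

text \<open>Difference quotients along the steps \<open>1 / Suc n\<close>, since dominated
  convergence is about sequences.\<close>

lemma pderiv_dir_seq:
  assumes "f differentiable (at y)"
  shows "(\<lambda>n. (f (y + (1 / real (Suc n)) *\<^sub>R b) - f y) /\<^sub>R (1 / real (Suc n))) \<longlonglongrightarrow> pderiv_dir b f y"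
proof -
  have "((\<lambda>\<tau>. f (y + \<tau> *\<^sub>R b)) has_vector_derivative pderiv_dir b f y) (at 0)"
    using has_vector_derivative_line[of f y 0 b] assms by simp
  then have "((\<lambda>h. norm (f (y + h *\<^sub>R b) - f y - h *\<^sub>R pderiv_dir b f y) / norm h) \<longlongrightarrow> 0) (at 0)"
    by (simp add: has_vector_derivative_def has_derivative_at)
  moreover have "norm (f (y + h *\<^sub>R b) - f y - h *\<^sub>R pderiv_dir b f y) / norm h =
      norm ((f (y + h *\<^sub>R b) - f y) /\<^sub>R h - pderiv_dir b f y)" if "h \<noteq> 0" for h
  proof -
    have "(f (y + h *\<^sub>R b) - f y) /\<^sub>R h - pderiv_dir b f y = (f (y + h *\<^sub>R b) - f y - h *\<^sub>R pderiv_dir b f y) /\<^sub>R h"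
      using that by (simp add: scaleR_diff_right)
    then show ?thesis by (simp add: divide_inverse_commute)
  qed
  ultimately have "((\<lambda>h. norm ((f (y + h *\<^sub>R b) - f y) /\<^sub>R h - pderiv_dir b f y)) \<longlongrightarrow> 0) (at 0)"
    by (elim Lim_transform_eventually) (auto simp: eventually_at_filter)
  then have "((\<lambda>h. (f (y + h *\<^sub>R b) - f y) /\<^sub>R h) \<longlongrightarrow> pderiv_dir b f y) (at 0)"
    by (simp add: tendsto_norm_zero_iff LIM_zero_iff)
  moreover have "filterlim (\<lambda>n. 1 / real (Suc n)) (at 0) sequentially"
    using LIMSEQ_Suc[OF lim_1_over_n] by (auto simp: filterlim_at)
  ultimately show ?thesis by (rule filterlim_compose)
qed

lemma pderiv_dir_Lipschitz:
  assumes d: "\<And>y. f differentiable (at y)" and B: "\<And>y. norm (pderiv_dir b f y) \<le> B" and "0 < \<tau>"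
  shows "norm (f (y + \<tau> *\<^sub>R b) - f y) \<le> B * \<tau>"
proof -
  have v: "((\<lambda>\<tau>. f (y + \<tau> *\<^sub>R b)) has_vector_derivative pderiv_dir b f (y + t *\<^sub>R b)) (at t)" for t
    by (rule has_vector_derivative_line) (rule d)
  have "\<exists>x\<in>{0<..<\<tau>}. norm (f (y + \<tau> *\<^sub>R b) - f (y + 0 *\<^sub>R b)) \<le> norm ((\<tau> - 0) *\<^sub>R pderiv_dir b f (y + x *\<^sub>R b))"
  proof (rule mvt_general[OF \<open>0 < \<tau>\<close>])
    show "continuous_on {0..\<tau>} (\<lambda>\<tau>. f (y + \<tau> *\<^sub>R b))"
      using has_vector_derivative_continuous[OF v] by (auto intro: continuous_at_imp_continuous_on)
  qed (use v in \<open>auto simp: has_vector_derivative_def\<close>)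
  then obtain x where "norm (f (y + \<tau> *\<^sub>R b) - f y) \<le> \<tau> * norm (pderiv_dir b f (y + x *\<^sub>R b))"
    using assms(3) by auto
  also have "\<dots> \<le> \<tau> * B" using B assms(3) by (intro mult_left_mono) auto
  finally show ?thesis by (simp add: mult.commute)
qed

text \<open>By the mean value inequality the difference quotients are dominated by
  \<open>C * h t\<close>, whatever the step, so dominated convergence applies. That \<psi> is
  Schwartz makes it differentiable to every order, which identifies the limit as its
  derivative.\<close>

lemma iter_pderiv_integral:
  fixes \<Psi> :: "'t::euclidean_space \<Rightarrow> 'a::euclidean_space \<Rightarrow> complex"
  assumes f: "\<And>n. fam n (\<lambda>t y. h t) \<Psi>" and h: "integrable lborel h"
    and \<psi>: "\<psi> \<in> schwartz" "\<And>y. \<psi> y = (\<integral>t. \<Psi> t y \<partial>lborel)"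
    and bs: "bs \<in> lists Basis"
  shows "iter_pderiv bs \<psi> y = (\<integral>t. iter_pderiv bs (\<Psi> t) y \<partial>lborel)"
  using bs
proof (induction bs arbitrary: y)
  case Nil
  then show ?case using \<psi> by simp
next
  case (Cons b bs)
  let ?g = "\<lambda>t. iter_pderiv bs (\<Psi> t)"
  let ?h = "\<lambda>n. 1 / real (Suc n)"
  have b: "b \<in> Basis" "bs \<in> lists Basis" using Cons by auto
  have F: "fam (Suc 0) (\<lambda>t y. h t) ?g" using fam_iter_pderiv[of bs "Suc 0", OF f b(2)] .
  then obtain C where C: "\<And>t y. norm (pderiv_dir b (?g t) y) \<le> C * h t"
    using b F unfolding fam.simps fam0_def by blast
  have cont: "continuous_on UNIV (\<lambda>t. ?g t y)" "continuous_on UNIV (\<lambda>t. pderiv_dir b (?g t) y)" for y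
  proof -
    have *: "continuous_on UNIV (\<lambda>t. v t y)" if v: "continuous_on UNIV (\<lambda>(t, y). v t y)" for v :: "'t \<Rightarrow> 'a \<Rightarrow> complex"
    proof -
      have "continuous_on UNIV (\<lambda>t. (\<lambda>(t, y). v t y) (t, y))"
        by (rule continuous_on_compose2[OF v]) (auto intro!: continuous_intros)
      then show ?thesis by simp
    qed
    show "continuous_on UNIV (\<lambda>t. ?g t y)" "continuous_on UNIV (\<lambda>t. pderiv_dir b (?g t) y)"
      using F b by (auto intro!: * simp: fam0_def)
  qed
  have [measurable]: "(\<lambda>t. ?g t y) \<in> borel_measurable borel" 
      "(\<lambda>t. pderiv_dir b (?g t) y) \<in> borel_measurable borel" for y
    using cont by (auto intro!: borel_measurable_continuous_onI)
  obtain D where D: "\<And>t y. norm (?g t y) \<le> D * h t"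
    using fam_fam0[OF F] by (auto simp: fam0_def)
  have int: "integrable lborel (\<lambda>t. ?g t y)" for y
  proof (rule Bochner_Integration.integrable_bound)
    show "integrable lborel (\<lambda>t. D * h t)" using h by simp
    show "AE t in lborel. norm (?g t y) \<le> norm (D * h t)" 
      using D by (intro AE_I2 order_trans[OF D]) auto
  qed simp
  have "(\<lambda>n. \<integral>t. (?g t (y + ?h n *\<^sub>R b) - ?g t y) /\<^sub>R ?h n \<partial>lborel) \<longlonglongrightarrow> (\<integral>t. pderiv_dir b (?g t) y \<partial>lborel)"
  proof (rule integral_dominated_convergence[where w="\<lambda>t. C * h t"])
    show "AE t in lborel. (\<lambda>n. (?g t (y + ?h n *\<^sub>R b) - ?g t y) /\<^sub>R ?h n) \<longlonglongrightarrow> pderiv_dir b (?g t) y"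
      using F by (intro AE_I2 pderiv_dir_seq) auto
    show "AE t in lborel. norm ((?g t (y + ?h n *\<^sub>R b) - ?g t y) /\<^sub>R ?h n) \<le> C * h t" for n
    proof (rule AE_I2)
      fix t
      have "norm (?g t (y + ?h n *\<^sub>R b) - ?g t y) \<le> C * h t * ?h n"
        using F C by (intro pderiv_dir_Lipschitz) auto
      then show "norm ((?g t (y + ?h n *\<^sub>R b) - ?g t y) /\<^sub>R ?h n) \<le> C * h t"
        unfolding norm_scaleR by (simp add: field_simps del: of_nat_Suc)
    qed
  qed (use h in simp_all)
  also have "(\<lambda>n. \<integral>t. (?g t (y + ?h n *\<^sub>R b) - ?g t y) /\<^sub>R ?h n \<partial>lborel) = 
      (\<lambda>n. (iter_pderiv bs \<psi> (y + ?h n *\<^sub>R b) - iter_pderiv bs \<psi> y) /\<^sub>R ?h n)"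
    using int by (simp add: Cons.IH b(2) del: of_nat_Suc)
  finally have "(\<integral>t. pderiv_dir b (?g t) y \<partial>lborel) = pderiv_dir b (iter_pderiv bs \<psi>) y"
    by (rule LIMSEQ_unique) (intro pderiv_dir_seq schwartz_iter_differentiable \<psi> b(2))
  then show ?case by (simp add: iter_pderiv_Cons del: iter_pderiv.simps)
qed

section \<open>Moving a tempered distribution under an integral\<close>

lemma integrable_tail_cbox:
  fixes h :: "'t::euclidean_space \<Rightarrow> real"
  assumes h: "integrable lborel h" and e: "0 < e"
  obtains a b where "norm (\<integral>t. indicator (- cbox a b) t * h t \<partial>lborel) < e"
proof -
  let ?Q = "\<lambda>n::nat. cbox (- real n *\<^sub>R One) (real n *\<^sub>R One) :: 't set"
  have "(\<lambda>n. \<integral>t. indicator (- ?Q n) t * h t \<partial>lborel) \<longlonglongrightarrow> (\<integral>t. 0 \<partial>(lborel :: 't measure))"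
  proof (rule integral_dominated_convergence[where w="\<lambda>t. norm (h t)"])
    show "AE t in lborel. (\<lambda>n. indicator (- ?Q n) t * h t) \<longlonglongrightarrow> 0"
    proof (rule AE_I2)
      fix t :: 't
      obtain m :: nat where m: "norm t \<le> real m" using real_arch_simple by blast
      have "t \<in> ?Q n" if "m \<le> n" for n
        using that m Basis_le_norm[of _ t] by (force simp: mem_box abs_le_iff intro: order_trans)
      then have "\<forall>\<^sub>F n in sequentially. indicator (- ?Q n) t * h t = 0"
        by (auto simp: eventually_sequentially intro!: exI[of _ m])
      then show "(\<lambda>n. indicator (- ?Q n) t * h t) \<longlonglongrightarrow> 0"
        by (rule tendsto_eventually)
    qed
    show "AE t in lborel. norm (indicator (- ?Q n) t * h t) \<le> norm (h t)" for n
      by (intro AE_I2) (auto simp: indicator_def)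
  qed (use h in auto)
  then have "(\<lambda>n. \<integral>t. indicator (- ?Q n) t * h t \<partial>lborel) \<longlonglongrightarrow> 0" by simp
  from tendstoD[OF this e] obtain n where "norm (\<integral>t. indicator (- ?Q n) t * h t \<partial>lborel) < e"
    by (auto simp: eventually_sequentially)
  then show ?thesis by (rule that)
qed

text \<open>Links the two integrals in play, the Bochner integral over the whole space and the gauge
  integral over a box.\<close>

lemma integral_minus_integral_cbox:
  fixes f :: "'t::euclidean_space \<Rightarrow> complex"
  assumes f: "integrable lborel f" and h: "integrable lborel h" and le: "\<And>t. norm (f t) \<le> C * h t" and "0 \<le> C"
  shows "norm ((\<integral>t. f t \<partial>lborel) - integral (cbox a b) f) \<le> C * norm (\<integral>t. indicator (- cbox a b) t * h t \<partial>lborel)"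
proof -
  have "set_integrable lborel (cbox a b) f"
    unfolding set_integrable_def using f by (intro integrable_mult_indicator) auto
  then have "integral (cbox a b) f = (\<integral>t. indicator (cbox a b) t *\<^sub>R f t \<partial>lborel)"
    by (simp add: set_borel_integral_eq_integral(2)[symmetric] set_lebesgue_integral_def)
  then have "(\<integral>t. f t \<partial>lborel) - integral (cbox a b) f = (\<integral>t. f t - indicator (cbox a b) t *\<^sub>R f t \<partial>lborel)"
    using f by (subst Bochner_Integration.integral_diff) (auto intro!: integrable_mult_indicator)
  also have "norm \<dots> \<le> (\<integral>t. C * (indicator (- cbox a b) t * h t) \<partial>lborel)"
  proof (rule Bochner_Integration.integral_norm_bound_integral)
    show "integrable lborel (\<lambda>t. f t - indicator (cbox a b) t *\<^sub>R f t)"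
      using f by (auto intro!: integrable_mult_indicator)
    show "integrable lborel (\<lambda>t. C * (indicator (- cbox a b) t * h t))"
      using h integrable_mult_indicator[of "- cbox a b" lborel h] by auto
  qed (use le in \<open>auto simp: indicator_def\<close>)
  also have "\<dots> \<le> C * norm (\<integral>t. indicator (- cbox a b) t * h t \<partial>lborel)"
    using \<open>0 \<le> C\<close> by (auto intro!: mult_left_mono)
  finally show ?thesis .
qed


text \<open>On a Riemann sum \<open>R\<close> of the family, \<open>u\<close> acts by linearity and
  gives the Riemann sum of \<open>u (\<Psi> t)\<close>. One tagged division makes \<open>R\<close>
  close to \<psi> in all seminorms that control \<open>u\<close>, and at the same time makes the
  scalar sum close to its integral. That the Banach-valued integral of the weighted derivatives
  belongs to \<psi> is checked at each point \<open>y\<close>, by differentiating under the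
  integral.\<close>

theorem tempered_integral:
  fixes \<Psi> :: "'t::euclidean_space \<Rightarrow> 'a::euclidean_space \<Rightarrow> complex"
  assumes u: "u \<in> tempered_distributions"
    and f: "\<And>n N. fam n (\<lambda>t y. h t / jb y ^ N) \<Psi>" 
    and h: "integrable lborel h" "continuous_on UNIV h" "\<And>t. 0 \<le> h t"
    and \<psi>: "\<psi> \<in> schwartz" "\<And>y. \<psi> y = (\<integral>t. \<Psi> t y \<partial>lborel)"
  shows "u \<psi> = (\<integral>t. u (\<Psi> t) \<partial>lborel)"
proof -
  obtain C I where C: "0 \<le> C" "finite I" "I \<subseteq> UNIV \<times> lists Basis" and 
    b: "\<And>\<phi>. \<phi> \<in> schwartz \<Longrightarrow> norm (u \<phi>) \<le> C * (\<Sum>(k, bs)\<in>I. norm (weighted_deriv k bs \<phi>))" and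
    bd: "\<And>\<phi> \<psi>. \<phi> \<in> schwartz \<Longrightarrow> \<psi> \<in> schwartz \<Longrightarrow> 
       dist (u \<phi>) (u \<psi>) \<le> C * (\<Sum>(k, bs)\<in>I. dist (weighted_deriv k bs \<phi>) (weighted_deriv k bs \<psi>))"
    by (rule tempered_bound[OF u]) blast
  have S: "\<Psi> t \<in> schwartz" for t
    by (rule schwartzI_fam) (use f in blast)
  have f0: "fam n (\<lambda>t y. h t) \<Psi>" for n using f[of n 0] by simp
  have fc: "\<exists>h. continuous_on UNIV h \<and> fam n (\<lambda>p y. h p / jb y ^ N) \<Psi>" for n N
    using f h by blast
  let ?E = "\<lambda>i. weighted_deriv (fst i) (snd i)"
  have bsI: "snd i \<in> lists Basis" if "i \<in> I" for i using that C by auto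
  have "\<exists>B\<ge>0. \<forall>t y. norm (apply_bcontfun (?E i (\<Psi> t)) y) \<le> B * h t" if i: "i \<in> I" for i
  proof -
    have "fam (length (snd i) + 0) (\<lambda>t y. h t / jb y ^ fst i) \<Psi>" by (rule f)
    then have "fam0 (\<lambda>t y. h t / jb y ^ fst i) (\<lambda>t. iter_pderiv (snd i) (\<Psi> t))"
      using fam_iter_pderiv[OF _ bsI[OF i]] by fastforce
    then obtain B where B: "0 \<le> B" "\<And>t y. norm (iter_pderiv (snd i) (\<Psi> t) y) \<le> B * (h t / jb y ^ fst i)"
      unfolding fam0_def by blast
    have "norm (apply_bcontfun (?E i (\<Psi> t)) y) \<le> B * h t" for t y
    proof -
      have "norm y ^ fst i * norm (iter_pderiv (snd i) (\<Psi> t) y) \<le> jb y ^ fst i * (B * (h t / jb y ^ fst i))"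
        by (intro mult_mono power_mono norm_le_jb B(2)) auto
      then show ?thesis by (simp add: apply_weighted_deriv S bsI i norm_power)
    qed
    then show ?thesis using B by blast
  qed
  then obtain B where B: "\<And>i. i \<in> I \<Longrightarrow> 0 \<le> B i" 
      "\<And>i t y. i \<in> I \<Longrightarrow> norm (apply_bcontfun (?E i (\<Psi> t)) y) \<le> B i * h t" by metis
  define g where "g t = u (\<Psi> t)" for t
  have gcont: "continuous_on UNIV g" 
    unfolding g_def by (rule continuous_on_tempered_family[OF u fc])
  define D where "D = C * (\<Sum>i\<in>I. B i)"
  have D: "0 \<le> D" using C B by (auto simp: D_def intro!: mult_nonneg_nonneg sum_nonneg)
  have gle: "norm (g t) \<le> D * h t" for t
  proof -
    have "norm (g t) \<le> C * (\<Sum>i\<in>I. norm (?E i (\<Psi> t)))"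
      using b[OF S] by (simp add: g_def split_beta)
    also have "\<dots> \<le> C * (\<Sum>i\<in>I. B i * h t)"
      using C by (intro mult_left_mono sum_mono norm_bound B(2)) auto
    finally show ?thesis by (simp add: D_def sum_distrib_right mult.assoc)
  qed
  have gint: "integrable lborel g"
  proof (rule Bochner_Integration.integrable_bound)
    show "integrable lborel (\<lambda>t. D * h t)" using h by simp
    show "AE t in lborel. norm (g t) \<le> norm (D * h t)" 
      using gle by (intro AE_I2 order_trans[OF gle]) auto
  qed (use gcont in \<open>auto intro!: borel_measurable_continuous_onI\<close>)
  have EI: "apply_bcontfun (?E i \<psi>) y = (\<integral>t. apply_bcontfun (?E i (\<Psi> t)) y \<partial>lborel)" if i: "i \<in> I" for i y
    using iter_pderiv_integral[OF f0 h(1) \<psi> bsI[OF i]]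
    by (simp add: apply_weighted_deriv S bsI i \<psi>(1))
  have Econt: "continuous_on UNIV (\<lambda>t. ?E i (\<Psi> t))" if "i \<in> I" for i
    by (rule continuous_on_weighted_deriv[OF fc bsI[OF that]])
  have bl: "bounded_linear (\<lambda>v :: 'a \<Rightarrow>\<^sub>C complex. apply_bcontfun v y)" for y
    by (rule bounded_linear_intro[of _ 1]) (auto intro: norm_bounded)
  have Ecy: "continuous_on UNIV (\<lambda>t. apply_bcontfun (?E i (\<Psi> t)) y)" if "i \<in> I" for i y
    by (intro bounded_linear.continuous_on[OF bl] Econt that)
  have Eint: "integrable lborel (\<lambda>t. apply_bcontfun (?E i (\<Psi> t)) y)" if "i \<in> I" for i y
  proof (rule Bochner_Integration.integrable_bound)
    show "integrable lborel (\<lambda>t. B i * h t)" using h by simp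
    show "AE t in lborel. norm (apply_bcontfun (?E i (\<Psi> t)) y) \<le> norm (B i * h t)" 
      by (intro AE_I2 order_trans[OF B(2)[OF that]]) auto
  qed (use Ecy[OF that] in \<open>auto intro!: borel_measurable_continuous_onI\<close>)
  \<comment> \<open>The error budget in units of \<open>e\<close>: in seminorm \<open>i\<close> the
    tail outside the box costs \<open>B i\<close> and the Riemann sum 1; the scalar integral costs 1
    for its Riemann sum and \<open>D\<close> for its tail.\<close>
  define K where "K = C * (\<Sum>i\<in>I. B i + 1) + 1 + D"
  have K: "0 \<le> K" using C B D by (auto simp: K_def intro!: add_nonneg_nonneg mult_nonneg_nonneg sum_nonneg)
  have main: "norm (u \<psi> - (\<integral>t. g t \<partial>lborel)) \<le> K * e" if e: "0 < e" for e
  proof -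
    obtain l r where lr: "norm (\<integral>t. indicator (- cbox l r) t * h t \<partial>lborel) < e"
      using integrable_tail_cbox[OF h(1) e] by blast
    \<comment> \<open>Bounded continuous functions form a non-separable space, so the integral is
      taken in the gauge sense, for which continuity on a box is enough.\<close>
    define J where "J i = integral (cbox l r) (\<lambda>t. ?E i (\<Psi> t))" for i
    have J: "((\<lambda>t. ?E i (\<Psi> t)) has_integral J i) (cbox l r)" if "i \<in> I" for i
      unfolding J_def by (intro integrable_integral integrable_continuous continuous_on_subset[OF Econt[OF that]]) auto
    have G: "(g has_integral integral (cbox l r) g) (cbox l r)"
      by (intro integrable_integral integrable_continuous continuous_on_subset[OF gcont]) auto
    have "\<forall>i\<in>I. \<exists>\<gamma>. gauge \<gamma> \<and> (\<forall>\<D>. \<D> tagged_division_of (cbox l r) \<and> \<gamma> fine \<D> \<longrightarrow> 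
        norm ((\<Sum>(x, k)\<in>\<D>. measure lborel k *\<^sub>R ?E i (\<Psi> x)) - J i) < e)"
    proof
      fix i assume "i \<in> I"
      then show "\<exists>\<gamma>. gauge \<gamma> \<and> (\<forall>\<D>. \<D> tagged_division_of (cbox l r) \<and> \<gamma> fine \<D> \<longrightarrow> 
        norm ((\<Sum>(x, k)\<in>\<D>. measure lborel k *\<^sub>R ?E i (\<Psi> x)) - J i) < e)"
        by (rule spec[OF J[unfolded has_integral], of _ e, THEN mp, OF _ e])
    qed
    from bchoice[OF this] obtain \<gamma> where \<gamma>: "\<forall>i\<in>I. gauge (\<gamma> i) \<and> (\<forall>\<D>. \<D> tagged_division_of (cbox l r) \<and> \<gamma> i fine \<D> \<longrightarrow> 
        norm ((\<Sum>(x, k)\<in>\<D>. measure lborel k *\<^sub>R ?E i (\<Psi> x)) - J i) < e)" ..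
    from spec[OF G[unfolded has_integral], of e, THEN mp, OF e]
    obtain \<gamma>0 where \<gamma>0: "gauge \<gamma>0 \<and> (\<forall>\<D>. \<D> tagged_division_of (cbox l r) \<and> \<gamma>0 fine \<D> \<longrightarrow>
        norm ((\<Sum>(x, k)\<in>\<D>. measure lborel k *\<^sub>R g x) - integral (cbox l r) g) < e)" ..
    \<comment> \<open>As \<open>I\<close> is finite, the intersection of all gauges is a gauge, and
      a single division is fine for every seminorm and for the scalar integral.\<close>
    have "gauge (\<lambda>x. \<gamma>0 x \<inter> \<Inter>{\<gamma> i x |i. i \<in> I})"
      using \<gamma> \<gamma>0 C by (intro gauge_Int gauge_Inter) auto
    then obtain P where P: "P tagged_division_of cbox l r" 
        "(\<lambda>x. \<gamma>0 x \<inter> \<Inter>{\<gamma> i x |i. i \<in> I}) fine P"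
      by (rule fine_division_exists)
    then have fine: "\<gamma>0 fine P" "\<And>i. i \<in> I \<Longrightarrow> \<gamma> i fine P" by (simp_all only: fine_Int fine_Inter)
    have finP: "finite P" using P(1) by (rule tagged_division_of_finite)
    define R where "R = (\<lambda>y. \<Sum>p\<in>P. complex_of_real (measure lborel (snd p)) * \<Psi> (fst p) y)"
    have RS: "R \<in> schwartz" unfolding R_def by (intro schwartz_sum finP S)
    have ER: "norm (?E i R - J i) < e" if "i \<in> I" for i
      using bspec[OF \<gamma> that, THEN conjunct2, rule_format, OF conjI[OF P(1) fine(2)[OF that]]]
      unfolding R_def weighted_deriv_sum[OF finP S bsI[OF that]] by (simp add: split_beta)
    have uR: "norm (u R - integral (cbox l r) g) < e"
      using conjunct2[OF \<gamma>0, rule_format, OF conjI[OF P(1) fine(1)]] unfolding R_def tempered_sum[OF u finP S] g_def by (simp add: split_beta)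
    \<comment> \<open>Evaluation at \<open>y\<close> is bounded and linear, hence commutes with the
      gauge integral. A bound uniform in \<open>y\<close> is then a bound for the supremum
      norm.\<close>
    have EJ: "norm (?E i \<psi> - J i) \<le> B i * e" if i: "i \<in> I" for i
    proof (rule norm_bound)
      fix y
      have "((\<lambda>t. apply_bcontfun (?E i (\<Psi> t)) y) has_integral apply_bcontfun (J i) y) (cbox l r)"
        using has_integral_linear[OF J[OF i] bl[of y]] by (simp add: o_def)
      then have "apply_bcontfun (J i) y = integral (cbox l r) (\<lambda>t. apply_bcontfun (?E i (\<Psi> t)) y)"
        by (simp add: integral_unique)
      then have "apply_bcontfun (?E i \<psi> - J i) y = 
          (\<integral>t. apply_bcontfun (?E i (\<Psi> t)) y \<partial>lborel) - integral (cbox l r) (\<lambda>t. apply_bcontfun (?E i (\<Psi> t)) y)"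
        using EI[OF i] by simp
      also have "norm \<dots> \<le> B i * norm (\<integral>t. indicator (- cbox l r) t * h t \<partial>lborel)"
        by (intro integral_minus_integral_cbox Eint h B i)
      also have "\<dots> \<le> B i * e" using lr B(1)[OF i] by (intro mult_left_mono) auto
      finally show "norm (apply_bcontfun (?E i \<psi> - J i) y) \<le> B i * e" .
    qed
    have "dist (?E i \<psi>) (?E i R) \<le> (B i + 1) * e" if "i \<in> I" for i
    proof -
      have "dist (?E i \<psi>) (?E i R) \<le> dist (?E i \<psi>) (J i) + dist (?E i R) (J i)" by (rule dist_triangle2)
      then show ?thesis using EJ[OF that] ER[OF that] by (simp add: dist_norm distrib_right)
    qed
    then have "(\<Sum>i\<in>I. dist (?E i \<psi>) (?E i R)) \<le> (\<Sum>i\<in>I. (B i + 1) * e)" by (intro sum_mono)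
    then have "C * (\<Sum>i\<in>I. dist (?E i \<psi>) (?E i R)) \<le> C * (\<Sum>i\<in>I. (B i + 1) * e)"
      using C by (intro mult_left_mono)
    then have 1: "norm (u \<psi> - u R) \<le> C * (\<Sum>i\<in>I. B i + 1) * e"
      using bd[OF \<psi>(1) RS] by (simp add: split_beta dist_norm sum_distrib_right mult.assoc)
    have "norm ((\<integral>t. g t \<partial>lborel) - integral (cbox l r) g) \<le> 
        D * norm (\<integral>t. indicator (- cbox l r) t * h t \<partial>lborel)"
      by (intro integral_minus_integral_cbox gint h gle D)
    also have "\<dots> \<le> D * e" using lr D by (intro mult_left_mono) auto
    finally have 2: "norm ((\<integral>t. g t \<partial>lborel) - integral (cbox l r) g) \<le> D * e" .
    have "norm (u \<psi> - (\<integral>t. g t \<partial>lborel)) \<le> norm (u \<psi> - u R) + norm (u R - integral (cbox l r) g) 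
        + norm ((\<integral>t. g t \<partial>lborel) - integral (cbox l r) g)"
      by norm
    also have "\<dots> \<le> K * e" using 1 2 uR by (simp add: K_def distrib_right)
    finally show ?thesis .
  qed
  have "norm (u \<psi> - (\<integral>t. g t \<partial>lborel)) \<le> 0"
  proof (rule field_le_epsilon)
    fix e :: real assume e: "0 < e"
    have "norm (u \<psi> - (\<integral>t. g t \<partial>lborel)) \<le> K * (e / (K + 1))" using K e by (intro main) auto
    also have "\<dots> \<le> e" using K e by (simp add: field_simps)
    finally show "norm (u \<psi> - (\<integral>t. g t \<partial>lborel)) \<le> 0 + e" by simp
  qed
  then show ?thesis by (simp add: g_def)
qed

subsection \<open>The Fourier transform up to normalisation\<close>

lemma integral_lborel_translate:
  fixes f :: "'a::euclidean_space \<Rightarrow> complex"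
  assumes [measurable]: "f \<in> borel_measurable borel"
  shows "(\<integral>x. f (w + x) \<partial>lborel) = (\<integral>x. f x \<partial>lborel)"
proof -
  have "(\<integral>x. f x \<partial>lborel) = (\<integral>x. f x \<partial>distr lborel borel ((+) w))"
    by (simp add: lborel_distr_plus)
  also have "\<dots> = (\<integral>x. f (w + x) \<partial>lborel)" by (simp add: integral_distr)
  finally show ?thesis by simp
qed

lemma integrable_lborel_translate:
  fixes f :: "'a::euclidean_space \<Rightarrow> 'b::{banach, second_countable_topology}"
  assumes "integrable lborel f"
  shows "integrable lborel (\<lambda>x. f (w + x))"
proof -
  have [measurable]: "f \<in> borel_measurable borel" using assms by auto
  have "integrable (distr lborel borel ((+) w)) f" using assms by (simp add: lborel_distr_plus)
  then show ?thesis by (simp add: integrable_distr_eq)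
qed

lemma integral_lborel_affine:
  fixes f :: "'a::euclidean_space \<Rightarrow> complex"
  assumes [measurable]: "f \<in> borel_measurable borel" and e: "0 < e"
  shows "(\<integral>x. f x \<partial>lborel) = e ^ DIM('a) *\<^sub>R (\<integral>x. f (t + e *\<^sub>R x) \<partial>lborel)"
proof -
  have "(\<integral>x. f x \<partial>lborel) = (\<integral>x. f x \<partial>density (distr lborel borel (\<lambda>x. t + e *\<^sub>R x)) (\<lambda>_. ennreal (\<bar>e\<bar>^DIM('a))))"
    using lborel_affine[of e t] e by simp
  also have "\<dots> = (\<integral>x. (\<bar>e\<bar>^DIM('a)) *\<^sub>R f x \<partial>(distr lborel borel (\<lambda>x. t + e *\<^sub>R x)))"
    by (rule integral_density) auto
  also have "\<dots> = e ^ DIM('a) *\<^sub>R (\<integral>x. f (t + e *\<^sub>R x) \<partial>lborel)"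
    using e by (simp add: integral_distr)
  finally show ?thesis .
qed

lemma integrable_lborel_affine:
  fixes f :: "'a::euclidean_space \<Rightarrow> complex"
  assumes f: "integrable lborel f" and e: "0 < e"
  shows "integrable lborel (\<lambda>x. f (t + e *\<^sub>R x))"
proof -
  have [measurable]: "f \<in> borel_measurable borel" using f by auto
  have "integrable (density (distr lborel borel (\<lambda>x. t + e *\<^sub>R x)) (\<lambda>_. ennreal (\<bar>e\<bar>^DIM('a)))) f"
    using lborel_affine[of e t] e f by simp
  then have "integrable (distr lborel borel (\<lambda>x. t + e *\<^sub>R x)) (\<lambda>x. (\<bar>e\<bar>^DIM('a)) *\<^sub>R f x)"
    by (subst (asm) integrable_density) auto
  then have "integrable lborel (\<lambda>x. e ^ DIM('a) *\<^sub>R f (t + e *\<^sub>R x))" 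
    using e by (simp add: integrable_distr_eq)
  from integrable_scaleR_right[OF this, of "1 / e ^ DIM('a)"] show ?thesis using e by simp
qed

text \<open>Domination is required on \<open>S\<close> only, so a majorant that works near one point
  can be used.\<close>

lemma continuous_on_integral_dominated:
  fixes F :: "'p::metric_space \<Rightarrow> 'a \<Rightarrow> complex"
  assumes c: "\<And>y. continuous_on S (\<lambda>p. F p y)" and m: "\<And>p. p \<in> S \<Longrightarrow> F p \<in> borel_measurable M"
    and g: "integrable M g" and le: "\<And>p y. p \<in> S \<Longrightarrow> norm (F p y) \<le> g y"
  shows "continuous_on S (\<lambda>p. \<integral>y. F p y \<partial>M)"
proof (unfold continuous_on_sequentially, intro allI ballI impI, elim conjE)
  fix x a assume a: "a \<in> S" and x: "\<forall>n. x n \<in> S" "x \<longlonglongrightarrow> a"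
  have "(\<lambda>n. \<integral>y. F (x n) y \<partial>M) \<longlonglongrightarrow> (\<integral>y. F a y \<partial>M)"
  proof (rule integral_dominated_convergence[where w=g])
    show "AE y in M. (\<lambda>n. F (x n) y) \<longlonglongrightarrow> F a y"
    proof (rule AE_I2)
      fix y
      have "((\<lambda>p. F p y) \<circ> x) \<longlonglongrightarrow> F a y"
        using c[of y] x a unfolding continuous_on_sequentially by blast
      then show "(\<lambda>n. F (x n) y) \<longlonglongrightarrow> F a y" by (simp add: o_def)
    qed
  qed (use m g le a x in auto)
  then show "((\<lambda>p. \<integral>y. F p y \<partial>M) \<circ> x) \<longlonglongrightarrow> (\<integral>y. F a y \<partial>M)" by (simp add: o_def)
qed

lemma integrable_bound_measurable:
  fixes f :: "'a \<Rightarrow> 'b::{banach, second_countable_topology}" and g :: "'a \<Rightarrow> real"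
  assumes "integrable M g" "f \<in> borel_measurable M" "\<And>x. norm (f x) \<le> g x"
  shows "integrable M f"
  using assms(1,2) 
proof (rule Bochner_Integration.integrable_bound)
  show "AE x in M. norm (f x) \<le> norm (g x)" using assms(3) by (intro AE_I2 order_trans[OF assms(3)]) auto
qed

lemma integrable_exp_mult:
  fixes g :: "'z \<Rightarrow> complex"
  assumes g: "integrable M g" and [measurable]: "r \<in> borel_measurable M"
  shows "integrable M (\<lambda>z. exp (\<i> * complex_of_real (r z)) * g z)"
proof (rule integrable_bound_measurable[OF integrable_norm[OF g]])
  have [measurable]: "g \<in> borel_measurable M" using g by auto
  show "(\<lambda>z. exp (\<i> * complex_of_real (r z)) * g z) \<in> borel_measurable M" by measurable
qed (simp add: norm_mult)

text \<open>Integration by parts without boundary terms: the integral of \<open>g (y + b) - g y\<close> vanishes by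
  translation invariance, and by Fubini it is the integral of the derivative.\<close>

lemma integral_pderiv_dir_eq_0:
  fixes g :: "'a::euclidean_space \<Rightarrow> complex"
  assumes d: "\<And>y. g differentiable (at y)" and g: "integrable lborel g"
    and G: "integrable lborel (pderiv_dir b g)" "continuous_on UNIV (pderiv_dir b g)"
  shows "(\<integral>y. pderiv_dir b g y \<partial>lborel) = 0"
proof -
  let ?G = "pderiv_dir b g"
  have [measurable]: "?G \<in> borel_measurable borel" "g \<in> borel_measurable borel"
    using G g by auto
  have line: "g (b + y) - g y = (\<integral>\<tau>. indicator {0..1} \<tau> *\<^sub>R ?G (\<tau> *\<^sub>R b + y) \<partial>lborel)" for y
  proof -
    have hi: "((\<lambda>\<tau>. ?G (y + \<tau> *\<^sub>R b)) has_integral g (y + 1 *\<^sub>R b) - g (y + 0 *\<^sub>R b)) {0..1}"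
      by (intro fundamental_theorem_of_calculus has_vector_derivative_at_within[OF has_vector_derivative_line] d) auto
    have si: "set_integrable lborel {0..1} (\<lambda>\<tau>. ?G (y + \<tau> *\<^sub>R b))"
      by (intro borel_integrable_atLeastAtMost' continuous_on_compose2[OF G(2)] continuous_intros) auto
    show ?thesis
      using integral_unique[OF hi] set_borel_integral_eq_integral(2)[OF si]
      by (simp add: set_lebesgue_integral_def add.commute)
  qed
  let ?f = "\<lambda>\<tau> y. indicator {0..1::real} \<tau> *\<^sub>R ?G (\<tau> *\<^sub>R b + y)"
  have tr: "(\<integral>y. norm (?G (c + y)) \<partial>lborel) = (\<integral>y. norm (?G y) \<partial>lborel)" for c
    using integral_lborel_translate[of "\<lambda>y. complex_of_real (norm (?G y))" c] by simp
  have int: "integrable (lborel \<Otimes>\<^sub>M lborel) (\<lambda>(\<tau>, y). ?f \<tau> y)"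
  proof (rule lborel_pair.Fubini_integrable)
    show "(\<lambda>(\<tau>, y). ?f \<tau> y) \<in> borel_measurable (lborel \<Otimes>\<^sub>M lborel)" by measurable
    have "integrable lborel (\<lambda>\<tau>. indicator {0..1::real} \<tau> * (\<integral>y. norm (?G y) \<partial>lborel))"
      by (intro integrable_mult_left integrable_real_indicator) auto
    then show "integrable lborel (\<lambda>\<tau>. \<integral>y. norm (case (\<tau>, y) of (\<tau>, y) \<Rightarrow> ?f \<tau> y) \<partial>lborel)"
      by (simp add: tr abs_mult)
    show "AE \<tau> in lborel. integrable lborel (\<lambda>y. case (\<tau>, y) of (\<tau>, y) \<Rightarrow> ?f \<tau> y)"
      using integrable_lborel_translate[OF G(1)] by (intro AE_I2) auto
  qed
  have "0 = (\<integral>y. g (b + y) - g y \<partial>lborel)"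
    using integral_lborel_translate[of g b] integrable_lborel_translate[OF g, of b] g by simp
  also have "\<dots> = (\<integral>y. (\<integral>\<tau>. ?f \<tau> y \<partial>lborel) \<partial>lborel)" by (simp only: line)
  also have "\<dots> = (\<integral>\<tau>. (\<integral>y. ?f \<tau> y \<partial>lborel) \<partial>lborel)"
    by (rule lborel_pair.Fubini_integral[OF int])
  also have "\<dots> = (\<integral>\<tau>. indicator {0..1::real} \<tau> *\<^sub>R (\<integral>y. ?G y \<partial>lborel) \<partial>lborel)"
    using integral_lborel_translate[of ?G] by simp
  also have "\<dots> = (\<integral>y. ?G y \<partial>lborel)" by simp
  finally show ?thesis by simp
qed

text \<open>The positive sign in the exponent makes \<open>window_coeff\<close> directly a transform
  of a product; inversion consequently carries the negative sign, and its constant is left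
  unspecified.\<close>

definition fourier :: "('a::euclidean_space \<Rightarrow> complex) \<Rightarrow> 'a \<Rightarrow> complex" where
  "fourier f \<theta> = (\<integral>y. exp (\<i> * complex_of_real (\<theta> \<bullet> y)) * f y \<partial>lborel)"

lemma fam0_continuous_snd: "fam0 w f \<Longrightarrow> continuous_on UNIV (f p)"
proof -
  assume "fam0 w f"
  then have "continuous_on UNIV (\<lambda>(p, y). f p y)" by (simp add: fam0_def)
  then have "continuous_on UNIV (\<lambda>y. (\<lambda>(p, y). f p y) (p, y))"
    by (rule continuous_on_compose2) (auto intro!: continuous_intros)
  then show ?thesis by simp
qed

lemma fam0_integrable:
  assumes f: "fam0 w f" and w: "integrable lborel (w p)"
  shows "integrable lborel (f p)"
proof -
  obtain C where C: "\<And>y. norm (f p y) \<le> C * w p y" using f unfolding fam0_def by blast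
  have "f p \<in> borel_measurable lborel" using fam0_continuous_snd[OF f] 
    by (auto intro: borel_measurable_continuous_onI)
  then show ?thesis using w C by (intro integrable_bound_measurable[of lborel "\<lambda>y. C * w p y" "f p"]) auto
qed

text \<open>The derivative of the exponential times \<open>f p\<close> has integral zero, and the
  product rule splits it into the two terms. The parameter is carried along so that later constants
  are uniform in it.\<close>

lemma fourier_pderiv_dir:
  fixes f :: "'p::topological_space \<Rightarrow> 'a::euclidean_space \<Rightarrow> complex"
  assumes f: "fam (Suc n) w f" and w: "integrable lborel (w p)" and b: "b \<in> Basis"
  shows "fourier (pderiv_dir b (f p)) \<theta> = - \<i> * complex_of_real (\<theta> \<bullet> b) * fourier (f p) \<theta>"
proof -
  let ?e = "\<lambda>y. exp (\<i> * complex_of_real (\<theta> \<bullet> y))"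
  have fD: "fam0 w (\<lambda>p. pderiv_dir b (f p))" using f b by (auto intro: fam_fam0)
  have int: "integrable lborel (f p)" "integrable lborel (pderiv_dir b (f p))"
    using fam0_integrable[OF fam_fam0[OF f] w] fam0_integrable[OF fD w] by auto
  have e: "integrable lborel (\<lambda>y. ?e y * g y)" if "integrable lborel g" for g
    using that by (intro integrable_exp_mult) auto
  have d: "(?e has_derivative (\<lambda>h. (\<i> * complex_of_real (\<theta> \<bullet> h)) * ?e y)) (at y)" for y
    by (rule has_derivative_exp_inner)
  have df: "f p differentiable (at y)" for y using f by simp
  have pd: "pderiv_dir b (\<lambda>y. ?e y * f p y) = 
      (\<lambda>y. \<i> * complex_of_real (\<theta> \<bullet> b) * (?e y * f p y) + ?e y * pderiv_dir b (f p) y)"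
  proof
    fix y
    have ed: "?e differentiable (at y)" using d by (auto simp: differentiable_def)
    show "pderiv_dir b (\<lambda>y. ?e y * f p y) y = \<i> * complex_of_real (\<theta> \<bullet> b) * (?e y * f p y) + ?e y * pderiv_dir b (f p) y"
      by (simp only: pderiv_dir_mult[OF ed df] pderiv_dir_eq[OF d] mult.assoc)
  qed
  have "0 = (\<integral>y. pderiv_dir b (\<lambda>y. ?e y * f p y) y \<partial>lborel)"
  proof (rule integral_pderiv_dir_eq_0[symmetric])
    show "(\<lambda>y. ?e y * f p y) differentiable (at y)" for y
      unfolding differentiable_def by (rule exI, rule has_derivative_mult[OF d has_derivative_frechet[OF df]])
    show "integrable lborel (pderiv_dir b (\<lambda>y. ?e y * f p y))"
      unfolding pd using int by (intro Bochner_Integration.integrable_add integrable_mult_right e)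
    have "continuous_on UNIV (f p)" "continuous_on UNIV (pderiv_dir b (f p))"
      using fam0_continuous_snd[OF fam_fam0[OF f]] fam0_continuous_snd[OF fD] by auto
    then show "continuous_on UNIV (pderiv_dir b (\<lambda>y. ?e y * f p y))"
      unfolding pd by (intro continuous_intros)
  qed (use e int in auto)
  also have "\<dots> = \<i> * complex_of_real (\<theta> \<bullet> b) * fourier (f p) \<theta> + fourier (pderiv_dir b (f p)) \<theta>"
    unfolding pd fourier_def using int e by (subst Bochner_Integration.integral_add) auto
  finally show ?thesis by (simp add: eq_neg_iff_add_eq_0 add.commute)
qed

text \<open>The bracket is at most a multiple of \<open>m\<close>, the maximum of 1 and all
  \<bar>coordinates\<bar>, and \<open>m ^ M\<close> is itself one of the terms on the right. Thus
  decay in each coordinate separately gives decay in the norm, and mixed derivatives are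
  avoided.\<close>

lemma jb_power_le_sum:
  "jb (\<theta> :: 'a::euclidean_space) ^ M \<le> (2 * (1 + real DIM('a))) ^ M * (1 + (\<Sum>b\<in>Basis. \<bar>\<theta> \<bullet> b\<bar> ^ M))"
proof -
  define m where "m = Max (insert 1 ((\<lambda>b. \<bar>\<theta> \<bullet> b\<bar>) ` Basis))"
  have m: "1 \<le> m" "\<And>b. b \<in> Basis \<Longrightarrow> \<bar>\<theta> \<bullet> b\<bar> \<le> m" unfolding m_def by (rule Max_ge; auto)+
  have "m \<in> insert 1 ((\<lambda>b. \<bar>\<theta> \<bullet> b\<bar>) ` Basis)" unfolding m_def by (rule Max_in) auto
  then have mM: "m ^ M \<le> 1 + (\<Sum>b\<in>Basis. \<bar>\<theta> \<bullet> b\<bar> ^ M)"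
  proof
    assume "m = 1" then show ?thesis by (simp add: sum_nonneg)
  next
    assume "m \<in> (\<lambda>b. \<bar>\<theta> \<bullet> b\<bar>) ` Basis"
    then obtain b where b: "b \<in> Basis" "m = \<bar>\<theta> \<bullet> b\<bar>" by auto
    then show ?thesis using member_le_sum[of b Basis "\<lambda>b. \<bar>\<theta> \<bullet> b\<bar> ^ M"] by simp
  qed
  have "jb \<theta> \<le> 1 + (\<Sum>b\<in>Basis. \<bar>\<theta> \<bullet> b\<bar>)" using jb_le[of \<theta>] norm_le_l1[of \<theta>] by simp
  also have "\<dots> \<le> m + (\<Sum>b\<in>(Basis :: 'a set). m)" using m by (intro add_mono sum_mono) auto
  also have "\<dots> = (1 + real DIM('a)) * m" by (simp add: distrib_right)
  also have "\<dots> \<le> (2 * (1 + real DIM('a))) * m" using m by (intro mult_right_mono) auto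
  finally have "jb \<theta> ^ M \<le> ((2 * (1 + real DIM('a))) * m) ^ M" by (intro power_mono) auto
  also have "\<dots> \<le> (2 * (1 + real DIM('a))) ^ M * (1 + (\<Sum>b\<in>Basis. \<bar>\<theta> \<bullet> b\<bar> ^ M))"
    unfolding power_mult_distrib[of _ m] by (intro mult_left_mono mM) auto
  finally show ?thesis .
qed

lemma fourier_bound:
  assumes f: "fam0 w f" and w: "\<And>p. integrable lborel (w p)" 
    and \<omega>: "\<And>p. (\<integral>y. w p y \<partial>lborel) \<le> \<omega> p"
  shows "\<exists>C\<ge>0. \<forall>p \<theta>. norm (fourier (f p) \<theta>) \<le> C * \<omega> p"
proof -
  obtain C where C: "0 \<le> C" "\<And>p y. norm (f p y) \<le> C * w p y" using f unfolding fam0_def by blast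
  have "norm (fourier (f p) \<theta>) \<le> C * \<omega> p" for p \<theta>
  proof -
    have "norm (fourier (f p) \<theta>) \<le> (\<integral>y. norm (exp (\<i> * complex_of_real (\<theta> \<bullet> y)) * f p y) \<partial>lborel)"
      unfolding fourier_def by (rule integral_norm_bound)
    also have "\<dots> = (\<integral>y. norm (f p y) \<partial>lborel)" by (simp add: norm_mult)
    also have "\<dots> \<le> (\<integral>y. C * w p y \<partial>lborel)"
      using fam0_integrable[OF f w] w C(2) by (intro integral_mono) auto
    also have "\<dots> \<le> C * \<omega> p" using \<omega> C(1) by (auto intro!: mult_left_mono)
    finally show ?thesis .
  qed
  then show ?thesis using C by blast
qed

lemma fourier_decay_dir:
  assumes f: "fam M w f" and w: "\<And>p. integrable lborel (w p)" 
    and \<omega>: "\<And>p. (\<integral>y. w p y \<partial>lborel) \<le> \<omega> p" and b: "b \<in> Basis"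
  shows "\<exists>C\<ge>0. \<forall>p \<theta>. \<bar>\<theta> \<bullet> b\<bar> ^ M * norm (fourier (f p) \<theta>) \<le> C * \<omega> p"
  using f
proof (induction M arbitrary: f)
  case 0
  then show ?case using fourier_bound[OF _ w \<omega>] by simp
next
  case (Suc M)
  have "fam M w (\<lambda>p. pderiv_dir b (f p))" using Suc.prems b by simp
  from Suc.IH[OF this] obtain C where C: "0 \<le> C" 
    "\<And>p \<theta>. \<bar>\<theta> \<bullet> b\<bar> ^ M * norm (fourier (pderiv_dir b (f p)) \<theta>) \<le> C * \<omega> p" by blast
  show ?case
    using C fourier_pderiv_dir[OF Suc.prems w b]
    by (intro exI[of _ C]) (auto simp: norm_mult mult_ac)
qed

text \<open>Integration by parts \<open>M\<close> times in each coordinate direction. The point is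
  the uniformity: \<open>C\<close> depends neither on \<open>p\<close> nor on \<theta>, and the
  parameter enters only through the bound on the integral of the weight.\<close>

lemma fourier_decay:
  assumes f: "fam M w f" and w: "\<And>p. integrable lborel (w p)" 
    and \<omega>: "\<And>p. (\<integral>y. w p y \<partial>lborel) \<le> \<omega> p" 
  shows "\<exists>C\<ge>0. \<forall>p \<theta>. norm (fourier (f p) \<theta>) \<le> C * \<omega> p / jb \<theta> ^ M"
proof -
  obtain C0 where C0: "0 \<le> C0" "\<And>p \<theta>. norm (fourier (f p) \<theta>) \<le> C0 * \<omega> p"
    using fourier_bound[OF fam_fam0[OF f] w \<omega>] by blast
  have "\<forall>b\<in>Basis. \<exists>C\<ge>0. \<forall>p \<theta>. \<bar>\<theta> \<bullet> b\<bar> ^ M * norm (fourier (f p) \<theta>) \<le> C * \<omega> p"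
    using fourier_decay_dir[OF f w \<omega>] by blast
  from bchoice[OF this] obtain C where C: "\<forall>b\<in>Basis. 0 \<le> C b \<and> (\<forall>p \<theta>. \<bar>\<theta> \<bullet> b\<bar> ^ M * norm (fourier (f p) \<theta>) \<le> C b * \<omega> p)" ..
  define L where "L = (2 * (1 + real DIM('b))) ^ M"
  have L: "0 \<le> L" by (simp add: L_def)
  have "norm (fourier (f p) \<theta>) \<le> L * (C0 + (\<Sum>b\<in>Basis. C b)) * \<omega> p / jb \<theta> ^ M" for p and \<theta> :: 'b
  proof -
    have "jb \<theta> ^ M * norm (fourier (f p) \<theta>) \<le> L * (1 + (\<Sum>b\<in>Basis. \<bar>\<theta> \<bullet> b\<bar> ^ M)) * norm (fourier (f p) \<theta>)"
      unfolding L_def by (intro mult_right_mono jb_power_le_sum) auto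
    also have "\<dots> = L * (norm (fourier (f p) \<theta>) + (\<Sum>b\<in>Basis. \<bar>\<theta> \<bullet> b\<bar> ^ M * norm (fourier (f p) \<theta>)))"
      by (simp add: algebra_simps sum_distrib_left sum_distrib_right)
    also have "\<dots> \<le> L * (C0 * \<omega> p + (\<Sum>b\<in>Basis. C b * \<omega> p))"
      using C L by (intro mult_left_mono add_mono C0 sum_mono) auto
    also have "\<dots> = L * (C0 + (\<Sum>b\<in>Basis. C b)) * \<omega> p" by (simp add: algebra_simps sum_distrib_left sum_distrib_right)
    finally show ?thesis by (simp add: field_simps)
  qed
  moreover have "0 \<le> L * (C0 + (\<Sum>b\<in>Basis. C b))"
    using C C0 L by (intro mult_nonneg_nonneg add_nonneg_nonneg sum_nonneg) auto
  ultimately show ?thesis by blast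
qed

lemma continuous_on_fourier:
  assumes "integrable lborel f"
  shows "continuous_on UNIV (fourier f)"
  unfolding fourier_def
proof (rule continuous_on_integral_dominated[where g="\<lambda>y. norm (f y)"])
  have [measurable]: "f \<in> borel_measurable borel" using assms by auto
  show "(\<lambda>y. exp (\<i> * complex_of_real (p \<bullet> y)) * f y) \<in> borel_measurable lborel" for p
    by (auto intro!: borel_measurable_times borel_measurable_continuous_onI continuous_intros)
qed (use assms in \<open>auto simp: norm_mult intro!: continuous_intros\<close>)

lemma integral_pos_continuous:
  fixes f :: "'a::euclidean_space \<Rightarrow> real"
  assumes f: "integrable lborel f" "continuous_on UNIV f" "\<And>x. 0 \<le> f x" and x0: "f x0 \<noteq> 0"
  shows "0 < (\<integral>x. f x \<partial>lborel)"
proof (rule ccontr)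
  assume "\<not> ?thesis"
  then have "(\<integral>x. f x \<partial>lborel) = 0" using integral_nonneg_AE[of f lborel] f by fastforce
  then have ae: "AE x in lborel. f x = 0" using f by (subst (asm) integral_nonneg_eq_0_iff_AE) auto
  have "open {x. f x \<noteq> 0}" using f(2) by (intro open_Collect_neq) auto
  then obtain e where e: "0 < e" "ball x0 e \<subseteq> {x. f x \<noteq> 0}" using x0 by (auto simp: open_contains_ball)
  have "AE x in lborel. x \<notin> ball x0 e" using ae e by (auto elim!: eventually_mono)
  then have "emeasure lborel (ball x0 e) = 0" by (subst (asm) AE_iff_measurable[of "ball x0 e"]) auto
  then have "measure lborel (ball x0 e) = 0" by (simp add: measure_def)
  then show False using content_ball_pos[of e x0] e by simp
qed


text \<open>Inversion up to an unspecified constant suffices, so no Gaussian is needed: the summability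
  kernel is the autocorrelation \<open>\<theta>\<close> of \<open>|\<gamma>|\<^sup>2\<close>, whose Fourier transform is a square.\<close>

lemma fourier_inversion:
  fixes \<gamma> :: "'a::euclidean_space \<Rightarrow> complex"
  assumes \<gamma>: "\<gamma> \<in> schwartz" "\<gamma> \<noteq> (\<lambda>_. 0)"
  obtains c :: complex where "c \<noteq> 0" 
    "\<And>(\<phi> :: 'a \<Rightarrow> complex) y. continuous_on UNIV \<phi> \<Longrightarrow> bounded (range \<phi>) \<Longrightarrow> integrable lborel \<phi> \<Longrightarrow> 
       integrable lborel (fourier \<phi>) \<Longrightarrow> 
       (\<integral>\<eta>. exp (- \<i> * complex_of_real (\<eta> \<bullet> y)) * fourier \<phi> \<eta> \<partial>lborel) = c * \<phi> y"
proof -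
  define \<rho> where "\<rho> = (\<lambda>y. \<gamma> y * cnj (\<gamma> y))"
  have \<rho>r: "\<rho> y = complex_of_real ((norm (\<gamma> y))\<^sup>2)" for y by (simp only: \<rho>_def complex_norm_square)
  define N where "N = Suc DIM('a)"
  have \<rho>f: "fam N (\<lambda>(p::real) y. 1 / jb y ^ N * (1 / jb y ^ 0)) (\<lambda>p. \<rho>)"
    unfolding \<rho>_def by (intro fam_mult fam_cnj fam_schwartz \<gamma>)
  then have \<rho>f: "fam N (\<lambda>(p::real) y. 1 / jb y ^ N) (\<lambda>p. \<rho>)" by simp
  have wi: "integrable lborel (\<lambda>y :: 'a. 1 / jb y ^ N)" by (rule integrable_jb_power) (simp add: N_def)
  have \<rho>i: "integrable lborel \<rho>" by (rule fam0_integrable[OF fam_fam0[OF \<rho>f] wi])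
  have \<rho>c: "continuous_on UNIV \<rho>" by (rule fam0_continuous_snd[OF fam_fam0[OF \<rho>f]])
  have [measurable]: "\<rho> \<in> borel_measurable borel" using \<rho>i by auto
  obtain B where B: "0 \<le> B" "\<And>y. norm (\<rho> y) \<le> B"
  proof -
    obtain C where C: "0 \<le> C" "\<And>y. norm (\<rho> y) \<le> C * (1 / jb y ^ N)"
      using fam_fam0[OF \<rho>f] unfolding fam0_def by blast
    have "norm (\<rho> y) \<le> C" for y
    proof -
      have "C * (1 / jb y ^ N) \<le> C * 1" using C(1) by (intro mult_left_mono) auto
      then show ?thesis using C(2)[of y] by simp
    qed
    then show thesis using C(1) that by blast
  qed
  obtain C where C: "0 \<le> C" "\<And>\<theta>. norm (fourier \<rho> \<theta>) \<le> C / jb \<theta> ^ N"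
  proof -
    define \<omega> where "\<omega> = (\<integral>y. 1 / jb (y::'a) ^ N \<partial>lborel)"
    obtain D where D: "0 \<le> D" "\<And>\<theta>. norm (fourier \<rho> \<theta>) \<le> D * \<omega> / jb \<theta> ^ N"
      using fourier_decay[OF \<rho>f wi, of "\<lambda>_. \<omega>"] unfolding \<omega>_def by auto
    have "0 \<le> D * \<omega>" using D(1) by (auto simp: \<omega>_def intro!: mult_nonneg_nonneg)
    then show thesis using D(2) that by blast
  qed
  define h where "h w = (norm (fourier \<rho> w))\<^sup>2" for w
  have frc: "continuous_on UNIV (fourier \<rho>)" by (rule continuous_on_fourier[OF \<rho>i])
  have hc: "continuous_on UNIV h" unfolding h_def by (intro continuous_intros frc)
  have [measurable]: "h \<in> borel_measurable borel" using hc by (rule borel_measurable_continuous_onI)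
  have hi: "integrable lborel h"
  proof (rule integrable_bound_measurable)
    show "integrable lborel (\<lambda>w :: 'a. C\<^sup>2 * (1 / jb w ^ N))" by (intro integrable_mult_right wi)
    show "norm (h w) \<le> C\<^sup>2 * (1 / jb w ^ N)" for w
    proof -
      have "h w \<le> (C / jb w ^ N)\<^sup>2" unfolding h_def by (intro power_mono C) auto
      also have "\<dots> = C\<^sup>2 * (1 / jb w ^ N) * (1 / jb w ^ N)" by (simp add: power2_eq_square)
      also have "\<dots> \<le> C\<^sup>2 * (1 / jb w ^ N) * 1" by (intro mult_left_mono) auto
      finally show ?thesis by (simp add: h_def)
    qed
  qed simp
  obtain y0 where y0: "\<gamma> y0 \<noteq> 0" using \<gamma>(2) by auto
  have \<gamma>2: "integrable lborel (\<lambda>y. (norm (\<gamma> y))\<^sup>2)" "continuous_on UNIV (\<lambda>y. (norm (\<gamma> y))\<^sup>2)"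
    using integrable_norm[OF \<rho>i] by (auto simp: \<rho>r norm_power intro!: continuous_intros schwartz_continuous \<gamma>)
  have "fourier \<rho> 0 = complex_of_real (\<integral>y. (norm (\<gamma> y))\<^sup>2 \<partial>lborel)"
    by (simp add: fourier_def \<rho>r del: of_real_power)
  moreover have "0 < (\<integral>y. (norm (\<gamma> y))\<^sup>2 \<partial>lborel)"
    using y0 by (intro integral_pos_continuous[OF \<gamma>2, of y0]) auto
  ultimately have "h 0 \<noteq> 0" by (simp add: h_def)
  then have hpos: "0 < (\<integral>w. h w \<partial>lborel)"
    by (intro integral_pos_continuous[OF hi hc, of 0]) (auto simp: h_def)
  define \<theta> where "\<theta> \<eta> = (\<integral>y. \<rho> y * \<rho> (y + \<eta>) \<partial>lborel)" for \<eta>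
  have \<theta>c: "continuous_on UNIV \<theta>" unfolding \<theta>_def
  proof (rule continuous_on_integral_dominated[where g="\<lambda>y. norm (\<rho> y) * B"])
    show "integrable lborel (\<lambda>y. norm (\<rho> y) * B)" using \<rho>i by (intro integrable_mult_left integrable_norm)
  qed (auto simp: norm_mult intro!: mult_left_mono B continuous_intros continuous_on_compose2[OF \<rho>c])
  have [measurable]: "\<theta> \<in> borel_measurable borel" using \<theta>c by (rule borel_measurable_continuous_onI)
  have \<theta>b: "norm (\<theta> \<eta>) \<le> (\<integral>y. norm (\<rho> y) * B \<partial>lborel)" for \<eta>
  proof -
    have "norm (\<theta> \<eta>) \<le> (\<integral>y. norm (\<rho> y * \<rho> (y + \<eta>)) \<partial>lborel)" unfolding \<theta>_def by (rule integral_norm_bound)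
    also have "\<dots> \<le> (\<integral>y. norm (\<rho> y) * B \<partial>lborel)"
    proof (rule integral_mono)
      show "integrable lborel (\<lambda>y. norm (\<rho> y) * B)" using \<rho>i by (intro integrable_mult_left integrable_norm)
      then show "integrable lborel (\<lambda>y. norm (\<rho> y * \<rho> (y + \<eta>)))"
        by (rule integrable_bound_measurable) (auto simp: norm_mult intro!: mult_left_mono B)
    qed (auto simp: norm_mult intro!: mult_left_mono B)
    finally show ?thesis .
  qed
  have int2: "integrable (lborel \<Otimes>\<^sub>M lborel) (\<lambda>(y, \<eta>). \<rho> y * \<rho> (y + \<eta>))"
  proof (rule lborel_pair.Fubini_integrable)
    have "integrable lborel (\<lambda>y. norm (\<rho> y) * (\<integral>\<eta>. norm (\<rho> \<eta>) \<partial>lborel))"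
      using \<rho>i by (intro integrable_mult_left integrable_norm)
    moreover have "(\<integral>\<eta>. norm (\<rho> (y + \<eta>)) \<partial>lborel) = (\<integral>\<eta>. norm (\<rho> \<eta>) \<partial>lborel)" for y
      using integral_lborel_translate[of "\<lambda>y. complex_of_real (norm (\<rho> y))" y] by simp
    ultimately show "integrable lborel (\<lambda>y. \<integral>\<eta>. norm (case (y, \<eta>) of (y, \<eta>) \<Rightarrow> \<rho> y * \<rho> (y + \<eta>)) \<partial>lborel)"
      by (simp add: norm_mult)
    show "AE y in lborel. integrable lborel (\<lambda>\<eta>. case (y, \<eta>) of (y, \<eta>) \<Rightarrow> \<rho> y * \<rho> (y + \<eta>))"
      using integrable_lborel_translate[OF \<rho>i] by (intro AE_I2) simp
  qed measurable
  have \<theta>i: "integrable lborel \<theta>"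
    unfolding \<theta>_def using lborel_pair.integrable_snd[OF int2] by simp
  have \<theta>F: "fourier \<theta> w = complex_of_real (h w)" for w
  proof -
    have i3: "integrable (lborel \<Otimes>\<^sub>M lborel) (\<lambda>(y, \<eta>). exp (\<i> * complex_of_real (w \<bullet> \<eta>)) * (\<rho> y * \<rho> (y + \<eta>)))"
      using integrable_exp_mult[OF int2, of "\<lambda>z. w \<bullet> snd z"] by (simp add: split_beta')
    have "fourier \<theta> w = (\<integral>\<eta>. (\<integral>y. exp (\<i> * complex_of_real (w \<bullet> \<eta>)) * (\<rho> y * \<rho> (y + \<eta>)) \<partial>lborel) \<partial>lborel)"
      by (simp add: fourier_def \<theta>_def)
    also have "\<dots> = (\<integral>y. (\<integral>\<eta>. exp (\<i> * complex_of_real (w \<bullet> \<eta>)) * (\<rho> y * \<rho> (y + \<eta>)) \<partial>lborel) \<partial>lborel)"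
      by (rule lborel_pair.Fubini_integral[OF i3])
    also have "\<dots> = (\<integral>y. cnj (exp (\<i> * complex_of_real (w \<bullet> y)) * \<rho> y) * fourier \<rho> w \<partial>lborel)"
    proof (rule Bochner_Integration.integral_cong[OF refl])
      fix y
      let ?G = "\<lambda>\<eta>. exp (\<i> * complex_of_real (w \<bullet> \<eta>)) * \<rho> \<eta>"
      have cc: "cnj (exp (\<i> * complex_of_real r)) * exp (\<i> * complex_of_real r) = 1" for r
        by (simp add: exp_cnj flip: exp_add)
      have "(\<integral>\<eta>. exp (\<i> * complex_of_real (w \<bullet> \<eta>)) * (\<rho> y * \<rho> (y + \<eta>)) \<partial>lborel) = 
          (\<integral>\<eta>. cnj (exp (\<i> * complex_of_real (w \<bullet> y)) * \<rho> y) * ?G (y + \<eta>) \<partial>lborel)"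
        using cc by (intro Bochner_Integration.integral_cong refl)
          (simp add: \<rho>r exp_cnj[symmetric] inner_add_right ring_distribs exp_add exp_minus flip: exp_diff mult.assoc)
      also have "\<dots> = cnj (exp (\<i> * complex_of_real (w \<bullet> y)) * \<rho> y) * (\<integral>\<eta>. ?G (y + \<eta>) \<partial>lborel)"
        by simp
      also have "(\<integral>\<eta>. ?G (y + \<eta>) \<partial>lborel) = fourier \<rho> w"
        unfolding fourier_def by (rule integral_lborel_translate) measurable
      finally show "(\<integral>\<eta>. exp (\<i> * complex_of_real (w \<bullet> \<eta>)) * (\<rho> y * \<rho> (y + \<eta>)) \<partial>lborel) = 
          cnj (exp (\<i> * complex_of_real (w \<bullet> y)) * \<rho> y) * fourier \<rho> w" .
    qed
    also have "\<dots> = cnj (fourier \<rho> w) * fourier \<rho> w"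
      by (simp add: fourier_def flip: Bochner_Integration.integral_cnj)
    also have "\<dots> = complex_of_real (h w)" by (simp only: h_def complex_norm_square mult.commute)
    finally show ?thesis .
  qed
  \<comment> \<open>At 0 the kernel is the integral of the fourth power of the modulus of \<gamma>;
    it has to be nonzero because the inversion constant is the integral of \<open>h\<close> divided
    by \<open>\<theta> 0\<close>.\<close>
  have \<theta>0: "\<theta> 0 \<noteq> 0"
  proof -
    have i: "integrable lborel (\<lambda>y. (norm (\<gamma> y))^4)"
    proof -
      have "integrable lborel (\<lambda>y. norm (\<rho> y) * B)" using \<rho>i by (intro integrable_mult_left integrable_norm)
      then have "integrable lborel (\<lambda>y. \<rho> y * \<rho> y)"
        by (rule integrable_bound_measurable) (auto simp: norm_mult intro!: mult_left_mono B)
      then have "integrable lborel (\<lambda>y. norm (\<rho> y * \<rho> y))" by (rule integrable_norm)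
      then show ?thesis by (simp add: \<rho>r norm_mult norm_power flip: power_add)
    qed
    have "\<theta> 0 = complex_of_real (\<integral>y. (norm (\<gamma> y))^4 \<partial>lborel)"
    proof -
      have "\<rho> y * \<rho> (y + 0) = complex_of_real ((norm (\<gamma> y))^4)" for y
        by (simp add: \<rho>r power4_eq_xxxx power2_eq_square)
      then show ?thesis by (simp only: \<theta>_def integral_complex_of_real)
    qed
    moreover have "0 < (\<integral>y. (norm (\<gamma> y))^4 \<partial>lborel)"
      using y0 by (intro integral_pos_continuous[OF i, of y0]) (auto intro!: continuous_intros schwartz_continuous \<gamma>)
    ultimately show ?thesis by simp
  qed
  show thesis
  proof (rule that[of "complex_of_real (\<integral>w. h w \<partial>lborel) / \<theta> 0"])
    fix \<phi> :: "'a \<Rightarrow> complex" and y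
    assume \<phi>: "continuous_on UNIV \<phi>" "bounded (range \<phi>)" "integrable lborel \<phi>" "integrable lborel (fourier \<phi>)"
    have [measurable]: "\<phi> \<in> borel_measurable borel" "fourier \<phi> \<in> borel_measurable borel" using \<phi> by auto
    obtain K where K: "\<And>x. norm (\<phi> x) \<le> K" using \<phi>(2) by (auto simp: bounded_iff)
    let ?X = "\<lambda>\<eta>. exp (- \<i> * complex_of_real (\<eta> \<bullet> y)) * fourier \<phi> \<eta>"
    have Xi: "integrable lborel ?X"
      using integrable_exp_mult[OF \<phi>(4), of "\<lambda>\<eta>. - (\<eta> \<bullet> y)"] by simp
    \<comment> \<open>Fubini moves the transform from \<theta> to \<phi>, and the dilation by
      \<open>e\<close> then changes sides. On the left \<phi> is averaged near \<open>y\<close>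
      against \<open>h\<close>, on the right the inversion integral is damped by
      \<open>\<theta> (e *\<^sub>R \<eta>)\<close>. As \<open>e\<close> tends to 0 the two sides
      become \<open>\<phi> y\<close> times the integral of \<open>h\<close>, and
      \<open>\<theta> 0\<close> times the inversion integral.\<close>
    have AB: "(\<integral>w. \<phi> (y + e *\<^sub>R w) * complex_of_real (h w) \<partial>lborel) = (\<integral>\<eta>. \<theta> (e *\<^sub>R \<eta>) * ?X \<eta> \<partial>lborel)" 
      if e: "0 < e" for e
    proof -
      have \<phi>e: "integrable lborel (\<lambda>w. \<phi> (y + e *\<^sub>R w))" by (rule integrable_lborel_affine[OF \<phi>(3) e])
      have i0: "integrable (lborel \<Otimes>\<^sub>M lborel) (\<lambda>(w, \<eta>). \<phi> (y + e *\<^sub>R w) * \<theta> \<eta>)"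
        using \<phi>e \<theta>i by (intro lborel_pair.Fubini_integrable) 
          (auto simp: norm_mult intro!: integrable_mult_left integrable_mult_right AE_I2)
      have i1: "integrable (lborel \<Otimes>\<^sub>M lborel) (\<lambda>(w, \<eta>). exp (\<i> * complex_of_real (w \<bullet> \<eta>)) * (\<phi> (y + e *\<^sub>R w) * \<theta> \<eta>))"
        using integrable_exp_mult[OF i0, of "\<lambda>z. fst z \<bullet> snd z"] by (simp add: split_beta')
      have "(\<integral>w. \<phi> (y + e *\<^sub>R w) * complex_of_real (h w) \<partial>lborel) = 
          (\<integral>w. (\<integral>\<eta>. exp (\<i> * complex_of_real (w \<bullet> \<eta>)) * (\<phi> (y + e *\<^sub>R w) * \<theta> \<eta>) \<partial>lborel) \<partial>lborel)"
        by (simp add: \<theta>F[symmetric] fourier_def mult.left_commute[of _ "\<phi> _"])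
      also have "\<dots> = (\<integral>\<eta>. (\<integral>w. exp (\<i> * complex_of_real (w \<bullet> \<eta>)) * (\<phi> (y + e *\<^sub>R w) * \<theta> \<eta>) \<partial>lborel) \<partial>lborel)"
        by (rule lborel_pair.Fubini_integral[OF i1, symmetric])
      also have "\<dots> = (\<integral>\<eta>. \<theta> \<eta> * (\<integral>w. exp (\<i> * complex_of_real (w \<bullet> \<eta>)) * \<phi> (y + e *\<^sub>R w) \<partial>lborel) \<partial>lborel)"
        by (simp add: mult_ac flip: integral_mult_right_zero)
      also have "\<dots> = e ^ DIM('a) *\<^sub>R (\<integral>\<eta>. \<theta> (0 + e *\<^sub>R \<eta>) * (\<integral>w. exp (\<i> * complex_of_real (w \<bullet> (0 + e *\<^sub>R \<eta>))) * \<phi> (y + e *\<^sub>R w) \<partial>lborel) \<partial>lborel)"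
        using e by (rule integral_lborel_affine[rotated]) measurable
      also have "\<dots> = (\<integral>\<eta>. \<theta> (e *\<^sub>R \<eta>) * (e ^ DIM('a) *\<^sub>R (\<integral>w. exp (\<i> * complex_of_real (e * (w \<bullet> \<eta>))) * \<phi> (y + e *\<^sub>R w) \<partial>lborel)) \<partial>lborel)"
        by (subst integral_scaleR_right[symmetric], rule Bochner_Integration.integral_cong[OF refl]) simp
      also have "\<dots> = (\<integral>\<eta>. \<theta> (e *\<^sub>R \<eta>) * ?X \<eta> \<partial>lborel)"
      proof (intro Bochner_Integration.integral_cong refl arg_cong2[where f="(*)"])
        fix \<eta>
        have "(\<integral>w. exp (\<i> * complex_of_real (e * (w \<bullet> \<eta>))) * \<phi> (y + e *\<^sub>R w) \<partial>lborel) = 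
          (\<integral>w. exp (- \<i> * complex_of_real (\<eta> \<bullet> y)) * (exp (\<i> * complex_of_real (\<eta> \<bullet> (y + e *\<^sub>R w))) * \<phi> (y + e *\<^sub>R w)) \<partial>lborel)"
        proof (intro Bochner_Integration.integral_cong refl)
          fix w
          have "exp (\<i> * complex_of_real (e * (w \<bullet> \<eta>))) = exp (- \<i> * complex_of_real (\<eta> \<bullet> y) + \<i> * complex_of_real (\<eta> \<bullet> (y + e *\<^sub>R w)))"
            by (simp add: inner_add_right inner_commute distrib_left)
          then show "exp (\<i> * complex_of_real (e * (w \<bullet> \<eta>))) * \<phi> (y + e *\<^sub>R w) = 
             exp (- \<i> * complex_of_real (\<eta> \<bullet> y)) * (exp (\<i> * complex_of_real (\<eta> \<bullet> (y + e *\<^sub>R w))) * \<phi> (y + e *\<^sub>R w))"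
            by (simp only: exp_add mult.assoc)
        qed
        also have "\<dots> = exp (- \<i> * complex_of_real (\<eta> \<bullet> y)) * (\<integral>w. exp (\<i> * complex_of_real (\<eta> \<bullet> (y + e *\<^sub>R w))) * \<phi> (y + e *\<^sub>R w) \<partial>lborel)"
          by (rule integral_mult_right_zero)
        finally show "e ^ DIM('a) *\<^sub>R (\<integral>w. exp (\<i> * complex_of_real (e * (w \<bullet> \<eta>))) * \<phi> (y + e *\<^sub>R w) \<partial>lborel) = ?X \<eta>"
          unfolding fourier_def using integral_lborel_affine[OF _ e, of "\<lambda>z. exp (\<i> * complex_of_real (\<eta> \<bullet> z)) * \<phi> z" y] by simp
      qed
      finally show ?thesis .
    qed
    let ?e = "\<lambda>n. 1 / real (Suc n)"
    have e0: "?e \<longlonglongrightarrow> 0" using LIMSEQ_Suc[OF lim_1_over_n] by simp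
    have L1: "(\<lambda>n. \<integral>w. \<phi> (y + ?e n *\<^sub>R w) * complex_of_real (h w) \<partial>lborel) \<longlonglongrightarrow> (\<integral>w. \<phi> y * complex_of_real (h w) \<partial>lborel)"
    proof (rule integral_dominated_convergence[where w="\<lambda>w. K * h w"])
      show "AE w in lborel. (\<lambda>n. \<phi> (y + ?e n *\<^sub>R w) * complex_of_real (h w)) \<longlonglongrightarrow> \<phi> y * complex_of_real (h w)"
      proof (rule AE_I2)
        fix w
        have "(\<lambda>n. y + ?e n *\<^sub>R w) \<longlonglongrightarrow> y + 0 *\<^sub>R w" by (intro tendsto_intros e0)
        then have "(\<lambda>n. \<phi> (y + ?e n *\<^sub>R w)) \<longlonglongrightarrow> \<phi> y"
          using \<phi>(1) by (auto intro: continuous_on_tendsto_compose)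
        then show "(\<lambda>n. \<phi> (y + ?e n *\<^sub>R w) * complex_of_real (h w)) \<longlonglongrightarrow> \<phi> y * complex_of_real (h w)"
          by (intro tendsto_intros)
      qed
      show "AE w in lborel. norm (\<phi> (y + ?e n *\<^sub>R w) * complex_of_real (h w)) \<le> K * h w" for n
        by (intro AE_I2) (simp add: norm_mult h_def norm_power mult_right_mono K)
    qed (use hi in auto)
    have L2: "(\<lambda>n. \<integral>\<eta>. \<theta> (?e n *\<^sub>R \<eta>) * ?X \<eta> \<partial>lborel) \<longlonglongrightarrow> (\<integral>\<eta>. \<theta> 0 * ?X \<eta> \<partial>lborel)"
    proof (rule integral_dominated_convergence[where w="\<lambda>\<eta>. (\<integral>y. norm (\<rho> y) * B \<partial>lborel) * norm (?X \<eta>)"])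
      show "AE \<eta> in lborel. (\<lambda>n. \<theta> (?e n *\<^sub>R \<eta>) * ?X \<eta>) \<longlonglongrightarrow> \<theta> 0 * ?X \<eta>"
      proof (rule AE_I2)
        fix w :: 'a
        have "(\<lambda>n. ?e n *\<^sub>R w) \<longlonglongrightarrow> 0 *\<^sub>R w" by (intro tendsto_intros e0)
        then have "(\<lambda>n. \<theta> (?e n *\<^sub>R w)) \<longlonglongrightarrow> \<theta> 0"
          using \<theta>c by (auto intro: continuous_on_tendsto_compose)
        then show "(\<lambda>n. \<theta> (?e n *\<^sub>R w) * ?X w) \<longlonglongrightarrow> \<theta> 0 * ?X w"
          by (intro tendsto_intros)
      qed
      show "AE \<eta> in lborel. norm (\<theta> (?e n *\<^sub>R \<eta>) * ?X \<eta>) \<le> (\<integral>y. norm (\<rho> y) * B \<partial>lborel) * norm (?X \<eta>)" for n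
        unfolding norm_mult[of "\<theta> _"] by (intro AE_I2 mult_right_mono \<theta>b) auto
      show "integrable lborel (\<lambda>\<eta>. (\<integral>y. norm (\<rho> y) * B \<partial>lborel) * norm (?X \<eta>))"
        using Xi by (intro integrable_mult_right integrable_norm)
    qed (use Xi in auto)
    have "(\<integral>w. \<phi> y * complex_of_real (h w) \<partial>lborel) = (\<integral>\<eta>. \<theta> 0 * ?X \<eta> \<partial>lborel)"
      using L1 L2 AB by (intro LIMSEQ_unique[OF L1]) simp
    then have "\<phi> y * complex_of_real (\<integral>w. h w \<partial>lborel) = \<theta> 0 * (\<integral>\<eta>. ?X \<eta> \<partial>lborel)"
      using Xi by simp
    then show "(\<integral>\<eta>. ?X \<eta> \<partial>lborel) = complex_of_real (\<integral>w. h w \<partial>lborel) / \<theta> 0 * \<phi> y"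
      using \<theta>0 by (simp add: field_simps)
  qed (use hpos \<theta>0 in auto)
qed

subsection \<open>Reconstruction from the short-time Fourier transform\<close>

text \<open>The time-frequency shift of \<gamma>, with position \<open>fst t\<close> and frequency
  \<open>snd t\<close> joined into one point, so that phase space is a single Euclidean space with
  its own Lebesgue measure.\<close>

definition tf_shift :: "('a::euclidean_space \<Rightarrow> complex) \<Rightarrow> 'a \<times> 'a \<Rightarrow> 'a \<Rightarrow> complex" where
  "tf_shift \<gamma> t = modulation (snd t) (translation (fst t) \<gamma>)"

lemma tf_shift_apply: "tf_shift \<gamma> t y = exp (\<i> * complex_of_real (snd t \<bullet> y)) * \<gamma> (y - fst t)"
  by (simp add: tf_shift_def modulation_def translation_def)

lemma cnj_tf_shift: "cnj (tf_shift \<gamma> t y) = exp (- \<i> * complex_of_real (snd t \<bullet> y)) * cnj (\<gamma> (y - fst t))"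
  by (simp add: tf_shift_apply exp_cnj)

lemma stft_eq: "stft \<gamma> u (fst t) (snd t) = complex_of_real ((2 * pi) powr (- real DIM('a) / 2)) * u (\<lambda>y. cnj (tf_shift \<gamma> t y))"
  for \<gamma> :: "'a::euclidean_space \<Rightarrow> complex"
  by (simp add: stft_def pairing_def tf_shift_def)

lemma fam_tf_shift:
  fixes \<gamma> :: "'a::euclidean_space \<Rightarrow> complex"
  assumes \<gamma>: "\<gamma> \<in> schwartz"
  shows "fam n (\<lambda>t y. jb (snd t) ^ n * (1 / jb (y - fst t) ^ N)) (tf_shift \<gamma>)"
  unfolding tf_shift_apply[abs_def]
  by (intro fam_mult fam_exp fam_translate[where f="\<lambda>p. \<gamma>" and w="\<lambda>p y. 1 / jb y ^ N"] fam_schwartz \<gamma> continuous_intros)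

text \<open>Peetre's inequality moves the centre of decay from \<open>fst t\<close> to the origin.
  What remains is polynomial growth in \<open>t\<close>, to be beaten by rapidly decaying
  coefficients.\<close>

lemma fam_tf_shift':
  fixes \<gamma> :: "'a::euclidean_space \<Rightarrow> complex"
  assumes \<gamma>: "\<gamma> \<in> schwartz"
  shows "fam n (\<lambda>t y. (jb (snd t) ^ n * jb (fst t) ^ N) / jb y ^ N) (\<lambda>t y. cnj (tf_shift \<gamma> t y))"
proof (rule fam_mono[where K="2 ^ N"])
  show "fam n (\<lambda>t y. jb (snd t) ^ n * (1 / jb (y - fst t) ^ N)) (\<lambda>t y. cnj (tf_shift \<gamma> t y))"
    by (rule fam_cnj[OF fam_tf_shift[OF \<gamma>]])
  fix t :: "'a \<times> 'a" and y :: 'a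
  have "1 / jb (y - fst t) ^ N \<le> 2 ^ N * jb (fst t) ^ N / jb y ^ N"
    using inverse_jb_Peetre[of y "- fst t" N] by simp
  then have "jb (snd t) ^ n * (1 / jb (y - fst t) ^ N) \<le> jb (snd t) ^ n * (2 ^ N * jb (fst t) ^ N / jb y ^ N)"
    by (intro mult_left_mono) auto
  then show "jb (snd t) ^ n * (1 / jb (y - fst t) ^ N) \<le> 2 ^ N * ((jb (snd t) ^ n * jb (fst t) ^ N) / jb y ^ N)"
    by (simp add: mult_ac)
qed simp

lemma cnj_tf_shift_schwartz:
  assumes "\<gamma> \<in> schwartz" shows "(\<lambda>y. cnj (tf_shift \<gamma> t y)) \<in> schwartz"
  by (rule schwartzI_fam[of "\<lambda>t y. cnj (tf_shift \<gamma> t y)"]) (rule exI, rule fam_tf_shift'[OF assms])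

lemma continuous_on_stft:
  fixes \<gamma> :: "'a::euclidean_space \<Rightarrow> complex"
  assumes \<gamma>: "\<gamma> \<in> schwartz" and u: "u \<in> tempered_distributions"
  shows "continuous_on UNIV (\<lambda>t. stft \<gamma> u (fst t) (snd t))"
  unfolding stft_eq
proof (intro continuous_intros continuous_on_tempered_family[OF u])
  show "\<exists>h. continuous_on UNIV h \<and> fam n (\<lambda>p y. h p / jb y ^ N) (\<lambda>t y. cnj (tf_shift \<gamma> t y))" for n N
    by (rule exI[of _ "\<lambda>t. jb (snd t) ^ n * jb (fst t) ^ N"], rule conjI[OF _ fam_tf_shift'[OF \<gamma>]])
      (intro continuous_intros)
qed

lemma measurable_stft:
  fixes \<gamma> :: "'a::euclidean_space \<Rightarrow> complex"
  assumes \<gamma>: "\<gamma> \<in> schwartz" and u: "u \<in> tempered_distributions"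
  shows "(\<lambda>t. stft \<gamma> u (fst t) (snd t)) \<in> borel_measurable borel"
  by (rule borel_measurable_continuous_onI[OF continuous_on_stft[OF assms]])

lemma distr_lborel_reflect: "distr lborel borel (\<lambda>x. t - x) = (lborel :: 'a::euclidean_space measure)"
  using lborel_affine[of "-1" t] by (simp add: density_1)

lemma integral_lborel_reflect:
  fixes f :: "'a::euclidean_space \<Rightarrow> 'b::{banach, second_countable_topology}"
  assumes [measurable]: "f \<in> borel_measurable borel"
  shows "(\<integral>x. f (t - x) \<partial>lborel) = (\<integral>x. f x \<partial>lborel)"
proof -
  have "(\<integral>x. f x \<partial>lborel) = (\<integral>x. f x \<partial>distr lborel borel (\<lambda>x. t - x))"
    by (simp add: distr_lborel_reflect)
  also have "\<dots> = (\<integral>x. f (t - x) \<partial>lborel)" by (simp add: integral_distr)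
  finally show ?thesis by simp
qed

lemma nn_integral_lborel_reflect:
  fixes f :: "'a::euclidean_space \<Rightarrow> ennreal"
  assumes [measurable]: "f \<in> borel_measurable borel"
  shows "(\<integral>\<^sup>+x. f (t - x) \<partial>lborel) = (\<integral>\<^sup>+x. f x \<partial>lborel)"
proof -
  have "(\<integral>\<^sup>+x. f x \<partial>lborel) = (\<integral>\<^sup>+x. f x \<partial>distr lborel borel (\<lambda>x. t - x))"
    by (simp add: distr_lborel_reflect)
  also have "\<dots> = (\<integral>\<^sup>+x. f (t - x) \<partial>lborel)" by (simp add: nn_integral_distr)
  finally show ?thesis by simp
qed

lemma norm_integral_le_nn_integral:
  fixes f :: "'a \<Rightarrow> 'b::{banach, second_countable_topology}"
  shows "ennreal (norm (\<integral>x. f x \<partial>M)) \<le> (\<integral>\<^sup>+x. ennreal (norm (f x)) \<partial>M)"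
  using integral_norm_bound_ennreal[of M f] not_integrable_integral_eq[of M f] by (cases "integrable M f") auto

lemma schwartz_bound:
  assumes "\<gamma> \<in> schwartz"
  obtains C where "0 \<le> C" "\<And>y. norm (\<gamma> y) \<le> C * (1 / jb y ^ N)"
  using fam_fam0[OF fam_schwartz[OF assms, of 0 N]] unfolding fam0_def by blast

lemma schwartz_integrable: 
  fixes \<phi> :: "'a::euclidean_space \<Rightarrow> complex"
  assumes "\<phi> \<in> schwartz" shows "integrable lborel \<phi>"
  using fam0_integrable[OF fam_fam0[OF fam_schwartz[OF assms, of 0 "Suc DIM('a)"]] integrable_jb_power] by simp

text \<open>Up to normalisation the conjugate of the short-time Fourier transform of
  \<open>cnj \<phi>\<close>: distributions act bilinearly, so test functions are analysed by the
  transposed map and not by the adjoint.\<close>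

definition window_coeff :: "('a::euclidean_space \<Rightarrow> complex) \<Rightarrow> ('a \<Rightarrow> complex) \<Rightarrow> 'a \<times> 'a \<Rightarrow> complex" where
  "window_coeff \<gamma> \<phi> t = (\<integral>y. tf_shift \<gamma> t y * \<phi> y \<partial>lborel)"

lemma window_coeff_fourier: "window_coeff \<gamma> \<phi> t = fourier (\<lambda>y. \<gamma> (y - fst t) * \<phi> y) (snd t)"
  by (simp add: window_coeff_def fourier_def tf_shift_apply mult.assoc)

lemma continuous_tf_shift:
  assumes "\<gamma> \<in> schwartz"
  shows "continuous_on UNIV (\<lambda>t. tf_shift \<gamma> t y)" "continuous_on UNIV (tf_shift \<gamma> t)"
    "continuous_on UNIV (\<lambda>z. tf_shift \<gamma> (fst z) (snd z))"
  unfolding tf_shift_apply[abs_def]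
  by (intro continuous_intros continuous_on_compose2[OF schwartz_continuous[OF assms, of UNIV]]; simp)+

text \<open>If \<open>z\<close> is large, the window at \<open>z\<close> or \<phi> at
  \<open>y\<close> must be small: \<open>L\<close> powers of the decay of \<phi> are traded for
  decay in \<open>z\<close>, and \<open>d + 1\<close> powers remain for integrability in
  \<open>y\<close>.\<close>

lemma window_coeff_family:
  fixes \<gamma> :: "'a::euclidean_space \<Rightarrow> complex"
  assumes \<gamma>: "\<gamma> \<in> schwartz" and \<phi>: "\<phi> \<in> schwartz"
  shows "fam M (\<lambda>z y. (1 / jb z ^ L) * (1 / jb y ^ Suc DIM('a))) (\<lambda>z y. \<gamma> (y - z) * \<phi> y)"
proof (rule fam_mono[where K="2 ^ L"])
  show "fam M (\<lambda>z y. (1 / jb (y - z) ^ L) * (1 / jb y ^ (L + Suc DIM('a)))) (\<lambda>z y. \<gamma> (y - z) * \<phi> y)"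
    by (intro fam_mult fam_translate[where f="\<lambda>p. \<gamma>" and w="\<lambda>p y. 1 / jb y ^ L"] fam_schwartz \<gamma> \<phi> continuous_intros)
  fix z y :: 'a
  have "1 / jb (y - z) ^ L \<le> 2 ^ L * jb y ^ L / jb z ^ L"
    using inverse_jb_Peetre[of "- z" y L] by simp
  then have "(1 / jb (y - z) ^ L) * (1 / jb y ^ (L + Suc DIM('a))) \<le> (2 ^ L * jb y ^ L / jb z ^ L) * (1 / jb y ^ (L + Suc DIM('a)))"
    by (rule mult_right_mono) simp
  then show "(1 / jb (y - z) ^ L) * (1 / jb y ^ (L + Suc DIM('a))) \<le> 2 ^ L * ((1 / jb z ^ L) * (1 / jb y ^ Suc DIM('a)))"
    by (simp add: power_add)
qed simp

lemma window_coeff_decay: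
  fixes \<gamma> :: "'a::euclidean_space \<Rightarrow> complex"
  assumes \<gamma>: "\<gamma> \<in> schwartz" and \<phi>: "\<phi> \<in> schwartz"
  obtains C where "0 \<le> C" "\<And>t. norm (window_coeff \<gamma> \<phi> t) \<le> C * (1 / (jb (fst t) ^ L * jb (snd t) ^ M))"
proof -
  define I where "I = (\<integral>y. 1 / jb (y::'a) ^ Suc DIM('a) \<partial>lborel)"
  have w: "integrable lborel (\<lambda>y :: 'a. (1 / jb z ^ L) * (1 / jb y ^ Suc DIM('a)))" for z :: 'a
    by (intro integrable_mult_right integrable_jb_power) simp
  have \<omega>: "(\<integral>y. (1 / jb z ^ L) * (1 / jb (y::'a) ^ Suc DIM('a)) \<partial>lborel) \<le> (1 / jb z ^ L) * I" for z :: 'a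
    unfolding I_def by (subst integral_mult_right_zero) simp
  obtain C where C: "0 \<le> C" "\<And>(z::'a) \<theta>. norm (fourier (\<lambda>y. \<gamma> (y - z) * \<phi> y) \<theta>) \<le> C * ((1 / jb z ^ L) * I) / jb \<theta> ^ M"
    using fourier_decay[OF window_coeff_family[OF \<gamma> \<phi>] w \<omega>] by blast
  have "0 \<le> C * I" using C by (auto simp: I_def intro!: mult_nonneg_nonneg)
  moreover have "norm (window_coeff \<gamma> \<phi> t) \<le> C * I * (1 / (jb (fst t) ^ L * jb (snd t) ^ M))" for t
    using C(2)[of "fst t" "snd t"] by (simp add: window_coeff_fourier)
  ultimately show thesis by (rule that)
qed

lemma continuous_on_window_coeff:
  fixes \<gamma> :: "'a::euclidean_space \<Rightarrow> complex"
  assumes \<gamma>: "\<gamma> \<in> schwartz" and \<phi>: "integrable lborel \<phi>"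
  shows "continuous_on UNIV (window_coeff \<gamma> \<phi>)"
proof -
  have [measurable]: "\<phi> \<in> borel_measurable borel" using \<phi> by auto
  obtain C where C: "0 \<le> C" "\<And>y. norm (\<gamma> y) \<le> C * (1 / jb y ^ 0)" by (rule schwartz_bound[OF \<gamma>, where N=0]) blast
  have [measurable]: "tf_shift \<gamma> t \<in> borel_measurable borel" for t
    by (rule borel_measurable_continuous_onI[OF continuous_tf_shift(2)[OF \<gamma>]])
  show ?thesis unfolding window_coeff_def
  proof (rule continuous_on_integral_dominated)
  show "integrable lborel (\<lambda>y. C * norm (\<phi> y))" using \<phi> by simp
  show "norm (tf_shift \<gamma> t y * \<phi> y) \<le> C * norm (\<phi> y)" for t y
    using C by (simp add: norm_mult tf_shift_apply mult_right_mono)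
  show "(\<lambda>y. tf_shift \<gamma> t y * \<phi> y) \<in> borel_measurable lborel" for t
    by measurable
  qed (intro continuous_intros continuous_tf_shift[OF \<gamma>])
qed

lemma integrable_lborel_prod_mult:
  fixes f g :: "'a::euclidean_space \<Rightarrow> real"
  assumes "integrable lborel f" "integrable lborel g"
  shows "integrable lborel (\<lambda>t. f (fst t) * g (snd t))"
proof -
  have [measurable]: "f \<in> borel_measurable borel" "g \<in> borel_measurable borel" using assms by auto
  have "integrable (lborel \<Otimes>\<^sub>M lborel) (\<lambda>(z, \<eta>). f z * g \<eta>)"
    using assms by (intro lborel_pair.Fubini_integrable) (auto simp: abs_mult)
  then show ?thesis by (simp add: lborel_prod split_beta')
qed

text \<open>For fixed position \<open>z\<close> the frequency integral is Fourier inversion of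
  \<open>\<gamma> (y - z) * \<phi> y\<close>; integrating the remaining square of the window over
  \<open>z\<close> gives the constant. In the last claim the transform of \<open>H\<close> times a
  shifted conjugate window vanishes identically, so inversion makes that product zero, and
  \<open>z\<close> can be chosen with the window nonzero at \<open>y - z\<close>.\<close>

lemma window_expansion:
  fixes \<gamma> :: "'a::euclidean_space \<Rightarrow> complex"
  assumes \<gamma>: "\<gamma> \<in> schwartz" "\<gamma> \<noteq> (\<lambda>_. 0)"
  obtains c :: complex where "c \<noteq> 0" 
    "\<And>\<phi> y. \<phi> \<in> schwartz \<Longrightarrow> (\<integral>t. window_coeff \<gamma> \<phi> t * cnj (tf_shift \<gamma> t y) \<partial>lborel) = c * \<phi> y"
    "\<And>H :: 'a \<Rightarrow> complex. continuous_on UNIV H \<Longrightarrow> bounded (range H) \<Longrightarrow> (\<And>\<phi>. \<phi> \<in> schwartz \<Longrightarrow> (\<integral>y. H y * \<phi> y \<partial>lborel) = 0) \<Longrightarrow> H = (\<lambda>_. 0)"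
proof -
  obtain c0 :: complex where c0: "c0 \<noteq> 0" and inv: 
    "\<And>(\<phi> :: 'a \<Rightarrow> complex) y. continuous_on UNIV \<phi> \<Longrightarrow> bounded (range \<phi>) \<Longrightarrow> integrable lborel \<phi> \<Longrightarrow> 
       integrable lborel (fourier \<phi>) \<Longrightarrow> 
       (\<integral>\<eta>. exp (- \<i> * complex_of_real (\<eta> \<bullet> y)) * fourier \<phi> \<eta> \<partial>lborel) = c0 * \<phi> y"
    by (rule fourier_inversion[OF \<gamma>]) blast
  define n0 where "n0 = Suc DIM('a)"
  have wi: "integrable lborel (\<lambda>y :: 'a. 1 / jb y ^ n0)" by (rule integrable_jb_power) (simp add: n0_def)
  obtain y0 where y0: "\<gamma> y0 \<noteq> 0" using \<gamma>(2) by auto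
  have "fam 0 (\<lambda>(p::real) y. 1 / jb y ^ n0 * (1 / jb y ^ 0)) (\<lambda>p y. \<gamma> y * cnj (\<gamma> y))"
    by (intro fam_mult fam_cnj fam_schwartz \<gamma>)
  then have "fam0 (\<lambda>(p::real) y. 1 / jb y ^ n0) (\<lambda>p y. \<gamma> y * cnj (\<gamma> y))" by simp
  from fam0_integrable[OF this wi] have \<gamma>2: "integrable lborel (\<lambda>y. \<gamma> y * cnj (\<gamma> y))" .
  have N2: "(\<integral>y. \<gamma> y * cnj (\<gamma> y) \<partial>lborel) \<noteq> 0"
  proof -
    have *: "\<gamma> y * cnj (\<gamma> y) = complex_of_real ((norm (\<gamma> y))\<^sup>2)" for y by (rule complex_norm_square[symmetric])
    have "0 < (\<integral>y. (norm (\<gamma> y))\<^sup>2 \<partial>lborel)"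
    proof (rule integral_pos_continuous)
      show "integrable lborel (\<lambda>y. (norm (\<gamma> y))\<^sup>2)" 
        using integrable_norm[OF \<gamma>2] by (simp add: norm_mult power2_eq_square)
    qed (use y0 in \<open>auto intro!: continuous_intros schwartz_continuous \<gamma>\<close>)
    then show ?thesis unfolding * integral_complex_of_real by simp
  qed
  have gm[measurable]: "\<gamma> \<in> borel_measurable borel" 
    by (rule borel_measurable_continuous_onI[OF schwartz_continuous[OF \<gamma>(1)]])
  obtain C\<gamma> where C\<gamma>: "0 \<le> C\<gamma>" "\<And>y. norm (\<gamma> y) \<le> C\<gamma> * (1 / jb y ^ 0)" by (rule schwartz_bound[OF \<gamma>(1), where N=0]) blast
  show thesis
  proof (rule that[of "c0 * (\<integral>y. \<gamma> y * cnj (\<gamma> y) \<partial>lborel)"])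
    fix \<phi> :: "'a \<Rightarrow> complex" and y
    assume \<phi>: "\<phi> \<in> schwartz"
    let ?W = "window_coeff \<gamma> \<phi>"
    obtain C where C: "0 \<le> C" "\<And>t. norm (?W t) \<le> C * (1 / (jb (fst t) ^ n0 * jb (snd t) ^ n0))"
      by (rule window_coeff_decay[OF \<gamma>(1) \<phi>, where L=n0 and M=n0]) blast
    have Wc: "continuous_on UNIV ?W" by (rule continuous_on_window_coeff[OF \<gamma>(1) schwartz_integrable[OF \<phi>]])
    then have [measurable]: "?W \<in> borel_measurable borel" by (rule borel_measurable_continuous_onI)
    have [measurable]: "(\<lambda>t. tf_shift \<gamma> t y) \<in> borel_measurable borel"
      by (rule borel_measurable_continuous_onI[OF continuous_tf_shift(1)[OF \<gamma>(1)]])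
    have cnjm: "(\<lambda>t. cnj (tf_shift \<gamma> t y)) \<in> borel_measurable borel"
      by (intro borel_measurable_continuous_onI continuous_intros continuous_tf_shift(1)[OF \<gamma>(1)])
    have hi: "integrable lborel (\<lambda>t::'a \<times> 'a. 1 / (jb (fst t) ^ n0 * jb (snd t) ^ n0))"
      using integrable_lborel_prod_mult[OF wi wi] by simp
    have int: "integrable (lborel \<Otimes>\<^sub>M lborel) (\<lambda>(z, \<eta>). ?W (z, \<eta>) * cnj (tf_shift \<gamma> (z, \<eta>) y))"
      unfolding lborel_prod
    proof (rule integrable_bound_measurable)
      show "integrable lborel (\<lambda>t::'a \<times> 'a. C * C\<gamma> * (1 / (jb (fst t) ^ n0 * jb (snd t) ^ n0)))"
        by (intro integrable_mult_right hi)
      show "(\<lambda>(z, \<eta>). ?W (z, \<eta>) * cnj (tf_shift \<gamma> (z, \<eta>) y)) \<in> borel_measurable lborel"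
        using cnjm by (simp add: split_beta')
      show "norm (case t of (z, \<eta>) \<Rightarrow> ?W (z, \<eta>) * cnj (tf_shift \<gamma> (z, \<eta>) y)) \<le> C * C\<gamma> * (1 / (jb (fst t) ^ n0 * jb (snd t) ^ n0))" for t
      proof -
        have "norm (?W t) * norm (\<gamma> (y - fst t)) \<le> (C * (1 / (jb (fst t) ^ n0 * jb (snd t) ^ n0))) * (C\<gamma> * (1 / jb (y - fst t) ^ 0))"
          by (intro mult_mono C C\<gamma>) (auto intro!: mult_nonneg_nonneg divide_nonneg_nonneg C)
        then show ?thesis by (simp add: split_beta' norm_mult tf_shift_apply mult_ac)
      qed
    qed
    have "(\<integral>t. ?W t * cnj (tf_shift \<gamma> t y) \<partial>lborel) = (\<integral>z. (\<integral>\<eta>. ?W (z, \<eta>) * cnj (tf_shift \<gamma> (z, \<eta>) y) \<partial>lborel) \<partial>lborel)"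
      unfolding lborel_prod[symmetric] by (rule lborel_pair.integral_fst'[symmetric]) (use int in \<open>simp add: split_beta'\<close>)
    also have "\<dots> = (\<integral>z. cnj (\<gamma> (y - z)) * (\<integral>\<eta>. exp (- \<i> * complex_of_real (\<eta> \<bullet> y)) * fourier (\<lambda>y. \<gamma> (y - z) * \<phi> y) \<eta> \<partial>lborel) \<partial>lborel)"
      by (simp add: window_coeff_fourier cnj_tf_shift mult_ac flip: integral_mult_right_zero)
    also have "\<dots> = (\<integral>z. cnj (\<gamma> (y - z)) * (c0 * (\<gamma> (y - z) * \<phi> y)) \<partial>lborel)"
    proof (intro Bochner_Integration.integral_cong refl arg_cong2[where f="(*)"] inv)
      fix z
      let ?f = "\<lambda>y. \<gamma> (y - z) * \<phi> y"
      have F: "fam0 (\<lambda>z y. (1 / jb z ^ 0) * (1 / jb y ^ Suc DIM('a))) (\<lambda>z y. \<gamma> (y - z) * \<phi> y)"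
        by (rule fam_fam0[OF window_coeff_family[OF \<gamma>(1) \<phi>]])
      show "continuous_on UNIV ?f" by (rule fam0_continuous_snd[OF F])
      show "integrable lborel ?f" by (rule fam0_integrable[OF F]) (use wi in \<open>simp add: n0_def\<close>)
      then have "continuous_on UNIV (fourier ?f)" by (rule continuous_on_fourier)
      obtain C\<phi> where C\<phi>: "0 \<le> C\<phi>" "\<And>y. norm (\<phi> y) \<le> C\<phi> * (1 / jb y ^ 0)" by (rule schwartz_bound[OF \<phi>, where N=0]) blast
      have "norm (?f y) \<le> C\<gamma> * C\<phi>" for y
        using mult_mono[OF C\<gamma>(2)[of "y - z"] C\<phi>(2)[of y]] C\<gamma>(1) by (simp add: norm_mult)
      then show "bounded (range ?f)" by (auto simp: bounded_iff)
      show "integrable lborel (fourier ?f)"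
      proof (rule integrable_bound_measurable)
        show "integrable lborel (\<lambda>\<eta>::'a. (C * (1 / jb z ^ n0)) * (1 / jb \<eta> ^ n0))" by (intro integrable_mult_right wi)
        show "fourier ?f \<in> borel_measurable lborel" 
          using borel_measurable_continuous_onI[OF \<open>continuous_on UNIV (fourier ?f)\<close>] by simp
        show "norm (fourier ?f \<eta>) \<le> (C * (1 / jb z ^ n0)) * (1 / jb \<eta> ^ n0)" for \<eta>
          using C(2)[of "(z, \<eta>)"] by (simp add: window_coeff_fourier)
      qed
    qed
    also have "\<dots> = (\<integral>z. c0 * \<phi> y * (\<gamma> (y - z) * cnj (\<gamma> (y - z))) \<partial>lborel)"
      by (intro Bochner_Integration.integral_cong refl) (simp only: mult_ac)
    also have "\<dots> = c0 * \<phi> y * (\<integral>z. \<gamma> (y - z) * cnj (\<gamma> (y - z)) \<partial>lborel)"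
      by (rule integral_mult_right_zero)
    also have "(\<integral>z. \<gamma> (y - z) * cnj (\<gamma> (y - z)) \<partial>lborel) = (\<integral>z. \<gamma> z * cnj (\<gamma> z) \<partial>lborel)"
      using \<gamma>2 by (intro integral_lborel_reflect[of "\<lambda>y. \<gamma> y * cnj (\<gamma> y)"]) auto
    finally show "(\<integral>t. ?W t * cnj (tf_shift \<gamma> t y) \<partial>lborel) = c0 * (\<integral>y. \<gamma> y * cnj (\<gamma> y) \<partial>lborel) * \<phi> y"
      by (simp add: mult_ac)
  next
    fix H :: "'a \<Rightarrow> complex"
    assume H: "continuous_on UNIV H" "bounded (range H)" "\<And>\<phi>. \<phi> \<in> schwartz \<Longrightarrow> (\<integral>y. H y * \<phi> y \<partial>lborel) = 0"
    obtain B where B: "\<And>y. norm (H y) \<le> B" using H(2) by (auto simp: bounded_iff)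
    have Hm[measurable]: "H \<in> borel_measurable borel" by (rule borel_measurable_continuous_onI[OF H(1)])
    have *: "H y * cnj (\<gamma> (y - z)) = 0" for y z
    proof -
      let ?f = "\<lambda>y. H y * cnj (\<gamma> (y - z))"
      have f0: "fourier ?f = (\<lambda>_. 0)"
      proof
        fix \<eta>
        have "fourier ?f \<eta> = (\<integral>y. H y * cnj (tf_shift \<gamma> (z, - \<eta>) y) \<partial>lborel)"
          by (simp add: fourier_def cnj_tf_shift mult_ac)
        also have "\<dots> = 0" by (rule H(3)[OF cnj_tf_shift_schwartz[OF \<gamma>(1)]])
        finally show "fourier ?f \<eta> = 0" .
      qed
      have "(\<integral>\<eta>. exp (- \<i> * complex_of_real (\<eta> \<bullet> y)) * fourier ?f \<eta> \<partial>lborel) = c0 * ?f y"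
      proof (rule inv)
        show c: "continuous_on UNIV ?f"
          by (intro continuous_intros H continuous_on_compose2[OF schwartz_continuous[OF \<gamma>(1), of UNIV]]) auto
        have "norm (?f y) \<le> B * C\<gamma>" for y
          using mult_mono[OF B[of y] C\<gamma>(2)[of "y - z"]] order_trans[OF _ B[of y]] by (simp add: norm_mult)
        then show "bounded (range ?f)" by (auto simp: bounded_iff)
        have "integrable lborel (\<lambda>y. B * norm (\<gamma> (- z + y)))"
          by (intro integrable_mult_right integrable_norm integrable_lborel_translate schwartz_integrable \<gamma>)
        then show "integrable lborel ?f"
        proof (rule integrable_bound_measurable)
          show "?f \<in> borel_measurable lborel" using borel_measurable_continuous_onI[OF c] by simp
          show "norm (?f y) \<le> B * norm (\<gamma> (- z + y))" for y
            using B[of y] by (simp add: norm_mult mult_right_mono)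
        qed
      qed (simp add: f0)
      then show ?thesis using c0 by (simp add: f0)
    qed
    show "H = (\<lambda>_. 0)"
    proof
      fix y show "H y = 0" using *[of y "y - y0"] y0 by simp
    qed
  qed (use c0 N2 in simp)
qed


section \<open>Synthesis of bounded continuous functions from phase-space data\<close>

definition synthesis :: "('a::euclidean_space \<Rightarrow> complex) \<Rightarrow> ('a \<times> 'a \<Rightarrow> complex) \<Rightarrow> 'a \<Rightarrow> complex" where
  "synthesis \<gamma> V y = (\<integral>t. V t * tf_shift \<gamma> t y \<partial>lborel)"

text \<open>This is the only consequence of membership in a modulation space that the reconstruction needs;
  it avoids changing windows and the embedding into bounded continuous functions.\<close>

definition locally_bounded_stft :: "('a::euclidean_space \<times> 'a \<Rightarrow> complex) \<Rightarrow> real \<Rightarrow> bool" where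
  "locally_bounded_stft V B \<longleftrightarrow> V \<in> borel_measurable borel \<and> 0 \<le> B \<and>
     (\<forall>y. (\<integral>\<^sup>+t. ennreal (norm (V t) * (1 / jb (y - fst t) ^ Suc DIM('a))) \<partial>lborel) \<le> ennreal B)"

lemma measurable_jb_fst [measurable]: "(\<lambda>t :: 'a::euclidean_space \<times> 'a. jb (y - fst t)) \<in> borel_measurable borel"
  by (intro borel_measurable_continuous_onI continuous_intros)

lemma locally_bounded_integrable:
  fixes V :: "'a::euclidean_space \<times> 'a \<Rightarrow> complex"
  assumes V: "locally_bounded_stft V B"
  shows "integrable lborel (\<lambda>t. norm (V t) * (1 / jb (y - fst t) ^ Suc DIM('a)))"
    "(\<integral>t. norm (V t) * (1 / jb (y - fst t) ^ Suc DIM('a)) \<partial>lborel) \<le> B"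
proof -
  have [measurable]: "V \<in> borel_measurable borel" using V by (simp add: locally_bounded_stft_def)
  have le: "(\<integral>\<^sup>+t. ennreal (norm (V t) * (1 / jb (y - fst t) ^ Suc DIM('a))) \<partial>lborel) \<le> ennreal B" and B: "0 \<le> B"
    using V unfolding locally_bounded_stft_def by auto
  show i: "integrable lborel (\<lambda>t. norm (V t) * (1 / jb (y - fst t) ^ Suc DIM('a)))"
    using le by (intro integrableI_nonneg) (auto simp: less_top[symmetric] top_unique)
  have "ennreal (\<integral>t. norm (V t) * (1 / jb (y - fst t) ^ Suc DIM('a)) \<partial>lborel) \<le> ennreal B"
    using le by (subst nn_integral_eq_integral[OF i, symmetric]) auto
  then show "(\<integral>t. norm (V t) * (1 / jb (y - fst t) ^ Suc DIM('a)) \<partial>lborel) \<le> B"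
    using B by simp
qed

lemma norm_tf_shift_le:
  assumes "\<gamma> \<in> schwartz"
  obtains C where "0 \<le> C" "\<And>t y. norm (tf_shift \<gamma> t y) \<le> C * (1 / jb (y - fst t) ^ N)"
proof -
  obtain C where C: "0 \<le> C" "\<And>y. norm (\<gamma> y) \<le> C * (1 / jb y ^ N)" by (rule schwartz_bound[OF assms, where N=N]) blast
  show thesis by (rule that[OF C(1)]) (use C(2) in \<open>simp add: tf_shift_apply norm_mult\<close>)
qed

lemma measurable_tf_shift:
  fixes \<gamma> :: "'a::euclidean_space \<Rightarrow> complex"
  assumes "\<gamma> \<in> schwartz"
  shows "(\<lambda>t. tf_shift \<gamma> t y) \<in> borel_measurable borel" "tf_shift \<gamma> t \<in> borel_measurable borel"
    "(\<lambda>z. tf_shift \<gamma> (fst z) (snd z)) \<in> borel_measurable borel"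
  by (rule borel_measurable_continuous_onI[OF continuous_tf_shift(1)[OF assms]]
      borel_measurable_continuous_onI[OF continuous_tf_shift(2)[OF assms]]
      borel_measurable_continuous_onI[OF continuous_tf_shift(3)[OF assms]])+

lemma synthesis_integrand:
  fixes \<gamma> :: "'a::euclidean_space \<Rightarrow> complex"
  assumes \<gamma>: "\<gamma> \<in> schwartz" and V: "locally_bounded_stft V B"
  obtains C where "0 \<le> C" 
    "\<And>t y. norm (V t * tf_shift \<gamma> t y) \<le> C * (norm (V t) * (1 / jb (y - fst t) ^ Suc DIM('a)))"
    "\<And>y. integrable lborel (\<lambda>t. V t * tf_shift \<gamma> t y)"
    "\<And>y. (\<integral>t. norm (V t * tf_shift \<gamma> t y) \<partial>lborel) \<le> C * B"
proof -
  let ?n = "Suc DIM('a)"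
  have [measurable]: "V \<in> borel_measurable borel" using V by (simp add: locally_bounded_stft_def)
  note [measurable] = measurable_tf_shift[OF \<gamma>]
  obtain C where C: "0 \<le> C" "\<And>t y. norm (tf_shift \<gamma> t y) \<le> C * (1 / jb (y - fst t) ^ ?n)"
    by (rule norm_tf_shift_le[OF \<gamma>, where N="?n"]) blast
  have le: "norm (V t * tf_shift \<gamma> t y) \<le> C * (norm (V t) * (1 / jb (y - fst t) ^ ?n))" for t y
    using mult_left_mono[OF C(2)[of t y] norm_ge_zero[of "V t"]] by (simp add: norm_mult mult_ac)
  have i: "integrable lborel (\<lambda>t. C * (norm (V t) * (1 / jb (y - fst t) ^ ?n)))" for y
    by (rule integrable_mult_right) (rule locally_bounded_integrable[OF V])
  have j: "integrable lborel (\<lambda>t. V t * tf_shift \<gamma> t y)" for y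
    by (rule integrable_bound_measurable[OF i _ le]) measurable
  have "(\<integral>t. norm (V t * tf_shift \<gamma> t y) \<partial>lborel) \<le> C * B" for y
  proof -
    have "(\<integral>t. norm (V t * tf_shift \<gamma> t y) \<partial>lborel) \<le> (\<integral>t. C * (norm (V t) * (1 / jb (y - fst t) ^ ?n)) \<partial>lborel)"
      by (rule integral_mono[OF integrable_norm[OF j] i le])
    also have "\<dots> \<le> C * B"
      using locally_bounded_integrable(2)[OF V, of y] C by (subst integral_mult_right_zero) (rule mult_left_mono)
    finally show ?thesis .
  qed
  with C(1) le j show thesis by (rule that)
qed

text \<open>Boundedness is immediate from the uniform bound on the absolute integrals. For
  continuity a majorant independent of \<open>y\<close> is needed, and Peetre's inequality provides
  one near each \<open>y0\<close>.\<close>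

lemma synthesis_bcontfun:
  fixes \<gamma> :: "'a::euclidean_space \<Rightarrow> complex"
  assumes \<gamma>: "\<gamma> \<in> schwartz" and V: "locally_bounded_stft V B"
  shows "synthesis \<gamma> V \<in> bcontfun"
proof -
  let ?n = "Suc DIM('a)"
  have [measurable]: "V \<in> borel_measurable borel" using V by (simp add: locally_bounded_stft_def)
  note [measurable] = measurable_tf_shift[OF \<gamma>]
  obtain C where C: "0 \<le> C" 
    "\<And>t y. norm (V t * tf_shift \<gamma> t y) \<le> C * (norm (V t) * (1 / jb (y - fst t) ^ ?n))"
    "\<And>y. (\<integral>t. norm (V t * tf_shift \<gamma> t y) \<partial>lborel) \<le> C * B"
    by (rule synthesis_integrand[OF \<gamma> V]) blast
  have "norm (synthesis \<gamma> V y) \<le> C * B" for y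
    unfolding synthesis_def by (rule order_trans[OF integral_norm_bound C(3)])
  then have "bounded (range (synthesis \<gamma> V))" by (auto simp: bounded_iff)
  moreover have "continuous_on UNIV (synthesis \<gamma> V)"
  proof -
    have "continuous_on (ball y0 1) (synthesis \<gamma> V)" for y0
      unfolding synthesis_def
    proof (rule continuous_on_integral_dominated)
      show "integrable lborel (\<lambda>t. C * 4 ^ ?n * (norm (V t) * (1 / jb (y0 - fst t) ^ ?n)))"
        by (rule integrable_mult_right) (rule locally_bounded_integrable[OF V])
      show "norm (V t * tf_shift \<gamma> t y) \<le> C * 4 ^ ?n * (norm (V t) * (1 / jb (y0 - fst t) ^ ?n))" 
        if "y \<in> ball y0 1" for t y
      proof -
        \<comment> \<open>On the unit ball this factor 2 and the 2 of Peetre's inequality combine to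
          the constant \<open>4 ^ ?n\<close>.\<close>
        have "jb (y - y0) \<le> 2" using jb_le[of "y - y0"] that by (simp add: dist_norm norm_minus_commute)
        then have "jb (y - y0) ^ ?n \<le> 2 ^ ?n" by (rule power_mono) simp
        then have l1: "2 ^ ?n * jb (y - y0) ^ ?n / jb (y0 - fst t) ^ ?n \<le> 2 ^ ?n * 2 ^ ?n / jb (y0 - fst t) ^ ?n"
          by (intro divide_right_mono mult_left_mono) auto
        have l2: "(2::real) ^ ?n * 2 ^ ?n = 4 ^ ?n" unfolding power_mult_distrib[symmetric] by simp
        have l3: "y0 - fst t + (y - y0) = y - fst t" by simp
        have "1 / jb (y - fst t) ^ ?n \<le> 4 ^ ?n * (1 / jb (y0 - fst t) ^ ?n)"
          using order_trans[OF inverse_jb_Peetre[of "y0 - fst t" "y - y0" ?n] l1] unfolding l2 l3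
          by (simp only: times_divide_eq_right mult_1_right)
        then have "C * (norm (V t) * (1 / jb (y - fst t) ^ ?n)) \<le> C * (norm (V t) * (4 ^ ?n * (1 / jb (y0 - fst t) ^ ?n)))"
          using C by (intro mult_left_mono) auto
        then show ?thesis using C(2)[of t y] by (simp add: mult_ac)
      qed
    qed (measurable, intro continuous_intros, 
         auto intro!: continuous_on_subset[OF continuous_tf_shift(2)[OF \<gamma>]])
    then have "isCont (synthesis \<gamma> V) y0" for y0
      using continuous_on_eq_continuous_at[of "ball y0 1" "synthesis \<gamma> V"] by (metis centre_in_ball open_ball zero_less_one)
    then show ?thesis by (intro continuous_at_imp_continuous_on) auto
  qed
  ultimately show ?thesis by (simp add: bcontfun_def)
qed

text \<open>Synthesis is the transpose of \<open>window_coeff\<close>. The bound on the inner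
  absolute integral is uniform in \<open>y\<close>, so Fubini applies to every integrable
  \<open>Q\<close>; the product estimate uses it for a \<open>Q\<close> that contains another
  synthesised function.\<close>

lemma synthesis_pairing:
  fixes \<gamma> :: "'a::euclidean_space \<Rightarrow> complex"
  assumes \<gamma>: "\<gamma> \<in> schwartz" and V: "locally_bounded_stft V B" and Q: "integrable lborel Q"
  shows "(\<integral>y. synthesis \<gamma> V y * Q y \<partial>lborel) = (\<integral>t. V t * window_coeff \<gamma> Q t \<partial>lborel)"
proof -
  let ?n = "Suc DIM('a)"
  have [measurable]: "V \<in> borel_measurable borel" "Q \<in> borel_measurable borel" 
    using V Q by (auto simp: locally_bounded_stft_def)
  have m3[measurable]: "(\<lambda>z. tf_shift \<gamma> (snd z) (fst z)) \<in> borel_measurable (lborel \<Otimes>\<^sub>M lborel)"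
  proof -
    have "continuous_on UNIV (\<lambda>z. tf_shift \<gamma> (fst (snd z, fst z)) (snd (snd z, fst z)))"
      by (rule continuous_on_compose2[OF continuous_tf_shift(3)[OF \<gamma>]]) (auto intro!: continuous_intros)
    then show ?thesis unfolding lborel_prod by (auto intro: borel_measurable_continuous_onI)
  qed
  obtain C where int1: "\<And>y. integrable lborel (\<lambda>t. V t * tf_shift \<gamma> t y)" and
    bd1: "\<And>y. (\<integral>t. norm (V t * tf_shift \<gamma> t y) \<partial>lborel) \<le> C * B"
    by (rule synthesis_integrand[OF \<gamma> V]) blast
  have int: "integrable (lborel \<Otimes>\<^sub>M lborel) (\<lambda>(y, t). V t * tf_shift \<gamma> t y * Q y)"
  proof (rule lborel_pair.Fubini_integrable)
    show m: "(\<lambda>(y, t). V t * tf_shift \<gamma> t y * Q y) \<in> borel_measurable (lborel \<Otimes>\<^sub>M lborel)"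
      using m3 by (simp add: split_beta')
    have m': "(\<lambda>(y, t). norm (V t * tf_shift \<gamma> t y * Q y)) \<in> borel_measurable (lborel \<Otimes>\<^sub>M lborel)"
      using m by (simp add: split_beta')
    show "integrable lborel (\<lambda>y. \<integral>t. norm (case (y, t) of (y, t) \<Rightarrow> V t * tf_shift \<gamma> t y * Q y) \<partial>lborel)"
    proof (rule integrable_bound_measurable)
      show "integrable lborel (\<lambda>y. C * B * norm (Q y))" using Q by simp
      show "(\<lambda>y. \<integral>t. norm (case (y, t) of (y, t) \<Rightarrow> V t * tf_shift \<gamma> t y * Q y) \<partial>lborel) \<in> borel_measurable lborel"
        using lborel.borel_measurable_lebesgue_integral[OF m'] by simp
      show "norm (\<integral>t. norm (case (y, t) of (y, t) \<Rightarrow> V t * tf_shift \<gamma> t y * Q y) \<partial>lborel) \<le> C * B * norm (Q y)" for y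
        using mult_right_mono[OF bd1[of y] norm_ge_zero[of "Q y"]] 
        by (simp add: norm_mult mult.assoc flip: integral_mult_left_zero)
    qed
    show "AE y in lborel. integrable lborel (\<lambda>t. case (y, t) of (y, t) \<Rightarrow> V t * tf_shift \<gamma> t y * Q y)"
      using int1 by (intro AE_I2) simp
  qed
  have "(\<integral>y. synthesis \<gamma> V y * Q y \<partial>lborel) = (\<integral>y. (\<integral>t. V t * tf_shift \<gamma> t y * Q y \<partial>lborel) \<partial>lborel)"
    by (simp add: synthesis_def)
  also have "\<dots> = (\<integral>t. (\<integral>y. V t * tf_shift \<gamma> t y * Q y \<partial>lborel) \<partial>lborel)"
    by (rule lborel_pair.Fubini_integral[OF int, symmetric])
  also have "\<dots> = (\<integral>t. V t * window_coeff \<gamma> Q t \<partial>lborel)"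
    by (simp add: window_coeff_def mult.assoc)
  finally show ?thesis .
qed

text \<open>The window supplies the nonzero Schwartz function on which inversion rests; apart from
  that the conclusion does not involve it.\<close>

lemma regular_distribution_inject:
  fixes \<gamma> :: "'a::euclidean_space \<Rightarrow> complex"
  assumes \<gamma>: "\<gamma> \<in> schwartz" "\<gamma> \<noteq> (\<lambda>_. 0)" and F: "F \<in> bcontfun" and G: "G \<in> bcontfun"
    and eq: "regular_distribution F = regular_distribution G"
  shows "(F :: 'a \<Rightarrow> complex) = G"
proof -
  have int: "integrable lborel (\<lambda>y. F y * \<phi> y)" if F: "F \<in> bcontfun" and \<phi>: "\<phi> \<in> schwartz" for F \<phi> :: "'a \<Rightarrow> complex"
  proof -
    obtain B where B: "\<And>y. norm (F y) \<le> B" using F by (auto simp: bcontfun_def bounded_iff)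
    have [measurable]: "F \<in> borel_measurable borel"
      using F by (auto simp: bcontfun_def intro!: borel_measurable_continuous_onI)
    have [measurable]: "\<phi> \<in> borel_measurable borel" 
      by (intro borel_measurable_continuous_onI schwartz_continuous \<phi>)
    show ?thesis
    proof (rule integrable_bound_measurable)
      show "integrable lborel (\<lambda>y. B * norm (\<phi> y))" using schwartz_integrable[OF \<phi>] by simp
    qed (use B in \<open>auto simp: norm_mult mult_right_mono\<close>)
  qed
  have "(\<lambda>y. F y - G y) = (\<lambda>_. 0)"
  proof (rule window_expansion[OF \<gamma>])
    assume *: "\<And>H :: 'a \<Rightarrow> complex. continuous_on UNIV H \<Longrightarrow> bounded (range H) \<Longrightarrow> (\<And>\<phi>. \<phi> \<in> schwartz \<Longrightarrow> (\<integral>y. H y * \<phi> y \<partial>lborel) = 0) \<Longrightarrow> H = (\<lambda>_. 0)"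
    show ?thesis
    proof (rule *)
      show "continuous_on UNIV (\<lambda>y. F y - G y)" "bounded (range (\<lambda>y. F y - G y))"
        using F G by (auto simp: bcontfun_def intro!: continuous_intros bounded_minus_comp)
      fix \<phi> :: "'a \<Rightarrow> complex" assume \<phi>: "\<phi> \<in> schwartz"
      have "(\<integral>y. F y * \<phi> y \<partial>lborel) = (\<integral>y. G y * \<phi> y \<partial>lborel)"
        using fun_cong[OF eq, of \<phi>] \<phi> by (simp add: regular_distribution_def)
      then show "(\<integral>y. (F y - G y) * \<phi> y \<partial>lborel) = 0"
        using int[OF F \<phi>] int[OF G \<phi>] by (simp add: left_diff_distrib)
    qed
  qed
  then show ?thesis by (auto simp: fun_eq_iff)
qed

lemma cb_function_regular_distribution:
  fixes \<gamma> :: "'a::euclidean_space \<Rightarrow> complex"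
  assumes \<gamma>: "\<gamma> \<in> schwartz" "\<gamma> \<noteq> (\<lambda>_. 0)" and F: "(F :: 'a \<Rightarrow> complex) \<in> bcontfun"
  shows "cb_function (regular_distribution F) = F"
  unfolding cb_function_def
proof (rule the_equality)
  show "G = F" if "G \<in> bcontfun \<and> regular_distribution F = regular_distribution G" for G
    using regular_distribution_inject[OF \<gamma> F, of G] that by auto
qed (use F in simp)

text \<open>A test function is expanded in conjugated time-frequency shifts, \<open>u\<close> is
  moved under the integral, and its values on these shifts are the short-time Fourier transform up
  to \<open>c0\<close>. Transposing with \<open>synthesis_pairing\<close> gives the representing
  function, and \<open>K\<close> depends on \<gamma> alone.\<close>

lemma stft_reconstruction:
  fixes \<gamma> :: "'a::euclidean_space \<Rightarrow> complex"
  assumes \<gamma>: "\<gamma> \<in> schwartz" "\<gamma> \<noteq> (\<lambda>_. 0)"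
  obtains K :: complex where
    "\<And>u B. u \<in> tempered_distributions \<Longrightarrow> locally_bounded_stft (\<lambda>t. stft \<gamma> u (fst t) (snd t)) B \<Longrightarrow>
       u = regular_distribution (\<lambda>y. K * synthesis \<gamma> (\<lambda>t. stft \<gamma> u (fst t) (snd t)) y)"
proof -
  define c0 where "c0 = complex_of_real ((2 * pi) powr (- real DIM('a) / 2))"
  have c0: "c0 \<noteq> 0" by (simp add: c0_def)
  obtain c :: complex where c: "c \<noteq> 0" and 
    exp: "\<And>\<phi> y. \<phi> \<in> schwartz \<Longrightarrow> (\<integral>t. window_coeff \<gamma> \<phi> t * cnj (tf_shift \<gamma> t y) \<partial>lborel) = c * \<phi> y"
    by (rule window_expansion[OF \<gamma>]) blast
  define n0 where "n0 = Suc DIM('a)"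
  have wi: "integrable lborel (\<lambda>y :: 'a. 1 / jb y ^ n0)" by (rule integrable_jb_power) (simp add: n0_def)
  define h where "h t = 1 / (jb (fst t) ^ n0 * jb (snd t) ^ n0)" for t :: "'a \<times> 'a"
  have hi: "integrable lborel h" unfolding h_def
    using integrable_lborel_prod_mult[OF wi wi] by simp
  have hc: "continuous_on UNIV h" unfolding h_def by (intro continuous_intros) auto
  show thesis
  proof (rule that[of "1 / (c0 * c)"])
    fix u :: "('a \<Rightarrow> complex) \<Rightarrow> complex" and B
    assume u: "u \<in> tempered_distributions" and V: "locally_bounded_stft (\<lambda>t. stft \<gamma> u (fst t) (snd t)) B"
    let ?V = "\<lambda>t. stft \<gamma> u (fst t) (snd t)"
    have rec: "u \<phi> = 1 / (c0 * c) * (\<integral>y. synthesis \<gamma> ?V y * \<phi> y \<partial>lborel)" if \<phi>: "\<phi> \<in> schwartz" for \<phi>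
    proof -
      have "u (\<lambda>y. c * \<phi> y) = (\<integral>t. u (\<lambda>y. window_coeff \<gamma> \<phi> t * cnj (tf_shift \<gamma> t y)) \<partial>lborel)"
      proof (rule tempered_integral[OF u _ hi hc])
        show "c * \<phi> y = (\<integral>t. window_coeff \<gamma> \<phi> t * cnj (tf_shift \<gamma> t y) \<partial>lborel)" for y
          using exp[OF \<phi>, of y] by simp
        show "fam n (\<lambda>t y. h t / jb y ^ N) (\<lambda>t y. window_coeff \<gamma> \<phi> t * cnj (tf_shift \<gamma> t y))" for n N
        proof -
          \<comment> \<open>The orders \<open>N\<close> and \<open>n\<close> absorb the growth of
            the shifts in position and frequency; the surplus \<open>n0 = d + 1\<close> in each
            variable is the integrable majorant \<open>h\<close>.\<close>
          obtain C where C: "0 \<le> C" "\<And>t. norm (window_coeff \<gamma> \<phi> t) \<le> C * (1 / (jb (fst t) ^ (N + n0) * jb (snd t) ^ (n + n0)))"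
            by (rule window_coeff_decay[OF \<gamma>(1) \<phi>, where L="N + n0" and M="n + n0"]) blast
          have "fam n (\<lambda>t y. 1 / (jb (fst t) ^ (N + n0) * jb (snd t) ^ (n + n0)) * ((jb (snd t) ^ n * jb (fst t) ^ N) / jb y ^ N))
              (\<lambda>t y. window_coeff \<gamma> \<phi> t * cnj (tf_shift \<gamma> t y))"
            by (rule fam_mult[OF fam_const[OF continuous_on_window_coeff[OF \<gamma>(1) schwartz_integrable[OF \<phi>]] C] fam_tf_shift'[OF \<gamma>(1)]]) simp
          moreover have "1 / (jb (fst t) ^ (N + n0) * jb (snd t) ^ (n + n0)) * ((jb (snd t) ^ n * jb (fst t) ^ N) / jb y ^ N) = h t / jb y ^ N" 
            for t :: "'a \<times> 'a" and y :: 'a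
            by (simp add: h_def power_add)
          ultimately show ?thesis by simp
        qed
      qed (auto simp: h_def schwartz_cmult \<phi>)
      also have "\<dots> = (\<integral>t. window_coeff \<gamma> \<phi> t * u (\<lambda>y. cnj (tf_shift \<gamma> t y)) \<partial>lborel)"
        by (simp add: tempered_cmult[OF u cnj_tf_shift_schwartz[OF \<gamma>(1)]])
      also have "\<dots> = (\<integral>t. (1 / c0) * (?V t * window_coeff \<gamma> \<phi> t) \<partial>lborel)"
      proof (rule Bochner_Integration.integral_cong[OF refl])
        fix t
        have Vc: "?V t = c0 * u (\<lambda>y. cnj (tf_shift \<gamma> t y))" by (simp only: stft_eq c0_def)
        show "window_coeff \<gamma> \<phi> t * u (\<lambda>y. cnj (tf_shift \<gamma> t y)) = (1 / c0) * (?V t * window_coeff \<gamma> \<phi> t)"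
          unfolding Vc using c0 by (simp add: mult_ac)
      qed
      also have "\<dots> = 1 / c0 * (\<integral>y. synthesis \<gamma> ?V y * \<phi> y \<partial>lborel)"
        unfolding synthesis_pairing[OF \<gamma>(1) V schwartz_integrable[OF \<phi>]] by (rule integral_mult_right_zero)
      finally have "c * u \<phi> = 1 / c0 * (\<integral>y. synthesis \<gamma> ?V y * \<phi> y \<partial>lborel)"
        by (simp add: tempered_cmult[OF u \<phi>])
      then show ?thesis using c c0 by (simp add: field_simps)
    qed
    show "u = regular_distribution (\<lambda>y. 1 / (c0 * c) * synthesis \<gamma> ?V y)"
    proof
      fix \<phi>
      show "u \<phi> = regular_distribution (\<lambda>y. 1 / (c0 * c) * synthesis \<gamma> ?V y) \<phi>"
      proof (cases "\<phi> \<in> schwartz")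
        case True
        then show ?thesis using rec[OF True] by (simp add: regular_distribution_def)
      next
        \<comment> \<open>Off the Schwartz class both sides are \<open>undefined\<close>, by
          extensionality.\<close>
        case False
        then show ?thesis using u by (simp add: regular_distribution_def tempered_distributions_def extensional_def)
      qed
    qed
  qed
qed

lemma norm_weighted_le_seminorm:
  assumes "\<phi> \<in> schwartz"
  shows "norm y ^ k * norm (\<phi> y) \<le> schwartz_seminorm k [] \<phi>"
  using norm_bounded[of "weighted_deriv k [] \<phi>" y] assms
  by (simp add: apply_weighted_deriv norm_weighted_deriv norm_power)

text \<open>Decay of order \<open>d + 1\<close> makes a test function integrable, so the
  derivative-free seminorms of orders 0 and \<open>d + 1\<close> control the integral; the other
  terms of the sum are nonnegative and only enlarge the bound.\<close>

lemma regular_distribution_tempered: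
  fixes F :: "'a::euclidean_space \<Rightarrow> complex"
  assumes F: "F \<in> bcontfun"
  shows "regular_distribution F \<in> tempered_distributions"
proof -
  obtain B where B: "\<And>y. norm (F y) \<le> B" using F by (auto simp: bcontfun_def bounded_iff)
  have B0: "0 \<le> B" using order_trans[OF norm_ge_zero B] .
  have [measurable]: "F \<in> borel_measurable borel" 
    using F by (auto simp: bcontfun_def intro!: borel_measurable_continuous_onI)
  have int: "integrable lborel (\<lambda>y. F y * \<phi> y)" if \<phi>: "\<phi> \<in> schwartz" for \<phi> :: "'a \<Rightarrow> complex"
  proof (rule integrable_bound_measurable)
    have [measurable]: "\<phi> \<in> borel_measurable borel" 
      using \<phi> by (auto intro!: borel_measurable_continuous_onI schwartz_continuous)
    show "integrable lborel (\<lambda>y. B * norm (\<phi> y))" using schwartz_integrable[OF \<phi>] by simp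
    show "(\<lambda>y. F y * \<phi> y) \<in> borel_measurable lborel" by measurable
  qed (use B in \<open>auto simp: norm_mult mult_right_mono\<close>)
  define N where "N = Suc DIM('a)"
  define I where "I = (\<integral>y. 1 / jb (y::'a) ^ N \<partial>lborel)"
  have wi: "integrable lborel (\<lambda>y :: 'a. 1 / jb y ^ N)" by (rule integrable_jb_power) (simp add: N_def)
  have bound: "norm (\<integral>y. F y * \<phi> y \<partial>lborel) \<le> (B * 2 ^ N * I) * (\<Sum>k\<le>N. \<Sum>bs\<in>{bs \<in> lists Basis. length bs \<le> N}. schwartz_seminorm k bs \<phi>)"
    if \<phi>: "\<phi> \<in> schwartz" for \<phi> :: "'a \<Rightarrow> complex"
  proof -
    let ?S = "\<Sum>k\<le>N. \<Sum>bs\<in>{bs \<in> lists Basis. length bs \<le> N}. schwartz_seminorm k bs \<phi>"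
    have fin: "finite {bs \<in> lists (Basis :: 'a set). length bs \<le> N}"
      using finite_lists_length_le[of "Basis :: 'a set" N] by (simp add: lists_eq_set)
    have nn: "0 \<le> schwartz_seminorm k bs \<phi>" if "bs \<in> lists Basis" for k bs
      using norm_weighted_deriv[OF \<phi> that, of k] by (metis norm_ge_zero)
    have inner: "schwartz_seminorm k [] \<phi> \<le> (\<Sum>bs\<in>{bs \<in> lists Basis. length bs \<le> N}. schwartz_seminorm k bs \<phi>)" for k
      using fin nn by (intro member_le_sum[of "[]"]) auto
    have "schwartz_seminorm 0 [] \<phi> + schwartz_seminorm N [] \<phi> = (\<Sum>k\<in>{0, N}. schwartz_seminorm k [] \<phi>)"
      by (simp add: N_def)
    also have "\<dots> \<le> (\<Sum>k\<le>N. schwartz_seminorm k [] \<phi>)"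
      using nn by (intro sum_mono2) auto
    also have "\<dots> \<le> ?S" by (intro sum_mono inner)
    finally have S: "schwartz_seminorm 0 [] \<phi> + schwartz_seminorm N [] \<phi> \<le> ?S" .
    have pw: "norm (F y * \<phi> y) \<le> B * 2 ^ N * ?S * (1 / jb y ^ N)" for y
    proof -
      have "jb y ^ N * norm (\<phi> y) \<le> 2 ^ N * (1 + norm y ^ N) * norm (\<phi> y)"
        by (rule mult_right_mono[OF jb_power_le]) simp
      also have "\<dots> = 2 ^ N * (norm y ^ 0 * norm (\<phi> y) + norm y ^ N * norm (\<phi> y))" by (simp add: algebra_simps)
      also have "\<dots> \<le> 2 ^ N * ?S"
        using norm_weighted_le_seminorm[OF \<phi>, of y 0] norm_weighted_le_seminorm[OF \<phi>, of y N] S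
        by (intro mult_left_mono) auto
      finally have "norm (\<phi> y) \<le> 2 ^ N * ?S * (1 / jb y ^ N)" by (simp add: field_simps)
      then have "norm (F y) * norm (\<phi> y) \<le> B * (2 ^ N * ?S * (1 / jb y ^ N))"
        using B B0 by (intro mult_mono) auto
      then show ?thesis by (simp add: norm_mult mult.assoc)
    qed
    have "norm (\<integral>y. F y * \<phi> y \<partial>lborel) \<le> (\<integral>y. B * 2 ^ N * ?S * (1 / jb (y::'a) ^ N) \<partial>lborel)"
      by (intro Bochner_Integration.integral_norm_bound_integral int \<phi> integrable_mult_right wi pw)
    also have "\<dots> = B * 2 ^ N * ?S * I" unfolding I_def by (rule integral_mult_right_zero)
    finally show ?thesis by (simp only: mult_ac)
  qed
  show ?thesis unfolding tempered_distributions_def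
  proof (intro CollectI conjI ballI allI)
    show "\<exists>C N. \<forall>\<phi>\<in>schwartz. norm (regular_distribution F \<phi>) \<le> 
        C * (\<Sum>k\<le>N. \<Sum>bs\<in>{bs \<in> lists Basis. length bs \<le> N}. schwartz_seminorm k bs \<phi>)"
      using bound by (intro exI[of _ "B * 2 ^ N * I"] exI[of _ N]) (simp add: regular_distribution_def)
  qed (auto simp: regular_distribution_def schwartz_add schwartz_cmult distrib_left int mult.left_commute[of _ "_ :: complex"])
qed

subsection \<open>Weighted convolution estimates\<close>

lemma Lp_norm_reflect_le:
  fixes F :: "'a::euclidean_space \<Rightarrow> ennreal"
  assumes p: "1 \<le> p" and [measurable]: "F \<in> borel_measurable borel"
  shows "Lp_norm p (\<lambda>x. F (w - x)) \<le> Lp_norm p F"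
  using p
proof (cases rule: ennreal_ge_1_cases)
  case top
  have "AE x in distr lborel borel (\<lambda>x. w - x). F x \<le> esssup lborel F"
    unfolding distr_lborel_reflect by (rule esssup_AE)
  then have "AE x in lborel. F (w - x) \<le> esssup lborel F"
    by (simp add: AE_distr_iff)
  then show ?thesis using top by (auto simp: Lp_norm_top intro!: esssup_I)
next
  case (real r)
  then show ?thesis 
    using nn_integral_lborel_reflect[of "\<lambda>x. ennreal_powr (F x) r" w]
    by (simp add: Lp_norm_ennreal)
qed

text \<open>A function with values at most 1 dominates its own powers of exponent at least
  1.\<close>

lemma Lp_norm_le_1_finite:
  assumes p: "1 \<le> p" and [measurable]: "F \<in> borel_measurable borel" 
    and le: "\<And>x. F x \<le> 1" and int: "(\<integral>\<^sup>+x. F x \<partial>lborel) < top"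
  shows "Lp_norm p F < top"
  using p
proof (cases rule: ennreal_ge_1_cases)
  case top
  have "esssup lborel F \<le> 1" using le by (intro esssup_I) auto
  then show ?thesis using top by (auto simp: Lp_norm_top intro: le_less_trans)
next
  case (real r)
  have "ennreal_powr (F x) r \<le> F x" for x
  proof (cases "F x")
    case (real c)
    then have "c \<le> 1" using le[of x] by (simp flip: ennreal_1)
    then have "c powr r \<le> c" using \<open>1 \<le> r\<close> real powr_mono'[of 1 r c] by simp
    then show ?thesis using real by (simp add: ennreal_leI)
  qed (use le[of x] in simp)
  then have "(\<integral>\<^sup>+x. ennreal_powr (F x) r \<partial>lborel) \<le> (\<integral>\<^sup>+x. F x \<partial>lborel)"
    by (intro nn_integral_mono)
  then have "(\<integral>\<^sup>+x. ennreal_powr (F x) r \<partial>lborel) < top" using int by (rule le_less_trans)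
  then show ?thesis using real by (simp add: Lp_norm_ennreal less_top[symmetric])
qed

text \<open>Minkowski's integral inequality in \<open>z\<close> together with translation invariance
  of the norm; this covers all exponents at once, \<open>top\<close> included.\<close>

lemma Young_convolution:
  fixes f k :: "'a::euclidean_space \<Rightarrow> ennreal"
  assumes p: "1 \<le> p" and [measurable]: "f \<in> borel_measurable borel" "k \<in> borel_measurable borel"
  shows "Lp_norm p (\<lambda>x. \<integral>\<^sup>+z. k z * f (x - z) \<partial>lborel) \<le> (\<integral>\<^sup>+z. k z \<partial>lborel) * Lp_norm p f"
proof -
  have "Lp_norm p (\<lambda>x. \<integral>\<^sup>+z. k z * f (x - z) \<partial>lborel) \<le> (\<integral>\<^sup>+z. Lp_norm p (\<lambda>x. k z * f (x - z)) \<partial>lborel)"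
    by (rule Minkowski_integral[OF p sigma_finite_lborel]) measurable
  also have "\<dots> \<le> (\<integral>\<^sup>+z. k z * Lp_norm p f \<partial>lborel)"
  proof (intro nn_integral_mono)
    fix z
    have "Lp_norm p (\<lambda>x. k z * f (x - z)) \<le> k z * Lp_norm p (\<lambda>x. f (- z + x))"
      using Lp_norm_cmult_le[OF p, of "\<lambda>x. f (- z + x)" "k z"] by simp
    also have "\<dots> \<le> k z * Lp_norm p f"
      by (intro mult_left_mono Lp_norm_translate_le p) auto
    finally show "Lp_norm p (\<lambda>x. k z * f (x - z)) \<le> k z * Lp_norm p f" .
  qed
  also have "\<dots> = (\<integral>\<^sup>+z. k z \<partial>lborel) * Lp_norm p f" by (rule nn_integral_multc) auto
  finally show ?thesis .
qed

lemma convolution_commute: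
  fixes f k :: "'a::euclidean_space \<Rightarrow> ennreal"
  assumes [measurable]: "f \<in> borel_measurable borel" "k \<in> borel_measurable borel"
  shows "(\<integral>\<^sup>+z. f z * k (x - z) \<partial>lborel) = (\<integral>\<^sup>+z. k z * f (x - z) \<partial>lborel)"
  using nn_integral_lborel_reflect[of "\<lambda>z. k z * f (x - z)" x] by (simp add: mult.commute)

lemma Young_convolution':
  fixes f k :: "'a::euclidean_space \<Rightarrow> ennreal"
  assumes p: "1 \<le> p" and m: "f \<in> borel_measurable borel" "k \<in> borel_measurable borel"
  shows "Lp_norm p (\<lambda>x. \<integral>\<^sup>+z. f z * k (x - z) \<partial>lborel) \<le> (\<integral>\<^sup>+z. k z \<partial>lborel) * Lp_norm p f"
  unfolding convolution_commute[OF m] by (rule Young_convolution[OF p m])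

text \<open>Written with \<open>1 / 1\<close> to match the exponent relation of
  \<open>Lp_norm_Holder\<close> at exponent 1. The further clauses express the dichotomy between
  finite and infinite \<open>q'\<close> in the terms of the hypotheses on \<open>s\<close>.\<close>

lemma conjugate_exponent:
  fixes q :: ennreal
  assumes "1 \<le> q"
  obtains q' where "1 \<le> q'" "1 / 1 = 1 / q' + 1 / q" "q = 1 \<Longrightarrow> q' = top" 
    "\<And>r'. 0 < r' \<Longrightarrow> q' = ennreal r' \<Longrightarrow> 1 / r' = 1 - enn2real (1 / q)" "q' = top \<Longrightarrow> q = 1"
  using assms
proof (cases rule: ennreal_ge_1_cases)
  case top
  show ?thesis using top by (intro that[of 1]) (auto simp flip: ennreal_1)
next
  case (real r)
  show ?thesis
  proof (cases "r = 1")
    case True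
    then show ?thesis using real by (intro that[of top]) auto
  next
    case False
    then have r: "1 < r" using real by simp
    have e: "1 - 1 / r = (r - 1) / r" using r by (simp add: field_simps)
    have "1 / ennreal (r / (r - 1)) + 1 / q = ennreal ((r - 1) / r) + ennreal (1 / r)"
      using r real by (simp add: ennreal_inverse_real)
    also have "\<dots> = ennreal ((r - 1) / r + 1 / r)" using r by (intro ennreal_plus[symmetric]) auto
    also have "(r - 1) / r + 1 / r = 1" using r by (simp add: field_simps)
    finally have *: "1 / 1 = 1 / ennreal (r / (r - 1)) + 1 / q" by simp
    show ?thesis
    proof (rule that[OF _ *])
      show "1 \<le> ennreal (r / (r - 1))" using r by (simp add: field_simps flip: ennreal_1)
      show "1 / r' = 1 - enn2real (1 / q)" if "0 < r'" "ennreal (r / (r - 1)) = ennreal r'" for r'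
      proof -
        have "r' = r / (r - 1)" using that r by simp
        then show ?thesis using r real e by (simp add: ennreal_inverse_real)
      qed
    qed (use r real in \<open>auto simp flip: ennreal_1\<close>)
  qed
qed

text \<open>The weight \<open>jb powr (- s)\<close> has to lie in \<open>L^q'\<close>. For finite
  \<open>q'\<close> this asks for \<open>s * q' > d\<close>, that is
  \<open>s > d * (1 - 1/q)\<close>; for infinite \<open>q'\<close>, where \<open>q = 1\<close>, it
  asks for boundedness, that is \<open>s \<ge> 0\<close>. The constant \<open>D\<close> is the
  \<open>L^q'\<close> norm of this weight.\<close>

lemma weighted_Lq_le_L1:
  assumes q: "1 \<le> q" and s: "q > 1 \<longrightarrow> s > real DIM('a) * (1 - enn2real (1 / q))" "q = 1 \<longrightarrow> s \<ge> 0"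
  obtains D :: ennreal where "D < top"
    "\<And>b :: 'a::euclidean_space \<Rightarrow> ennreal. b \<in> borel_measurable borel \<Longrightarrow> 
       (\<integral>\<^sup>+\<eta>. b \<eta> \<partial>lborel) \<le> D * Lp_norm q (\<lambda>\<eta>. ennreal (jb \<eta> powr s) * b \<eta>)"
proof -
  obtain q' where q': "1 \<le> q'" "1 / 1 = 1 / q' + 1 / q" "q = 1 \<Longrightarrow> q' = top" 
    "\<And>r'. 0 < r' \<Longrightarrow> q' = ennreal r' \<Longrightarrow> 1 / r' = 1 - enn2real (1 / q)" "q' = top \<Longrightarrow> q = 1"
    by (rule conjugate_exponent[OF q]) blast
  let ?w = "\<lambda>\<eta> :: 'a. ennreal (jb \<eta> powr (- s))"
  have "Lp_norm q' ?w < top"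
    using q'(1)
  proof (cases rule: ennreal_ge_1_cases)
    case top
    then have "0 \<le> s" using q' s by auto
    then have "?w \<eta> \<le> 1" for \<eta>
      using powr_mono[of "- s" 0 "jb \<eta>"] by (simp flip: ennreal_1)
    then have "esssup lborel ?w \<le> 1" by (intro esssup_I) auto
    then show ?thesis using top by (auto simp: Lp_norm_top intro: le_less_trans)
  next
    case (real r')
    then have "q \<noteq> 1" using q'(3) by auto
    then have "1 < q" using q by (simp add: less_le)
    then have "real DIM('a) * (1 / r') < s" using s q'(4)[of r'] real by simp
    then have "real DIM('a) < s * r'" using real by (simp add: field_simps)
    then have "(\<integral>\<^sup>+\<eta>. ennreal (jb (\<eta> :: 'a) powr (- (s * r'))) \<partial>lborel) < \<infinity>" by (rule nn_integral_jb_powr)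
    then show ?thesis using real by (simp add: Lp_norm_ennreal powr_powr less_top[symmetric])
  qed
  moreover have "(\<integral>\<^sup>+\<eta>. b \<eta> \<partial>lborel) \<le> Lp_norm q' ?w * Lp_norm q (\<lambda>\<eta>. ennreal (jb \<eta> powr s) * b \<eta>)"
    if [measurable]: "b \<in> borel_measurable borel" for b :: "'a \<Rightarrow> ennreal"
  proof -
    have "Lp_norm 1 (\<lambda>\<eta>. ?w \<eta> * (ennreal (jb \<eta> powr s) * b \<eta>)) \<le> Lp_norm q' ?w * Lp_norm q (\<lambda>\<eta>. ennreal (jb \<eta> powr s) * b \<eta>)"
      by (rule Lp_norm_Holder[OF _ q'(1) q q'(2)]) auto
    moreover have "?w \<eta> * (ennreal (jb \<eta> powr s) * b \<eta>) = b \<eta>" for \<eta>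
    proof -
      have "?w \<eta> * ennreal (jb \<eta> powr s) = ennreal (jb \<eta> powr (- s) * jb \<eta> powr s)" by (rule ennreal_mult[symmetric]) auto
      also have "jb \<eta> powr (- s) * jb \<eta> powr s = 1" by (simp flip: powr_add)
      finally show ?thesis by (simp flip: mult.assoc)
    qed
    ultimately show ?thesis by (simp add: Lp_norm_1)
  qed
  ultimately show thesis by (rule that)
qed

text \<open>The weight at \<xi> is distributed over \<eta>, \<zeta> and the kernel, whose exponent
  drops from \<open>M\<close> to \<open>M - s\<close>. In each of the two resulting terms one factor
  keeps the weight and is measured in \<open>L^q\<close>, while the other is measured in
  \<open>L^1\<close>, where \<open>D\<close> returns it to the weighted norm.\<close>

lemma weighted_convolution_bound:
  fixes a b :: "'a::euclidean_space \<Rightarrow> ennreal"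
  assumes q: "1 \<le> q" and s: "0 \<le> s" 
    and [measurable]: "a \<in> borel_measurable borel" "b \<in> borel_measurable borel"
    and D: "(\<integral>\<^sup>+\<eta>. a \<eta> \<partial>lborel) \<le> D * Lp_norm q (\<lambda>\<eta>. ennreal (jb \<eta> powr s) * a \<eta>)"
      "(\<integral>\<^sup>+\<eta>. b \<eta> \<partial>lborel) \<le> D * Lp_norm q (\<lambda>\<eta>. ennreal (jb \<eta> powr s) * b \<eta>)"
  shows "Lp_norm q (\<lambda>\<xi>. ennreal (jb \<xi> powr s) * (\<integral>\<^sup>+\<eta>. \<integral>\<^sup>+\<zeta>. ennreal (1 / jb (\<xi> - \<eta> - \<zeta>) ^ M) * (a \<eta> * b \<zeta>) \<partial>lborel \<partial>lborel))
    \<le> 2 * ennreal (4 powr s) * D * (\<integral>\<^sup>+\<theta>. ennreal (jb (\<theta>::'a) powr (s - real M)) \<partial>lborel) * 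
      (Lp_norm q (\<lambda>\<eta>. ennreal (jb \<eta> powr s) * a \<eta>) * Lp_norm q (\<lambda>\<eta>. ennreal (jb \<eta> powr s) * b \<eta>))"
proof -
  let ?w = "\<lambda>\<eta> :: 'a. ennreal (jb \<eta> powr s)"
  let ?k = "\<lambda>\<theta> :: 'a. ennreal (jb \<theta> powr (s - real M))"
  let ?A = "\<lambda>\<eta>. ?w \<eta> * a \<eta>" and ?B = "\<lambda>\<eta>. ?w \<eta> * b \<eta>"
  \<comment> \<open>The double convolution of \<open>f\<close>, \<open>g\<close> and the reduced
    kernel, nested so that two applications of Young's inequality leave \<open>f\<close> in
    \<open>L^q\<close> and \<open>g\<close> in \<open>L^1\<close>.\<close>
  define T where "T f g \<xi> = (\<integral>\<^sup>+\<zeta>. g \<zeta> * (\<integral>\<^sup>+\<eta>. f \<eta> * ?k (\<xi> - \<zeta> - \<eta>) \<partial>lborel) \<partial>lborel)" for f g :: "'a \<Rightarrow> ennreal" and \<xi>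
  have T: "Lp_norm q (T f g) \<le> (\<integral>\<^sup>+\<zeta>. g \<zeta> \<partial>lborel) * ((\<integral>\<^sup>+\<theta>. ?k \<theta> \<partial>lborel) * Lp_norm q f)"
    if [measurable]: "f \<in> borel_measurable borel" "g \<in> borel_measurable borel" for f g
  proof -
    have "Lp_norm q (T f g) \<le> (\<integral>\<^sup>+\<zeta>. g \<zeta> \<partial>lborel) * Lp_norm q (\<lambda>x. \<integral>\<^sup>+\<eta>. f \<eta> * ?k (x - \<eta>) \<partial>lborel)"
      unfolding T_def by (rule Young_convolution[OF q]) measurable
    also have "\<dots> \<le> (\<integral>\<^sup>+\<zeta>. g \<zeta> \<partial>lborel) * ((\<integral>\<^sup>+\<theta>. ?k \<theta> \<partial>lborel) * Lp_norm q f)"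
      by (intro mult_left_mono Young_convolution'[OF q]) auto
    finally show ?thesis .
  qed
  have Tm[measurable]: "T f g \<in> borel_measurable borel" if [measurable]: "f \<in> borel_measurable borel" "g \<in> borel_measurable borel" for f g
    unfolding T_def by measurable
  \<comment> \<open>One factor \<open>2 powr s\<close> is due to Peetre's inequality, the other to
    the triangle inequality in the form of twice the maximum.\<close>
  have w4: "?w \<xi> * ennreal (1 / jb (\<xi> - \<eta> - \<zeta>) ^ M) \<le> ennreal (4 powr s) * ?k (\<xi> - \<eta> - \<zeta>) * (?w \<eta> + ?w \<zeta>)" for \<xi> \<eta> \<zeta> :: 'a
  proof -
    let ?\<theta> = "\<xi> - \<eta> - \<zeta>"
    have "jb \<xi> \<le> 2 * jb ?\<theta> * jb (\<eta> + \<zeta>)" using jb_Peetre[of ?\<theta> "\<eta> + \<zeta>"] by simp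
    also have "\<dots> \<le> 2 * jb ?\<theta> * (2 * max (jb \<eta>) (jb \<zeta>))"
      using jb_triangle[of \<eta> \<zeta>] by (intro mult_left_mono) auto
    finally have "jb \<xi> powr s \<le> (4 * (jb ?\<theta> * max (jb \<eta>) (jb \<zeta>))) powr s"
      using s by (intro powr_mono2) (auto simp: mult_ac)
    also have "\<dots> = 4 powr s * (jb ?\<theta> powr s * max (jb \<eta>) (jb \<zeta>) powr s)"
      by (simp add: powr_mult max_def)
    also have "max (jb \<eta>) (jb \<zeta>) powr s \<le> jb \<eta> powr s + jb \<zeta> powr s" by (simp add: max_def)
    finally have "jb \<xi> powr s \<le> 4 powr s * (jb ?\<theta> powr s * (jb \<eta> powr s + jb \<zeta> powr s))"
      by (simp add: mult_left_mono)
    then have "jb \<xi> powr s * (1 / jb ?\<theta> ^ M) \<le> 4 powr s * (jb ?\<theta> powr s * (jb \<eta> powr s + jb \<zeta> powr s)) * (1 / jb ?\<theta> ^ M)"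
      by (rule mult_right_mono) simp
    also have "\<dots> = 4 powr s * jb ?\<theta> powr (s - real M) * (jb \<eta> powr s + jb \<zeta> powr s)"
      by (simp add: powr_diff powr_realpow)
    finally have "ennreal (jb \<xi> powr s * (1 / jb ?\<theta> ^ M)) \<le> ennreal \<dots>" by (rule ennreal_leI)
    moreover have "?w \<xi> * ennreal (1 / jb ?\<theta> ^ M) = ennreal (jb \<xi> powr s * (1 / jb ?\<theta> ^ M))"
      by (rule ennreal_mult[symmetric]) auto
    moreover have "ennreal (4 powr s) * ?k ?\<theta> * (?w \<eta> + ?w \<zeta>) = ennreal (4 powr s * jb ?\<theta> powr (s - real M) * (jb \<eta> powr s + jb \<zeta> powr s))"
      by (simp add: ennreal_mult ennreal_plus)
    ultimately show ?thesis by simp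
  qed
  have pw: "?w \<xi> * (\<integral>\<^sup>+\<eta>. \<integral>\<^sup>+\<zeta>. ennreal (1 / jb (\<xi> - \<eta> - \<zeta>) ^ M) * (a \<eta> * b \<zeta>) \<partial>lborel \<partial>lborel) \<le> 
      ennreal (4 powr s) * (T ?A b \<xi> + T ?B a \<xi>)" for \<xi>
  proof -
    have "?w \<xi> * (\<integral>\<^sup>+\<eta>. \<integral>\<^sup>+\<zeta>. ennreal (1 / jb (\<xi> - \<eta> - \<zeta>) ^ M) * (a \<eta> * b \<zeta>) \<partial>lborel \<partial>lborel) = 
      (\<integral>\<^sup>+\<eta>. \<integral>\<^sup>+\<zeta>. ?w \<xi> * ennreal (1 / jb (\<xi> - \<eta> - \<zeta>) ^ M) * (a \<eta> * b \<zeta>) \<partial>lborel \<partial>lborel)"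
      by (simp add: nn_integral_cmult mult.assoc)
    also have "\<dots> \<le> (\<integral>\<^sup>+\<eta>. \<integral>\<^sup>+\<zeta>. ennreal (4 powr s) * ?k (\<xi> - \<eta> - \<zeta>) * (?w \<eta> + ?w \<zeta>) * (a \<eta> * b \<zeta>) \<partial>lborel \<partial>lborel)"
      by (intro nn_integral_mono mult_right_mono w4) auto
    also have "\<dots> = (\<integral>\<^sup>+\<eta>. \<integral>\<^sup>+\<zeta>. ennreal (4 powr s) * (b \<zeta> * (?A \<eta> * ?k (\<xi> - \<zeta> - \<eta>))) + 
         ennreal (4 powr s) * (a \<eta> * (?B \<zeta> * ?k (\<xi> - \<eta> - \<zeta>))) \<partial>lborel \<partial>lborel)"
    proof (intro nn_integral_cong)
      fix \<eta> \<zeta>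
      have "\<xi> - \<eta> - \<zeta> = \<xi> - \<zeta> - \<eta>" by simp
      then show "ennreal (4 powr s) * ?k (\<xi> - \<eta> - \<zeta>) * (?w \<eta> + ?w \<zeta>) * (a \<eta> * b \<zeta>) = 
         ennreal (4 powr s) * (b \<zeta> * (?A \<eta> * ?k (\<xi> - \<zeta> - \<eta>))) + ennreal (4 powr s) * (a \<eta> * (?B \<zeta> * ?k (\<xi> - \<eta> - \<zeta>)))"
        by (simp only: distrib_left distrib_right mult_ac)
    qed
    also have "\<dots> = ennreal (4 powr s) * (\<integral>\<^sup>+\<eta>. \<integral>\<^sup>+\<zeta>. b \<zeta> * (?A \<eta> * ?k (\<xi> - \<zeta> - \<eta>)) \<partial>lborel \<partial>lborel) + 
        ennreal (4 powr s) * (\<integral>\<^sup>+\<eta>. \<integral>\<^sup>+\<zeta>. a \<eta> * (?B \<zeta> * ?k (\<xi> - \<eta> - \<zeta>)) \<partial>lborel \<partial>lborel)"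
      by (simp add: nn_integral_add nn_integral_cmult)
    also have "(\<integral>\<^sup>+\<eta>. \<integral>\<^sup>+\<zeta>. b \<zeta> * (?A \<eta> * ?k (\<xi> - \<zeta> - \<eta>)) \<partial>lborel \<partial>lborel) = 
        (\<integral>\<^sup>+\<zeta>. \<integral>\<^sup>+\<eta>. b \<zeta> * (?A \<eta> * ?k (\<xi> - \<zeta> - \<eta>)) \<partial>lborel \<partial>lborel)"
      by (rule lborel_pair.Fubini') measurable
    also have "\<dots> = T ?A b \<xi>" unfolding T_def by (simp add: nn_integral_cmult)
    also have "(\<integral>\<^sup>+\<eta>. \<integral>\<^sup>+\<zeta>. a \<eta> * (?B \<zeta> * ?k (\<xi> - \<eta> - \<zeta>)) \<partial>lborel \<partial>lborel) = T ?B a \<xi>" 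
      unfolding T_def by (simp add: nn_integral_cmult)
    finally show ?thesis by (simp add: distrib_left)
  qed
  have "Lp_norm q (\<lambda>\<xi>. ?w \<xi> * (\<integral>\<^sup>+\<eta>. \<integral>\<^sup>+\<zeta>. ennreal (1 / jb (\<xi> - \<eta> - \<zeta>) ^ M) * (a \<eta> * b \<zeta>) \<partial>lborel \<partial>lborel)) \<le> 
      Lp_norm q (\<lambda>\<xi>. ennreal (4 powr s) * (T ?A b \<xi> + T ?B a \<xi>))"
    by (intro Lp_norm_mono q pw) measurable
  also have "\<dots> \<le> ennreal (4 powr s) * Lp_norm q (\<lambda>\<xi>. T ?A b \<xi> + T ?B a \<xi>)"
    by (rule Lp_norm_cmult_le[OF q]) measurable
  also have "\<dots> \<le> ennreal (4 powr s) * (Lp_norm q (T ?A b) + Lp_norm q (T ?B a))"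
    by (intro mult_left_mono Lp_norm_add_le q) auto
  also have "\<dots> \<le> ennreal (4 powr s) * ((D * Lp_norm q ?B) * ((\<integral>\<^sup>+\<theta>. ?k \<theta> \<partial>lborel) * Lp_norm q ?A) + 
      (D * Lp_norm q ?A) * ((\<integral>\<^sup>+\<theta>. ?k \<theta> \<partial>lborel) * Lp_norm q ?B))"
    by (intro mult_left_mono add_mono order_trans[OF T] mult_right_mono D) auto
  also have "\<dots> = 2 * ennreal (4 powr s) * D * (\<integral>\<^sup>+\<theta>. ?k \<theta> \<partial>lborel) * (Lp_norm q ?A * Lp_norm q ?B)"
    by (simp add: mult_ac mult_2[symmetric] flip: distrib_left)
  finally show ?thesis .
qed

text \<open>Frequency is placed outside and position inside, the order in which the modulation norm
  is formed.\<close>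

lemma nn_integral_lborel_pair:
  fixes f :: "'a::euclidean_space \<times> 'a \<Rightarrow> ennreal"
  assumes [measurable]: "f \<in> borel_measurable borel"
  shows "(\<integral>\<^sup>+t. f t \<partial>lborel) = (\<integral>\<^sup>+\<eta>. \<integral>\<^sup>+z. f (z, \<eta>) \<partial>lborel \<partial>lborel)"
proof -
  have m: "f \<in> borel_measurable (lborel \<Otimes>\<^sub>M lborel)" by (simp add: lborel_prod)
  show ?thesis using lborel_pair.nn_integral_snd[of "\<lambda>t. f t"] m by (simp add: lborel_prod split_beta')
qed

subsection \<open>The short-time Fourier transform of a product\<close>

text \<open>The coefficient is the transform, at frequency \<open>snd t + snd t' - snd r\<close>, of
  a product of three translated windows with their centres as parameters. All centres are compared
  with \<open>fst r\<close>: each of the other two costs \<open>N\<close> powers of decay of the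
  window there, and \<open>d + 1\<close> are kept for integrating, hence the exponent
  \<open>N + N + n0\<close>.\<close>

lemma triple_window_bound:
  fixes \<gamma> :: "'a::euclidean_space \<Rightarrow> complex"
  assumes \<gamma>: "\<gamma> \<in> schwartz"
  obtains C where "0 \<le> C" 
    "\<And>t t' r. norm (window_coeff \<gamma> (\<lambda>y. tf_shift \<gamma> t y * cnj (tf_shift \<gamma> r y)) t') \<le> 
       C * ((1 / jb (fst r - fst t) ^ N) * (1 / jb (fst r - fst t') ^ N) * (1 / jb (snd r - snd t - snd t') ^ M))"
proof -
  define n0 where "n0 = Suc DIM('a)"
  define w where "w p y = ((1 / jb (fst (snd (snd p)) - fst p) ^ N) * (1 / jb (fst (snd (snd p)) - fst (snd p)) ^ N)) * (1 / jb (- fst (snd (snd p)) + y) ^ n0)" 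
    for p :: "'a \<times> 'a \<times> ('a \<times> real)" and y :: 'a
  define f where "f p y = \<gamma> (y - fst p) * (\<gamma> (y - fst (snd p)) * cnj (\<gamma> (y - fst (snd (snd p)))))" 
    for p :: "'a \<times> 'a \<times> ('a \<times> real)" and y :: 'a
  have F: "fam M w f"
  proof (rule fam_mono[where K="2 ^ N * 2 ^ N"])
    show "fam M (\<lambda>p y. (1 / jb (y - fst p) ^ N) * ((1 / jb (y - fst (snd p)) ^ N) * (1 / jb (y - fst (snd (snd p))) ^ (N + N + n0)))) f"
      unfolding f_def
      by (intro fam_mult fam_cnj fam_translate[where f="\<lambda>p. \<gamma>" and w="\<lambda>p y. 1 / jb y ^ N"] 
           fam_translate[where f="\<lambda>p. \<gamma>" and w="\<lambda>p y. 1 / jb y ^ (N + N + n0)"] fam_schwartz \<gamma> continuous_intros)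
    fix p :: "'a \<times> 'a \<times> ('a \<times> real)" and y :: 'a
    let ?x = "fst (snd (snd p))"
    have P: "1 / jb (y - v) ^ N \<le> 2 ^ N * jb (y - ?x) ^ N * (1 / jb (?x - v) ^ N)" for v
      using inverse_jb_Peetre[of "?x - v" "y - ?x" N] by simp
    have "(1 / jb (y - fst p) ^ N) * ((1 / jb (y - fst (snd p)) ^ N) * (1 / jb (y - ?x) ^ (N + N + n0))) \<le> 
       (2 ^ N * jb (y - ?x) ^ N * (1 / jb (?x - fst p) ^ N)) * ((2 ^ N * jb (y - ?x) ^ N * (1 / jb (?x - fst (snd p)) ^ N)) * (1 / jb (y - ?x) ^ (N + N + n0)))"
      by (intro mult_mono P order_refl) auto
    also have "\<dots> = 2 ^ N * 2 ^ N * w p y"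
      by (simp add: w_def power_add)
    finally show "(1 / jb (y - fst p) ^ N) * ((1 / jb (y - fst (snd p)) ^ N) * (1 / jb (y - ?x) ^ (N + N + n0))) \<le> 2 ^ N * 2 ^ N * w p y" .
  qed simp
  define I where "I = (\<integral>y. 1 / jb (y::'a) ^ n0 \<partial>lborel)"
  have wi: "integrable lborel (\<lambda>y :: 'a. 1 / jb y ^ n0)" by (rule integrable_jb_power) (simp add: n0_def)
  have w: "integrable lborel (w p)" for p
    unfolding w_def by (intro integrable_mult_right integrable_lborel_translate[OF wi])
  have tr: "(\<integral>y. 1 / jb (v + y :: 'a) ^ n0 \<partial>lborel) = I" for v
    using integral_lborel_translate[of "\<lambda>y. complex_of_real (1 / jb y ^ n0)" v] 
    unfolding integral_complex_of_real I_def of_real_eq_iff by simp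
  have \<omega>: "(\<integral>y. w p y \<partial>lborel) \<le> ((1 / jb (fst (snd (snd p)) - fst p) ^ N) * (1 / jb (fst (snd (snd p)) - fst (snd p)) ^ N)) * I" for p
    unfolding w_def by (subst integral_mult_right_zero) (simp only: tr order_refl)
  obtain C where C: "0 \<le> C" "\<And>p \<theta>. norm (fourier (f p) \<theta>) \<le> 
       C * (((1 / jb (fst (snd (snd p)) - fst p) ^ N) * (1 / jb (fst (snd (snd p)) - fst (snd p)) ^ N)) * I) / jb \<theta> ^ M"
    using fourier_decay[OF F w \<omega>] by blast
  have I0: "0 \<le> I" by (auto simp: I_def)
  show thesis
  proof (rule that[of "C * I"])
    fix t t' r :: "'a \<times> 'a"
    let ?p = "(fst t, fst t', fst r, 0::real)"
    have "window_coeff \<gamma> (\<lambda>y. tf_shift \<gamma> t y * cnj (tf_shift \<gamma> r y)) t' = fourier (f ?p) (snd t + snd t' - snd r)"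
      unfolding window_coeff_def fourier_def
    proof (rule Bochner_Integration.integral_cong[OF refl])
      fix y
      have "exp (\<i> * complex_of_real ((snd t + snd t' - snd r) \<bullet> y)) = 
        exp (\<i> * complex_of_real (snd t' \<bullet> y)) * (exp (\<i> * complex_of_real (snd t \<bullet> y)) * exp (- \<i> * complex_of_real (snd r \<bullet> y)))"
      proof -
        have "\<i> * complex_of_real ((snd t + snd t' - snd r) \<bullet> y) = 
            \<i> * complex_of_real (snd t' \<bullet> y) + (\<i> * complex_of_real (snd t \<bullet> y) + (- \<i> * complex_of_real (snd r \<bullet> y)))"
          by (simp add: inner_add_left inner_diff_left algebra_simps)
        then show ?thesis by (simp only: exp_add)
      qed
      then show "tf_shift \<gamma> t' y * (tf_shift \<gamma> t y * cnj (tf_shift \<gamma> r y)) = exp (\<i> * complex_of_real ((snd t + snd t' - snd r) \<bullet> y)) * f ?p y"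
        by (simp add: tf_shift_apply[of \<gamma> t] tf_shift_apply[of \<gamma> t'] cnj_tf_shift f_def mult_ac)
    qed
    moreover have "jb (snd t + snd t' - snd r) = jb (snd r - snd t - snd t')"
      using jb_minus[of "snd t + snd t' - snd r"] by (simp add: algebra_simps)
    ultimately show "norm (window_coeff \<gamma> (\<lambda>y. tf_shift \<gamma> t y * cnj (tf_shift \<gamma> r y)) t') \<le> 
       C * I * ((1 / jb (fst r - fst t) ^ N) * (1 / jb (fst r - fst t') ^ N) * (1 / jb (snd r - snd t - snd t') ^ M))"
      using C(2)[of ?p "snd t + snd t' - snd r"] by (simp add: mult_ac)
  qed (use C I0 in simp)
qed

text \<open>A convolution in position with an integrable kernel, so that by Young's inequality the
  smearing caused by the windows costs only a constant in every \<open>L^p\<close> norm.\<close>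

definition window_average :: "('a::euclidean_space \<times> 'a \<Rightarrow> complex) \<Rightarrow> 'a \<Rightarrow> 'a \<Rightarrow> ennreal" where
  "window_average V x \<eta> = (\<integral>\<^sup>+z. ennreal (norm (V (z, \<eta>))) * ennreal (1 / jb (x - z) ^ Suc DIM('a)) \<partial>lborel)"

lemma measurable_section:
  fixes V :: "'a::euclidean_space \<times> 'a \<Rightarrow> complex"
  assumes V: "V \<in> borel_measurable borel" and [measurable]: "f \<in> borel_measurable N" "g \<in> borel_measurable N"
  shows "(\<lambda>p. V (f p, g p)) \<in> borel_measurable N"
proof -
  have "(\<lambda>p. (f p, g p)) \<in> N \<rightarrow>\<^sub>M borel" by measurable
  then show ?thesis by (rule measurable_compose) (rule V)
qed

text \<open>\<open>synthesis_pairing\<close> is applied once for each factor, which leaves the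
  coefficient estimated by \<open>triple_window_bound\<close>. That bound is a product of kernels in
  \<open>x - z\<close>, \<open>x - w\<close> and \<open>\<xi> - \<eta> - \<zeta>\<close>, so Tonelli
  collects the position integrals into the two averages. The reconstruction constant
  \<open>K\<close> occurs twice in the product and goes into \<open>C\<close>.\<close>

lemma stft_product_bound:
  fixes \<gamma> :: "'a::euclidean_space \<Rightarrow> complex"
  assumes \<gamma>: "\<gamma> \<in> schwartz"
  obtains C where "0 \<le> C" 
    "\<And>V W A B x \<xi>. locally_bounded_stft V A \<Longrightarrow> locally_bounded_stft W B \<Longrightarrow>
       ennreal (norm (stft \<gamma> (regular_distribution (\<lambda>y. (K * synthesis \<gamma> V y) * (K * synthesis \<gamma> W y))) x \<xi>)) \<le> 
       ennreal C * (\<integral>\<^sup>+\<eta>. \<integral>\<^sup>+\<zeta>. ennreal (1 / jb (\<xi> - \<eta> - \<zeta>) ^ M) * (window_average V x \<eta> * window_average W x \<zeta>) \<partial>lborel \<partial>lborel)"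
proof -
  let ?n = "Suc DIM('a)"
  define c0 where "c0 = complex_of_real ((2 * pi) powr (- real DIM('a) / 2))"
  obtain C where C: "0 \<le> C" 
    "\<And>t t' r. norm (window_coeff \<gamma> (\<lambda>y. tf_shift \<gamma> t y * cnj (tf_shift \<gamma> r y)) t') \<le> 
       C * ((1 / jb (fst r - fst t) ^ ?n) * (1 / jb (fst r - fst t') ^ ?n) * (1 / jb (snd r - snd t - snd t') ^ M))"
    by (rule triple_window_bound[OF \<gamma>, where N="?n" and M=M]) blast
  note [measurable] = measurable_tf_shift[OF \<gamma>]
  obtain G where G: "0 \<le> G" "\<And>t y. norm (tf_shift \<gamma> t y) \<le> G * (1 / jb (y - fst t) ^ 0)"
    by (rule norm_tf_shift_le[OF \<gamma>, where N=0]) blast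
  show thesis
  proof (rule that[of "norm (c0 * K * K) * C"])
    fix V W :: "'a \<times> 'a \<Rightarrow> complex" and A B and x \<xi> :: 'a
    assume V: "locally_bounded_stft V A" and W: "locally_bounded_stft W B"
    have [measurable]: "V \<in> borel_measurable borel" "W \<in> borel_measurable borel"
      using V W by (auto simp: locally_bounded_stft_def)
    let ?v = "\<lambda>t. ennreal (norm (V t))" and ?w = "\<lambda>t. ennreal (norm (W t))"
    let ?kx = "\<lambda>z. ennreal (1 / jb (x - z) ^ ?n)" and ?kf = "\<lambda>\<eta> \<zeta>. ennreal (1 / jb (\<xi> - \<eta> - \<zeta>) ^ M)"
    let ?kr = "\<lambda>t t'. (1 / jb (x - fst t) ^ ?n) * (1 / jb (x - fst t') ^ ?n) * (1 / jb (\<xi> - snd t - snd t') ^ M)"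
    let ?r = "(x, \<xi>)"
    let ?R = "\<integral>\<^sup>+\<eta>. \<integral>\<^sup>+\<zeta>. ?kf \<eta> \<zeta> * (window_average V x \<eta> * window_average W x \<zeta>) \<partial>lborel \<partial>lborel"
    let ?e = "\<lambda>y. cnj (tf_shift \<gamma> ?r y)"
    let ?Q' = "\<lambda>t y. tf_shift \<gamma> t y * ?e y"
    let ?J = "\<integral>t. V t * (\<integral>t'. W t' * window_coeff \<gamma> (?Q' t) t' \<partial>lborel) \<partial>lborel"
    let ?Q = "\<lambda>y. synthesis \<gamma> W y * ?e y"
    have ei: "integrable lborel ?e" by (rule schwartz_integrable[OF cnj_tf_shift_schwartz[OF \<gamma>]])
    have [measurable]: "?e \<in> borel_measurable borel" 
      by (intro borel_measurable_continuous_onI continuous_intros continuous_tf_shift(2)[OF \<gamma>])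
    have bnd: "integrable lborel (\<lambda>y. H y * ?e y)" if "H \<in> borel_measurable borel" "\<And>y. norm (H y) \<le> D" for H D
    proof (rule integrable_bound_measurable)
      show "integrable lborel (\<lambda>y. D * norm (?e y))" by (intro integrable_mult_right integrable_norm ei)
      show "(\<lambda>y. H y * ?e y) \<in> borel_measurable lborel" using that(1) by measurable
    qed (use that(2) in \<open>auto simp: norm_mult intro!: mult_right_mono\<close>)
    have Q'i: "integrable lborel (?Q' t)" for t
      by (rule bnd[of _ G]) (use G in auto)
    \<comment> \<open>The synthesised factor is bounded and continuous but need not be smooth, so
      this product is integrable without being a Schwartz function.\<close>
    have Qi: "integrable lborel ?Q"
    proof -
      have "synthesis \<gamma> W \<in> bcontfun" by (rule synthesis_bcontfun[OF \<gamma> W])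
      then obtain D where D: "\<And>y. norm (synthesis \<gamma> W y) \<le> D" and c: "continuous_on UNIV (synthesis \<gamma> W)" 
        by (auto simp: bcontfun_def bounded_iff)
      show ?thesis by (rule bnd[of _ D]) (use D borel_measurable_continuous_onI[OF c] in auto)
    qed
    \<comment> \<open>The second use of transposition: the shift at \<open>t\<close> joins the test
      function, and only explicit windows remain inside the coefficient.\<close>
    have wcQ: "window_coeff \<gamma> ?Q t = (\<integral>t'. W t' * window_coeff \<gamma> (?Q' t) t' \<partial>lborel)" for t
    proof -
      have "window_coeff \<gamma> ?Q t = (\<integral>y. synthesis \<gamma> W y * ?Q' t y \<partial>lborel)"
        unfolding window_coeff_def by (intro Bochner_Integration.integral_cong refl) (simp only: mult_ac)
      then show ?thesis using synthesis_pairing[OF \<gamma> W Q'i[of t]] by simp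
    qed
    let ?H = "\<lambda>y. (K * synthesis \<gamma> V y) * (K * synthesis \<gamma> W y)"
    have "stft \<gamma> (regular_distribution ?H) x \<xi> = c0 * (\<integral>y. ?H y * ?e y \<partial>lborel)"
      using stft_eq[of \<gamma> "regular_distribution ?H" ?r] cnj_tf_shift_schwartz[OF \<gamma>, of ?r]
      by (simp add: regular_distribution_def c0_def)
    also have "(\<integral>y. ?H y * ?e y \<partial>lborel) = (\<integral>y. K * K * (synthesis \<gamma> V y * ?Q y) \<partial>lborel)"
      by (intro Bochner_Integration.integral_cong refl) (simp only: mult_ac)
    also have "\<dots> = K * K * (\<integral>y. synthesis \<gamma> V y * ?Q y \<partial>lborel)" by (rule integral_mult_right_zero)
    also have "(\<integral>y. synthesis \<gamma> V y * ?Q y \<partial>lborel) = (\<integral>t. V t * window_coeff \<gamma> ?Q t \<partial>lborel)"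
      by (rule synthesis_pairing[OF \<gamma> V Qi])
    finally have eq: "stft \<gamma> (regular_distribution ?H) x \<xi> = c0 * K * K * ?J"
      unfolding wcQ by (simp add: mult.assoc)
    let ?k = "\<lambda>t t'. ?v t * (?w t' * ennreal (?kr t t'))"
    have "ennreal (norm ?J) \<le> 
        (\<integral>\<^sup>+t. ennreal (norm (V t * (\<integral>t'. W t' * window_coeff \<gamma> (?Q' t) t' \<partial>lborel))) \<partial>lborel)"
      by (rule norm_integral_le_nn_integral)
    also have "\<dots> \<le> (\<integral>\<^sup>+t. ?v t * (\<integral>\<^sup>+t'. ennreal (norm (W t' * window_coeff \<gamma> (?Q' t) t')) \<partial>lborel) \<partial>lborel)"
      unfolding norm_mult[of "V _"] ennreal_mult[OF norm_ge_zero norm_ge_zero]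
      by (intro nn_integral_mono mult_left_mono norm_integral_le_nn_integral) auto
    also have "\<dots> \<le> (\<integral>\<^sup>+t. ?v t * (\<integral>\<^sup>+t'. ?w t' * (ennreal C * ennreal (?kr t t')) \<partial>lborel) \<partial>lborel)"
    proof (intro nn_integral_mono mult_left_mono)
      fix t t' :: "'a \<times> 'a"
      have "norm (W t' * window_coeff \<gamma> (?Q' t) t') \<le> norm (W t') * (C * (?kr t t'))"
        unfolding norm_mult using C(2)[of t ?r t'] by (intro mult_left_mono) auto
      then have "ennreal (norm (W t' * window_coeff \<gamma> (?Q' t) t')) \<le> ennreal \<dots>" by (rule ennreal_leI)
      also have "\<dots> = ?w t' * (ennreal C * ennreal (?kr t t'))"
        using C(1) by (subst ennreal_mult, simp, simp, subst ennreal_mult) auto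
      finally show "ennreal (norm (W t' * window_coeff \<gamma> (?Q' t) t')) \<le> \<dots>" .
    qed auto
    also have "\<dots> = (\<integral>\<^sup>+t. \<integral>\<^sup>+t'. ennreal C * ?k t t' \<partial>lborel \<partial>lborel)"
    proof (intro nn_integral_cong)
      fix t :: "'a \<times> 'a"
      have m: "(\<lambda>t'. ?w t' * (ennreal C * ennreal (?kr t t'))) \<in> borel_measurable lborel"
      proof -
        have "continuous_on UNIV (\<lambda>t' :: 'a \<times> 'a. ?kr t t')"
          by (intro continuous_intros) auto
        from borel_measurable_continuous_onI[OF this] 
        have [measurable]: "(\<lambda>t'. ennreal (?kr t t')) \<in> borel_measurable borel"
          by (rule measurable_compose[OF _ measurable_ennreal])
        show ?thesis unfolding measurable_lborel2 by (intro borel_measurable_times_ennreal) measurable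
      qed
      show "?v t * (\<integral>\<^sup>+t'. ?w t' * (ennreal C * ennreal (?kr t t')) \<partial>lborel) = 
         (\<integral>\<^sup>+t'. ennreal C * ?k t t' \<partial>lborel)"
        by (subst nn_integral_cmult[OF m, symmetric]) (intro nn_integral_cong, simp only: mult_ac)
    qed
    also have "\<dots> = (\<integral>\<^sup>+\<eta>. \<integral>\<^sup>+z. \<integral>\<^sup>+\<zeta>. \<integral>\<^sup>+w. ennreal C * ?k (z, \<eta>) (w, \<zeta>) \<partial>lborel \<partial>lborel \<partial>lborel \<partial>lborel)"
    proof -
      have m2: "(\<lambda>p. ennreal C * ?k (fst p) (snd p)) \<in> borel_measurable borel"
      proof -
        have "continuous_on UNIV (\<lambda>p :: ('a \<times> 'a) \<times> ('a \<times> 'a). ?kr (fst p) (snd p))"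
          by (intro continuous_intros) auto
        from borel_measurable_continuous_onI[OF this] 
        have [measurable]: "(\<lambda>p. ennreal (?kr (fst p) (snd p))) \<in> borel_measurable borel"
          by (rule measurable_compose[OF _ measurable_ennreal])
        have fs: "fst \<in> borel \<rightarrow>\<^sub>M (borel :: ('a \<times> 'a) measure)" "snd \<in> borel \<rightarrow>\<^sub>M (borel :: ('a \<times> 'a) measure)"
          by (intro borel_measurable_continuous_onI continuous_intros)+
        have [measurable]: "(\<lambda>p. V (fst p)) \<in> borel_measurable (borel :: (('a \<times> 'a) \<times> ('a \<times> 'a)) measure)"
          "(\<lambda>p. W (snd p)) \<in> borel_measurable (borel :: (('a \<times> 'a) \<times> ('a \<times> 'a)) measure)"
          using measurable_compose[OF fs(1) \<open>V \<in> _\<close>] measurable_compose[OF fs(2) \<open>W \<in> _\<close>] by auto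
        show ?thesis by (intro borel_measurable_times_ennreal) measurable
      qed
      then have m3: "(\<lambda>(t, t'). ennreal C * ?k t t') \<in> borel_measurable (lborel \<Otimes>\<^sub>M lborel)"
        by (simp add: lborel_prod split_beta')
      have m1: "(\<lambda>t'. ennreal C * ?k t t') \<in> borel_measurable borel" for t
      proof -
        have "(\<lambda>t'. (t, t')) \<in> borel \<rightarrow>\<^sub>M (borel :: (('a \<times> 'a) \<times> ('a \<times> 'a)) measure)"
          by (intro borel_measurable_continuous_onI continuous_intros)
        from measurable_compose[OF this m2] show ?thesis by (simp only: fst_conv snd_conv)
      qed
      have m4: "(\<lambda>t. \<integral>\<^sup>+t'. ennreal C * ?k t t' \<partial>lborel) \<in> borel_measurable borel"
        using lborel.borel_measurable_nn_integral_fst[OF m3] by simp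
      show ?thesis
        by (rule trans[OF nn_integral_lborel_pair[OF m4]]) (intro nn_integral_cong nn_integral_lborel_pair m1)
    qed
    also have "\<dots> = (\<integral>\<^sup>+\<eta>. \<integral>\<^sup>+z. \<integral>\<^sup>+\<zeta>. ennreal C * (?v (z, \<eta>) * ?kx z * (?kf \<eta> \<zeta> * window_average W x \<zeta>)) \<partial>lborel \<partial>lborel \<partial>lborel)"
    proof (intro nn_integral_cong)
      fix \<eta> z \<zeta> :: 'a
      have m: "(\<lambda>w. ?w (w, \<zeta>) * ?kx w) \<in> borel_measurable lborel"
        using measurable_section[OF \<open>W \<in> _\<close>, of "\<lambda>w. w" lborel "\<lambda>w. \<zeta>"] by measurable
      have "(\<integral>\<^sup>+w. ennreal C * ?k (z, \<eta>) (w, \<zeta>) \<partial>lborel) = 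
        (\<integral>\<^sup>+w. (ennreal C * (?v (z, \<eta>) * ?kx z * ?kf \<eta> \<zeta>)) * (?w (w, \<zeta>) * ?kx w) \<partial>lborel)"
      proof (intro nn_integral_cong)
        fix w
        have "ennreal ((1 / jb (x - z) ^ ?n) * (1 / jb (x - w) ^ ?n) * (1 / jb (\<xi> - \<eta> - \<zeta>) ^ M)) = 
           ?kx z * ?kx w * ?kf \<eta> \<zeta>"
          by (subst ennreal_mult, simp, simp, subst ennreal_mult) auto
        then show "ennreal C * ?k (z, \<eta>) (w, \<zeta>) = (ennreal C * (?v (z, \<eta>) * ?kx z * ?kf \<eta> \<zeta>)) * (?w (w, \<zeta>) * ?kx w)"
          by (simp only: fst_conv snd_conv mult_ac)
      qed
      also have "\<dots> = (ennreal C * (?v (z, \<eta>) * ?kx z * ?kf \<eta> \<zeta>)) * window_average W x \<zeta>"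
        unfolding window_average_def by (rule nn_integral_cmult[OF m])
      finally show "(\<integral>\<^sup>+w. ennreal C * ?k (z, \<eta>) (w, \<zeta>) \<partial>lborel) = 
        ennreal C * (?v (z, \<eta>) * ?kx z * (?kf \<eta> \<zeta> * window_average W x \<zeta>))"
        by (simp only: mult_ac)
    qed
    also have "\<dots> = (\<integral>\<^sup>+\<eta>. \<integral>\<^sup>+\<zeta>. ennreal C * (?kf \<eta> \<zeta> * (window_average V x \<eta> * window_average W x \<zeta>)) \<partial>lborel \<partial>lborel)"
    proof (rule nn_integral_cong)
      fix \<eta> :: 'a
      have mW[measurable]: "window_average W x \<in> borel_measurable borel"
        unfolding window_average_def using measurable_section[OF \<open>W \<in> _\<close>, of snd "borel \<Otimes>\<^sub>M borel" fst] by measurable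
      have mV[measurable]: "(\<lambda>z. V (z, \<eta>)) \<in> borel_measurable borel"
        using measurable_section[OF \<open>V \<in> _\<close>, of "\<lambda>w. w" borel "\<lambda>w. \<eta>"] by simp
      have "(\<integral>\<^sup>+z. \<integral>\<^sup>+\<zeta>. ennreal C * (?v (z, \<eta>) * ?kx z * (?kf \<eta> \<zeta> * window_average W x \<zeta>)) \<partial>lborel \<partial>lborel) =
        (\<integral>\<^sup>+\<zeta>. \<integral>\<^sup>+z. ennreal C * (?v (z, \<eta>) * ?kx z * (?kf \<eta> \<zeta> * window_average W x \<zeta>)) \<partial>lborel \<partial>lborel)"
        by (rule lborel_pair.Fubini') measurable
      also have "\<dots> = (\<integral>\<^sup>+\<zeta>. ennreal C * (?kf \<eta> \<zeta> * (window_average V x \<eta> * window_average W x \<zeta>)) \<partial>lborel)"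
      proof (intro nn_integral_cong)
        fix \<zeta> :: 'a
        have "(\<integral>\<^sup>+z. ennreal C * (?v (z, \<eta>) * ?kx z * (?kf \<eta> \<zeta> * window_average W x \<zeta>)) \<partial>lborel) = 
          (\<integral>\<^sup>+z. (ennreal C * (?kf \<eta> \<zeta> * window_average W x \<zeta>)) * (?v (z, \<eta>) * ?kx z) \<partial>lborel)"
          by (intro nn_integral_cong) (simp only: mult_ac)
        also have "\<dots> = (ennreal C * (?kf \<eta> \<zeta> * window_average W x \<zeta>)) * window_average V x \<eta>"
          unfolding window_average_def[of V] by (rule nn_integral_cmult) measurable
        finally show "(\<integral>\<^sup>+z. ennreal C * (?v (z, \<eta>) * ?kx z * (?kf \<eta> \<zeta> * window_average W x \<zeta>)) \<partial>lborel) = 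
          ennreal C * (?kf \<eta> \<zeta> * (window_average V x \<eta> * window_average W x \<zeta>))"
          by (simp only: mult_ac)
      qed
      finally show "(\<integral>\<^sup>+z. \<integral>\<^sup>+\<zeta>. ennreal C * (?v (z, \<eta>) * ?kx z * (?kf \<eta> \<zeta> * window_average W x \<zeta>)) \<partial>lborel \<partial>lborel) = 
         (\<integral>\<^sup>+\<zeta>. ennreal C * (?kf \<eta> \<zeta> * (window_average V x \<eta> * window_average W x \<zeta>)) \<partial>lborel)" .
    qed
    also have "\<dots> = ennreal C * ?R"
    proof -
      have [measurable]: "window_average W x \<in> borel_measurable borel"
        unfolding window_average_def using measurable_section[OF \<open>W \<in> _\<close>, of snd "borel \<Otimes>\<^sub>M borel" fst] by measurable
      have [measurable]: "window_average V x \<in> borel_measurable borel"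
        unfolding window_average_def using measurable_section[OF \<open>V \<in> _\<close>, of snd "borel \<Otimes>\<^sub>M borel" fst] by measurable
      show ?thesis by (simp add: nn_integral_cmult)
    qed
    finally have "ennreal (norm (c0 * K * K)) * ennreal (norm ?J) \<le> 
      ennreal (norm (c0 * K * K)) * (ennreal C * ?R)"
      by (rule mult_left_mono) simp
    then show "ennreal (norm (stft \<gamma> (regular_distribution ?H) x \<xi>)) \<le> 
       ennreal (norm (c0 * K * K) * C) * ?R"
      unfolding eq norm_mult[of "c0 * K * K"] ennreal_mult[OF norm_ge_zero norm_ge_zero] ennreal_mult[OF norm_ge_zero C(1)] by (simp only: mult.assoc)
  qed (use C in simp)
qed

lemma Lp_norm_window_average:
  fixes V :: "'a::euclidean_space \<times> 'a \<Rightarrow> complex"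
  assumes p: "1 \<le> p" and V: "V \<in> borel_measurable borel"
  shows "Lp_norm p (\<lambda>x. window_average V x \<eta>) \<le> 
    (\<integral>\<^sup>+z. ennreal (1 / jb (z::'a) ^ Suc DIM('a)) \<partial>lborel) * Lp_norm p (\<lambda>x. ennreal (norm (V (x, \<eta>))))"
  unfolding window_average_def
proof (rule Young_convolution'[OF p])
  show "(\<lambda>x. ennreal (norm (V (x, \<eta>)))) \<in> borel_measurable borel"
    using measurable_section[OF V, of "\<lambda>x. x" borel "\<lambda>_. \<eta>"] by measurable
qed measurable

text \<open>Hoelder in position against the kernel, which is bounded by 1 and integrable and
  therefore lies in every \<open>L^p'\<close>. Its norm does not grow under reflection and
  translation, so the bound is uniform in \<open>y\<close>; the frequency is then
  integrated.\<close>

lemma locally_bounded_stftI: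
  fixes V :: "'a::euclidean_space \<times> 'a \<Rightarrow> complex"
  assumes p: "1 \<le> p" and V: "V \<in> borel_measurable borel"
    and fin: "(\<integral>\<^sup>+\<eta>. Lp_norm p (\<lambda>x. ennreal (norm (V (x, \<eta>)))) \<partial>lborel) < top"
  obtains B where "locally_bounded_stft V B"
proof -
  let ?n = "Suc DIM('a)"
  let ?k = "\<lambda>z :: 'a. ennreal (1 / jb z ^ ?n)"
  obtain p' where p': "1 \<le> p'" "1 / 1 = 1 / p' + 1 / p" by (rule conjugate_exponent[OF p]) blast
  have k1: "?k z \<le> 1" for z by (simp add: one_le_power del: power_Suc flip: ennreal_1)
  have k: "Lp_norm p' ?k < top"
    using nn_integral_jb_power[of ?n, where 'a='a] k1 by (intro Lp_norm_le_1_finite p') auto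
  define a where "a \<eta> = Lp_norm p (\<lambda>x. ennreal (norm (V (x, \<eta>))))" for \<eta>
  have sec: "(\<lambda>z. ennreal (norm (V (z, \<eta>)))) \<in> borel_measurable borel" for \<eta>
    using measurable_section[OF V, of "\<lambda>x. x" borel "\<lambda>_. \<eta>"] by measurable
  have [measurable]: "a \<in> borel_measurable borel" unfolding a_def
  proof (rule measurable_Lp_norm[OF p])
    show "(\<lambda>(\<eta>, x). ennreal (norm (V (x, \<eta>)))) \<in> borel_measurable (borel \<Otimes>\<^sub>M borel)"
      using measurable_section[OF V, of snd "borel \<Otimes>\<^sub>M borel" fst] by (simp add: split_beta')
  qed
  define D where "D = Lp_norm p' ?k * (\<integral>\<^sup>+\<eta>. a \<eta> \<partial>lborel)"
  have D: "D < top" using k fin by (simp add: D_def a_def ennreal_mult_less_top)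
  have le: "(\<integral>\<^sup>+t. ennreal (norm (V t) * (1 / jb (y - fst t) ^ ?n)) \<partial>lborel) \<le> D" for y
  proof -
    have "(\<lambda>t. norm (V t) * (1 / jb (y - fst t) ^ ?n)) \<in> borel_measurable borel" 
      using V by measurable
    then have m: "(\<lambda>t. ennreal (norm (V t) * (1 / jb (y - fst t) ^ ?n))) \<in> borel_measurable borel"
      by (rule measurable_compose[OF _ measurable_ennreal])
    have "(\<integral>\<^sup>+t. ennreal (norm (V t) * (1 / jb (y - fst t) ^ ?n)) \<partial>lborel) = 
      (\<integral>\<^sup>+\<eta>. \<integral>\<^sup>+z. ennreal (norm (V (z, \<eta>)) * (1 / jb (y - z) ^ ?n)) \<partial>lborel \<partial>lborel)"
      using nn_integral_lborel_pair[OF m] by simp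
    also have "\<dots> \<le> (\<integral>\<^sup>+\<eta>. Lp_norm p' ?k * a \<eta> \<partial>lborel)"
    proof (rule nn_integral_mono)
      fix \<eta> :: 'a
      have "(\<integral>\<^sup>+z. ennreal (norm (V (z, \<eta>)) * (1 / jb (y - z) ^ ?n)) \<partial>lborel) = Lp_norm 1 (\<lambda>z. ?k (y - z) * ennreal (norm (V (z, \<eta>))))"
        unfolding Lp_norm_1 by (intro nn_integral_cong) (simp add: ennreal_mult'[symmetric] mult.commute)
      also have "\<dots> \<le> Lp_norm p' (\<lambda>z. ?k (y - z)) * a \<eta>"
        unfolding a_def by (rule Lp_norm_Holder[OF _ p'(1) p p'(2) _ sec]) auto
      also have "\<dots> \<le> Lp_norm p' ?k * a \<eta>"
        by (intro mult_right_mono Lp_norm_reflect_le p') auto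
      finally show "(\<integral>\<^sup>+z. ennreal (norm (V (z, \<eta>)) * (1 / jb (y - z) ^ ?n)) \<partial>lborel) \<le> Lp_norm p' ?k * a \<eta>" .
    qed
    also have "\<dots> = D" unfolding D_def by (rule nn_integral_cmult) auto
    finally show ?thesis .
  qed
  show thesis
  proof (rule that[of "enn2real D"])
    show "locally_bounded_stft V (enn2real D)"
      unfolding locally_bounded_stft_def using V le D by (simp add: less_top)
  qed
qed

theorem theorem3:
  fixes \<gamma> :: "'a::euclidean_space \<Rightarrow> complex"
    and p p1 p2 q :: ennreal
    and s :: real
  assumes "\<gamma> \<in> schwartz" and "\<gamma> \<noteq> (\<lambda>_. 0)"
    and "1 \<le> p" and "1 \<le> p1" and "1 \<le> p2" and "1 \<le> q"
    and "1 / p = 1 / p1 + 1 / p2"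
    and "q > 1 \<longrightarrow> s > real DIM('a) * (1 - enn2real (1 / q))"
    and "q = 1 \<longrightarrow> s \<ge> 0"
  shows "\<exists>C::real. C > 0 \<and>
    (\<forall>f\<in>modulation_space \<gamma> p1 q s. \<forall>g\<in>modulation_space \<gamma> p2 q s.
       distr_product f g \<in> modulation_space \<gamma> p q s \<and>
       modulation_norm \<gamma> p q s (distr_product f g)
         \<le> ennreal C * modulation_norm \<gamma> p1 q s f * modulation_norm \<gamma> p2 q s g)"
proof -
  note \<gamma> = assms(1,2)
  note p = assms(3-5) and q = assms(6)
  let ?w = "\<lambda>\<xi> :: 'a. ennreal (jb \<xi> powr s)"
  obtain D :: ennreal where D: "D < top"
    "\<And>b :: 'a \<Rightarrow> ennreal. b \<in> borel_measurable borel \<Longrightarrow> (\<integral>\<^sup>+\<eta>. b \<eta> \<partial>lborel) \<le> D * Lp_norm q (\<lambda>\<eta>. ?w \<eta> * b \<eta>)"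
    by (rule weighted_Lq_le_L1[OF q assms(8,9)]) blast
  \<comment> \<open>Since \<open>1 / q\<close> is at most 1, the strict hypothesis for
    \<open>q > 1\<close> also yields the sign of \<open>s\<close>, on which monotonicity of the
    weight in the convolution estimate relies.\<close>
  have s: "0 \<le> s"
  proof (cases "q = 1")
    case False
    then have q1: "1 < q" using q by (simp add: less_le)
    have "enn2real (1 / q) \<le> 1"
      using q by (cases rule: ennreal_ge_1_cases) (auto simp: ennreal_inverse_real)
    then have "0 \<le> real DIM('a) * (1 - enn2real (1 / q))" by simp
    then show ?thesis using assms(8) q1 by linarith
  qed (use assms(9) in simp)
  obtain K :: complex where K:
    "\<And>u B. u \<in> tempered_distributions \<Longrightarrow> locally_bounded_stft (\<lambda>t. stft \<gamma> u (fst t) (snd t)) B \<Longrightarrow>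
       u = regular_distribution (\<lambda>y. K * synthesis \<gamma> (\<lambda>t. stft \<gamma> u (fst t) (snd t)) y)"
    by (rule stft_reconstruction[OF \<gamma>]) blast
  \<comment> \<open>Large enough for the kernel of exponent \<open>M - s\<close>, left after the
    weight has been absorbed, to be integrable.\<close>
  define M where "M = nat \<lceil>s\<rceil> + Suc DIM('a)"
  have M: "real DIM('a) < real M - s" unfolding M_def by linarith
  obtain C0 where C0: "0 \<le> C0" 
    "\<And>V W A B x \<xi>. locally_bounded_stft V A \<Longrightarrow> locally_bounded_stft W B \<Longrightarrow>
       ennreal (norm (stft \<gamma> (regular_distribution (\<lambda>y. (K * synthesis \<gamma> V y) * (K * synthesis \<gamma> W y))) x \<xi>)) \<le> 
       ennreal C0 * (\<integral>\<^sup>+\<eta>. \<integral>\<^sup>+\<zeta>. ennreal (1 / jb (\<xi> - \<eta> - \<zeta>) ^ M) * (window_average V x \<eta> * window_average W x \<zeta>) \<partial>lborel \<partial>lborel)"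
    by (rule stft_product_bound[OF \<gamma>(1), where K=K and M=M]) blast
  define \<kappa> where "\<kappa> = (\<integral>\<^sup>+z. ennreal (1 / jb (z::'a) ^ Suc DIM('a)) \<partial>lborel)"
  have \<kappa>: "\<kappa> < top" unfolding \<kappa>_def using nn_integral_jb_power[of "Suc DIM('a)", where 'a='a] by simp
  define \<mu> where "\<mu> = (\<integral>\<^sup>+\<theta>. ennreal (jb (\<theta>::'a) powr (s - real M)) \<partial>lborel)"
  have \<mu>: "\<mu> < top" unfolding \<mu>_def using nn_integral_jb_powr[OF M] by simp
  \<comment> \<open>One \<kappa> for each position average, and the bracket is the constant of the
    weighted convolution estimate.\<close>
  define E where "E = ennreal C0 * (\<kappa> * \<kappa>) * (2 * ennreal (4 powr s) * D * \<mu>)"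
  have E: "E < top" unfolding E_def using D(1) \<kappa> \<mu> by (simp add: ennreal_mult_less_top)
  have main: "distr_product f g \<in> tempered_distributions \<and>
      modulation_norm \<gamma> p q s (distr_product f g) \<le> E * (modulation_norm \<gamma> p1 q s f * modulation_norm \<gamma> p2 q s g)"
    if f: "f \<in> modulation_space \<gamma> p1 q s" and g: "g \<in> modulation_space \<gamma> p2 q s" for f g
  proof -
    \<comment> \<open>Stated for a generic exponent \<open>r\<close> because it is used for
      \<open>f\<close> with \<open>p1\<close> and for \<open>g\<close> with
      \<open>p2\<close>.\<close>
    have prep: "\<exists>B. locally_bounded_stft (\<lambda>t. stft \<gamma> u (fst t) (snd t)) B" 
      and am: "(\<lambda>\<eta>. Lp_norm r (\<lambda>x. ennreal (norm (stft \<gamma> u x \<eta>)))) \<in> borel_measurable borel"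
      and um: "(\<lambda>t. stft \<gamma> u (fst t) (snd t)) \<in> borel_measurable borel"
      if u: "u \<in> modulation_space \<gamma> r q s" and r: "1 \<le> r" for u r
    proof -
      have t: "u \<in> tempered_distributions" and fin: "modulation_norm \<gamma> r q s u < top"
        using u by (auto simp: modulation_space_def)
      show V: "(\<lambda>t. stft \<gamma> u (fst t) (snd t)) \<in> borel_measurable borel" by (rule measurable_stft[OF \<gamma>(1) t])
      show a: "(\<lambda>\<eta>. Lp_norm r (\<lambda>x. ennreal (norm (stft \<gamma> u x \<eta>)))) \<in> borel_measurable borel"
      proof (rule measurable_Lp_norm[OF r])
        show "(\<lambda>(\<eta>, x). ennreal (norm (stft \<gamma> u x \<eta>))) \<in> borel_measurable (borel \<Otimes>\<^sub>M borel)"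
          using measurable_section[OF V, of snd "borel \<Otimes>\<^sub>M borel" fst] by (simp add: split_beta')
      qed
      have "(\<integral>\<^sup>+\<eta>. Lp_norm r (\<lambda>x. ennreal (norm (stft \<gamma> u x \<eta>))) \<partial>lborel) \<le> D * modulation_norm \<gamma> r q s u"
        unfolding modulation_norm_def by (rule D(2)[OF a])
      also have "\<dots> < top" using D(1) fin by (simp add: ennreal_mult_less_top)
      finally show "\<exists>B. locally_bounded_stft (\<lambda>t. stft \<gamma> u (fst t) (snd t)) B"
        using locally_bounded_stftI[OF r V] by auto
    qed
    let ?V = "\<lambda>t. stft \<gamma> f (fst t) (snd t)" and ?W = "\<lambda>t. stft \<gamma> g (fst t) (snd t)"
    obtain A B where V: "locally_bounded_stft ?V A" and W: "locally_bounded_stft ?W B"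
      using prep[OF f p(2)] prep[OF g p(3)] by blast
    note Vm = um[OF f p(2)] and Wm = um[OF g p(3)]
    let ?F = "\<lambda>y. K * synthesis \<gamma> ?V y" and ?G = "\<lambda>y. K * synthesis \<gamma> ?W y"
    have bc: "(\<lambda>y. K * synthesis \<gamma> X y) \<in> bcontfun" if "locally_bounded_stft X B" for X B
      using synthesis_bcontfun[OF \<gamma>(1) that] 
      by (auto simp: bcontfun_def norm_mult bounded_iff intro!: continuous_intros mult_left_mono exI[of _ "norm K * _"])
    have fF: "f = regular_distribution ?F" using f by (intro K[OF _ V]) (simp add: modulation_space_def)
    have gG: "g = regular_distribution ?G" using g by (intro K[OF _ W]) (simp add: modulation_space_def)
    \<comment> \<open>Here uniqueness of the representative enters: the reconstructed function is
      the one that \<open>cb_function\<close> denotes.\<close>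
    have cf: "cb_function f = ?F" using cb_function_regular_distribution[OF \<gamma> bc[OF V]] fF by simp
    have cg: "cb_function g = ?G" using cb_function_regular_distribution[OF \<gamma> bc[OF W]] gG by simp
    have prod: "distr_product f g = regular_distribution (\<lambda>y. ?F y * ?G y)"
      unfolding distr_product_def cf cg ..
    have FG: "(\<lambda>y. ?F y * ?G y) \<in> bcontfun"
    proof -
      obtain b1 b2 where b: "\<And>y. norm (?F y) \<le> b1" "\<And>y. norm (?G y) \<le> b2"
        using bc[OF V] bc[OF W] unfolding bcontfun_def bounded_iff by blast
      have "norm (?F y * ?G y) \<le> b1 * b2" for y
        unfolding norm_mult[of "?F y"] by (rule mult_mono'[OF b]) simp_all
      moreover have "continuous_on UNIV ?F" "continuous_on UNIV ?G"
        using bc[OF V] bc[OF W] by (simp_all only: bcontfun_def mem_Collect_eq)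
      then have "continuous_on UNIV (\<lambda>y. ?F y * ?G y)" by (rule continuous_on_mult)
      ultimately show ?thesis by (intro bcontfun_normI)
    qed
    have T: "distr_product f g \<in> tempered_distributions"
      unfolding prod by (rule regular_distribution_tempered[OF FG])
    let ?a = "\<lambda>\<eta>. Lp_norm p1 (\<lambda>x. ennreal (norm (stft \<gamma> f x \<eta>)))"
    let ?b = "\<lambda>\<eta>. Lp_norm p2 (\<lambda>x. ennreal (norm (stft \<gamma> g x \<eta>)))"
    have abm[measurable]: "?a \<in> borel_measurable borel" "?b \<in> borel_measurable borel"
      using am[OF f p(2)] am[OF g p(3)] by auto
    have wm: "(\<lambda>(x, \<eta>). window_average X x \<eta>) \<in> borel_measurable (borel \<Otimes>\<^sub>M borel)" 
      if X: "X \<in> borel_measurable borel" for X :: "'a \<times> 'a \<Rightarrow> complex"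
      unfolding window_average_def
      using measurable_section[OF X, of snd "(borel \<Otimes>\<^sub>M borel) \<Otimes>\<^sub>M borel" "\<lambda>p. snd (fst p)"] by measurable
    note [measurable] = wm[OF Vm] wm[OF Wm]
    let ?I = "\<lambda>\<xi>. \<integral>\<^sup>+\<eta>. \<integral>\<^sup>+\<zeta>. ennreal (1 / jb (\<xi> - \<eta> - \<zeta>) ^ M) * (?a \<eta> * ?b \<zeta>) \<partial>lborel \<partial>lborel"
    have hm: "(\<lambda>t. stft \<gamma> (distr_product f g) (fst t) (snd t)) \<in> borel_measurable borel"
      by (rule measurable_stft[OF \<gamma>(1) T])
    \<comment> \<open>Minkowski is applied twice, first in \<eta> and then in \<zeta>. After that
      \<eta> and \<zeta> are fixed, Hoelder separates the two averages in \<open>x\<close>, and each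
      is bounded by Young's inequality.\<close>
    have Lp: "Lp_norm p (\<lambda>x. ennreal (norm (stft \<gamma> (distr_product f g) x \<xi>))) \<le> ennreal C0 * (\<kappa> * \<kappa>) * ?I \<xi>" for \<xi>
    proof -
      let ?P = "\<lambda>x \<eta> \<zeta>. ennreal (1 / jb (\<xi> - \<eta> - \<zeta>) ^ M) * (window_average ?V x \<eta> * window_average ?W x \<zeta>)"
      have "Lp_norm p (\<lambda>x. ennreal (norm (stft \<gamma> (distr_product f g) x \<xi>))) \<le> Lp_norm p (\<lambda>x. ennreal C0 * (\<integral>\<^sup>+\<eta>. \<integral>\<^sup>+\<zeta>. ?P x \<eta> \<zeta> \<partial>lborel \<partial>lborel))"
      proof (rule Lp_norm_mono[OF p(1)])
        show "(\<lambda>x. ennreal (norm (stft \<gamma> (distr_product f g) x \<xi>))) \<in> borel_measurable borel"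
          using measurable_section[OF hm, of "\<lambda>x. x" borel "\<lambda>_. \<xi>"] by simp
      qed (unfold prod, rule C0(2)[OF V W])
      also have "\<dots> \<le> ennreal C0 * Lp_norm p (\<lambda>x. \<integral>\<^sup>+\<eta>. \<integral>\<^sup>+\<zeta>. ?P x \<eta> \<zeta> \<partial>lborel \<partial>lborel)"
        by (rule Lp_norm_cmult_le[OF p(1)]) measurable
      also have "\<dots> \<le> ennreal C0 * (\<integral>\<^sup>+\<eta>. Lp_norm p (\<lambda>x. \<integral>\<^sup>+\<zeta>. ?P x \<eta> \<zeta> \<partial>lborel) \<partial>lborel)"
        by (intro mult_left_mono Minkowski_integral p sigma_finite_lborel) measurable
      also have "\<dots> \<le> ennreal C0 * (\<integral>\<^sup>+\<eta>. \<integral>\<^sup>+\<zeta>. Lp_norm p (\<lambda>x. ?P x \<eta> \<zeta>) \<partial>lborel \<partial>lborel)"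
        by (intro mult_left_mono nn_integral_mono Minkowski_integral p sigma_finite_lborel) measurable
      also have "\<dots> \<le> ennreal C0 * (\<integral>\<^sup>+\<eta>. \<integral>\<^sup>+\<zeta>. (\<kappa> * \<kappa>) * (ennreal (1 / jb (\<xi> - \<eta> - \<zeta>) ^ M) * (?a \<eta> * ?b \<zeta>)) \<partial>lborel \<partial>lborel)"
      proof (intro mult_left_mono nn_integral_mono)
        fix \<eta> \<zeta> :: 'a
        have "Lp_norm p (\<lambda>x. ?P x \<eta> \<zeta>) \<le> ennreal (1 / jb (\<xi> - \<eta> - \<zeta>) ^ M) * Lp_norm p (\<lambda>x. window_average ?V x \<eta> * window_average ?W x \<zeta>)"
          by (rule Lp_norm_cmult_le[OF p(1)]) measurable
        also have "\<dots> \<le> ennreal (1 / jb (\<xi> - \<eta> - \<zeta>) ^ M) * (Lp_norm p1 (\<lambda>x. window_average ?V x \<eta>) * Lp_norm p2 (\<lambda>x. window_average ?W x \<zeta>))"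
          by (intro mult_left_mono Lp_norm_Holder p assms(7)) measurable
        also have "\<dots> \<le> ennreal (1 / jb (\<xi> - \<eta> - \<zeta>) ^ M) * ((\<kappa> * ?a \<eta>) * (\<kappa> * ?b \<zeta>))"
          using Lp_norm_window_average[OF p(2) Vm, of \<eta>] Lp_norm_window_average[OF p(3) Wm, of \<zeta>]
          unfolding \<kappa>_def[symmetric] by (intro mult_left_mono mult_mono) auto
        finally show "Lp_norm p (\<lambda>x. ?P x \<eta> \<zeta>) \<le> (\<kappa> * \<kappa>) * (ennreal (1 / jb (\<xi> - \<eta> - \<zeta>) ^ M) * (?a \<eta> * ?b \<zeta>))"
          by (simp only: mult_ac)
      qed auto
      also have "\<dots> = ennreal C0 * (\<kappa> * \<kappa>) * ?I \<xi>"
        by (simp add: nn_integral_cmult mult.assoc)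
      finally show ?thesis .
    qed
    have "modulation_norm \<gamma> p q s (distr_product f g) \<le> Lp_norm q (\<lambda>\<xi>. (ennreal C0 * (\<kappa> * \<kappa>)) * (?w \<xi> * ?I \<xi>))"
      unfolding modulation_norm_def
    proof (rule Lp_norm_mono[OF q])
      have [measurable]: "(\<lambda>\<xi>. Lp_norm p (\<lambda>x. ennreal (norm (stft \<gamma> (distr_product f g) x \<xi>)))) \<in> borel_measurable borel"
      proof (rule measurable_Lp_norm[OF p(1)])
        show "(\<lambda>(\<eta>, x). ennreal (norm (stft \<gamma> (distr_product f g) x \<eta>))) \<in> borel_measurable (borel \<Otimes>\<^sub>M borel)"
          using measurable_section[OF hm, of snd "borel \<Otimes>\<^sub>M borel" fst] by (simp add: split_beta')
      qed
      show "(\<lambda>\<xi>. ?w \<xi> * Lp_norm p (\<lambda>x. ennreal (norm (stft \<gamma> (distr_product f g) x \<xi>)))) \<in> borel_measurable borel"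
        by measurable
      show "?w \<xi> * Lp_norm p (\<lambda>x. ennreal (norm (stft \<gamma> (distr_product f g) x \<xi>))) \<le> (ennreal C0 * (\<kappa> * \<kappa>)) * (?w \<xi> * ?I \<xi>)" for \<xi>
        using mult_left_mono[OF Lp[of \<xi>], of "?w \<xi>"] by (simp only: mult_ac zero_le)
    qed
    also have "\<dots> \<le> (ennreal C0 * (\<kappa> * \<kappa>)) * Lp_norm q (\<lambda>\<xi>. ?w \<xi> * ?I \<xi>)"
      by (rule Lp_norm_cmult_le[OF q]) measurable
    also have "\<dots> \<le> (ennreal C0 * (\<kappa> * \<kappa>)) * (2 * ennreal (4 powr s) * D * \<mu> * (modulation_norm \<gamma> p1 q s f * modulation_norm \<gamma> p2 q s g))"
      unfolding modulation_norm_def \<mu>_def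
      by (intro mult_left_mono weighted_convolution_bound q s D(2) abm) auto
    finally show ?thesis using T by (simp only: E_def mult.assoc)
  qed
  show ?thesis
  \<comment> \<open>The added 1 makes the constant positive even if \<open>E\<close> is
    zero.\<close>
  proof (intro exI[of _ "enn2real E + 1"] conjI ballI)
    fix f g assume f: "f \<in> modulation_space \<gamma> p1 q s" and g: "g \<in> modulation_space \<gamma> p2 q s"
    have "E \<le> ennreal (enn2real E + 1)" using E by (simp add: ennreal_plus less_top)
    then have "E * (modulation_norm \<gamma> p1 q s f * modulation_norm \<gamma> p2 q s g) \<le> 
        ennreal (enn2real E + 1) * (modulation_norm \<gamma> p1 q s f * modulation_norm \<gamma> p2 q s g)"
      by (rule mult_right_mono) simp
    then show *: "modulation_norm \<gamma> p q s (distr_product f g) \<le> 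
        ennreal (enn2real E + 1) * modulation_norm \<gamma> p1 q s f * modulation_norm \<gamma> p2 q s g"
      using main[OF f g] unfolding mult.assoc by (blast intro: order_trans)
    have "ennreal (enn2real E + 1) * modulation_norm \<gamma> p1 q s f * modulation_norm \<gamma> p2 q s g < top"
      using f g by (auto simp: modulation_space_def ennreal_mult_less_top)
    with * have "modulation_norm \<gamma> p q s (distr_product f g) < top" by (rule le_less_trans)
    then show "distr_product f g \<in> modulation_space \<gamma> p q s"
      using main[OF f g] by (simp add: modulation_space_def)
  qed (simp add: add_nonneg_pos)
qed

end
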